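(* Let $\Omega\subset\mathbb{R}^2$ be the interior of $\{(x,y): -1\le x,y\le 1,\ -1\le x+y\le 1\}$, let $\mathcal{T}=\{K_1,\dots,K_6\}$ be its triangulation into the six triangles described in the context, and for $0<\varepsilon<1$ let $a=a_\varepsilon$ be the piecewise constant function with $a_\varepsilon=1$ on $K_1\cup K_4$ and $a_\varepsilon=\varepsilon^2$ on $K_2\cup K_3\cup K_5\cup K_6$. For measurable $\omega\subset\Omega$ put $|||v|||_{\varepsilon,\omega}=\|a_\varepsilon^{1/2}\nabla v\|_{L^2(\omega)}$. (i) There exist constants $c,C,\varepsilon_0>0$ such that for every $0<\varepsilon<\varepsilon_0$ there is a function $u_\varepsilon\in H^1_0(\Omega)$ with $$\inf_{v\in S^{1,0}(\mathcal{T})\cap H^1_0(\Omega)}|||u_\varepsilon-v|||_{\varepsilon,\Omega}^2\ge c\qquad\text{and}\qquad \sum_{j=1}^6\ \inf_{P\in\mathbb{P}_1(K_j)}|||u_\varepsilon-P|||_{\varepsilon,K_j}^2\le C\varepsilon .$$ In particular, there is no constant $C'$ independent of $\varepsilon$ such that $\inf_{v\in S^{1,0}(\mathcal{T})\cap H^1_0(\Omega)}|||u-v|||_{\varepsilon,\Omega}^2\le C'\sum_{j=1}^6\inf_{P\in\mathbb{P}_1(K_j)}|||u-P|||_{\varepsilon,K_j}^2$ for all $u\in H^1_0(\Omega)$ and all $\varepsilon\in(0,1)$. (ii) There is also no constant $C''$ independent of $\varepsilon$ such that $$\inf_{v\in S^{1,0}(\mathcal{T})\cap H^1_0(\Omega)}|||u-v|||_{\varepsilon,\Omega}^2\le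 C''\sum_{F}\ \inf_{V\in S^{1,0}(\mathcal{T})|_{\omega_F}}|||u-V|||_{\varepsilon,\omega_F}^2$$ for all $u\in H^1_0(\Omega)$ and all $\varepsilon\in(0,1)$, where the sum runs over the interior edges $F$ of $\mathcal{T}$ and $\omega_F$ is the union of the two triangles sharing the edge $F$.
   Context: The six triangles, all having the origin as a vertex, are $K_1=\mathrm{conv}\{(0,0),(1,0),(0,1)\}$, $K_2=\mathrm{conv}\{(0,0),(0,1),(-1,1)\}$, $K_3=\mathrm{conv}\{(0,0),(-1,1),(-1,0)\}$, $K_4=\mathrm{conv}\{(0,0),(-1,0),(0,-1)\}$, $K_5=\mathrm{conv}\{(0,0),(0,-1),(1,-1)\}$, $K_6=\mathrm{conv}\{(0,0),(1,-1),(1,0)\}$. $\mathbb{P}_1(K)$ is the space of affine functions on $K$. $S^{1,0}(\mathcal{T})$ is the space of continuous functions on $\overline\Omega$ that are affine on each $K_j$, and $S^{1,0}(\mathcal{T})|_{\omega}$ is the space of restrictions to $\omega$ of functions in $S^{1,0}(\mathcal{T})$ (no boundary condition is imposed on these local spaces). *)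

theory Defs
  imports "HOL-Analysis.Analysis"
begin

fun C_k :: "nat \<Rightarrow> ('a::euclidean_space \<Rightarrow> real) \<Rightarrow> bool" where
  "C_k 0 f \<longleftrightarrow> continuous_on UNIV f"
| "C_k (Suc k) f \<longleftrightarrow>
     f differentiable_on UNIV \<and> (\<forall>v. C_k k (\<lambda>x. frechet_derivative f (at x) v))"

definition test_functions :: "'a::euclidean_space set \<Rightarrow> ('a \<Rightarrow> real) set" where
  "test_functions U = {\<phi>. (\<forall>k. C_k k \<phi>) \<and>
     compact (closure {x. \<phi> x \<noteq> 0}) \<and> closure {x. \<phi> x \<noteq> 0} \<subseteq> U}"

definition grad :: "('a::euclidean_space \<Rightarrow> real) \<Rightarrow> 'a \<Rightarrow> 'a" where
  "grad f x = (\<Sum>b\<in>Basis. frechet_derivative f (at x) b *\<^sub>R b)"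

definition square_integrable_on ::
    "('a::euclidean_space \<Rightarrow> 'b::euclidean_space) \<Rightarrow> 'a set \<Rightarrow> bool"
    (infixr \<open>square'_integrable'_on\<close> 46) where
  "f square_integrable_on S \<longleftrightarrow> f \<in> borel_measurable (lebesgue_on S) \<and>
     integrable (lebesgue_on S) (\<lambda>x. (norm (f x))\<^sup>2)"

definition L2_norm :: "'a::euclidean_space set \<Rightarrow> ('a \<Rightarrow> 'b::euclidean_space) \<Rightarrow> real" where
  "L2_norm S f = sqrt (\<integral>x. (norm (f x))\<^sup>2 \<partial>lebesgue_on S)"

definition is_weak_grad ::
    "'a::euclidean_space set \<Rightarrow> ('a \<Rightarrow> real) \<Rightarrow> ('a \<Rightarrow> 'a) \<Rightarrow> bool" where
  "is_weak_grad U u g \<longleftrightarrow> g square_integrable_on U \<and>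
     (\<forall>\<phi>\<in>test_functions U.
        (\<integral>x. u x *\<^sub>R grad \<phi> x \<partial>lebesgue_on U) = - (\<integral>x. \<phi> x *\<^sub>R g x \<partial>lebesgue_on U))"

text \<open>Elements of Sobolev spaces are represented by functions on the whole space; only their
  values (almost everywhere) on \<open>U\<close> matter.\<close>

definition H1 :: "'a::euclidean_space set \<Rightarrow> ('a \<Rightarrow> real) set" where
  "H1 U = {u. u square_integrable_on U \<and> (\<exists>g. is_weak_grad U u g)}"

definition weak_grad :: "'a::euclidean_space set \<Rightarrow> ('a \<Rightarrow> real) \<Rightarrow> 'a \<Rightarrow> 'a" where
  "weak_grad U u = (SOME g. is_weak_grad U u g)"

definition H1_norm :: "'a::euclidean_space set \<Rightarrow> ('a \<Rightarrow> real) \<Rightarrow> real" where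
  "H1_norm U u = sqrt ((L2_norm U u)\<^sup>2 + (L2_norm U (weak_grad U u))\<^sup>2)"

definition H10 :: "'a::euclidean_space set \<Rightarrow> ('a \<Rightarrow> real) set" where
  "H10 U = {u \<in> H1 U. \<exists>\<phi>. (\<forall>n. \<phi> n \<in> test_functions U) \<and>
     (\<lambda>n::nat. H1_norm U (\<lambda>x. u x - \<phi> n x)) \<longlonglongrightarrow> 0}"

definition Omega :: "(real \<times> real) set" where
  "Omega = interior {(x, y). -1 \<le> x \<and> x \<le> 1 \<and> -1 \<le> y \<and> y \<le> 1 \<and> -1 \<le> x + y \<and> x + y \<le> 1}"

definition K1 :: "(real \<times> real) set" where "K1 = convex hull {(0, 0), (1, 0), (0, 1)}"
definition K2 :: "(real \<times> real) set" where "K2 = convex hull {(0, 0), (0, 1), (-1, 1)}"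
definition K3 :: "(real \<times> real) set" where "K3 = convex hull {(0, 0), (-1, 1), (-1, 0)}"
definition K4 :: "(real \<times> real) set" where "K4 = convex hull {(0, 0), (-1, 0), (0, -1)}"
definition K5 :: "(real \<times> real) set" where "K5 = convex hull {(0, 0), (0, -1), (1, -1)}"
definition K6 :: "(real \<times> real) set" where "K6 = convex hull {(0, 0), (1, -1), (1, 0)}"

definition Triangulation :: "(real \<times> real) set set" where
  "Triangulation = {K1, K2, K3, K4, K5, K6}"

definition interior_edges :: "(real \<times> real) set set" where
  "interior_edges = {F. \<exists>K\<in>Triangulation. \<exists>K'\<in>Triangulation.
     K \<noteq> K' \<and> F edge_of K \<and> F edge_of K'}"

definition edge_patch :: "(real \<times> real) set \<Rightarrow> (real \<times> real) set" where
  "edge_patch F = \<Union>{K \<in> Triangulation. F edge_of K}"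

definition P1 :: "(real \<times> real) set \<Rightarrow> (real \<times> real \<Rightarrow> real) set" where
  "P1 K = {P. \<exists>l b. linear l \<and> (\<forall>x\<in>K. P x = l x + b)}"

definition S10 :: "(real \<times> real \<Rightarrow> real) set" where
  "S10 = {v. continuous_on (closure Omega) v \<and> (\<forall>K\<in>Triangulation. v \<in> P1 K)}"

definition S10_restricted :: "(real \<times> real) set \<Rightarrow> (real \<times> real \<Rightarrow> real) set" where
  "S10_restricted \<omega> = (\<lambda>V. restrict V \<omega>) ` S10"

text \<open>On the common edges of the triangles, a null set, the value is immaterial.\<close>

definition coeff :: "real \<Rightarrow> real \<times> real \<Rightarrow> real" where
  "coeff \<epsilon> x = (if x \<in> K1 \<union> K4 then 1 else \<epsilon>\<^sup>2)"

text \<open>The energy norm of \<open>v\<close> over a measurable set \<open>\<omega>\<close>. Since the local functions \<open>P\<close> and \<open>V\<close> live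
  only on a triangle or an edge patch, the open set \<open>U\<close> on which the weak gradient of \<open>v\<close> is taken
  is a separate argument: \<open>v \<in> H1 U\<close>, and \<open>U\<close> covers \<open>\<omega>\<close> up to a null set.\<close>

definition energy_norm ::
    "real \<Rightarrow> (real \<times> real) set \<Rightarrow> (real \<times> real) set \<Rightarrow> (real \<times> real \<Rightarrow> real) \<Rightarrow> real" where
  "energy_norm \<epsilon> U \<omega> v = L2_norm \<omega> (\<lambda>x. sqrt (coeff \<epsilon> x) *\<^sub>R weak_grad U v x)"

definition global_error :: "real \<Rightarrow> (real \<times> real \<Rightarrow> real) \<Rightarrow> real" where
  "global_error \<epsilon> u = (INF v\<in>S10 \<inter> H10 Omega. (energy_norm \<epsilon> Omega Omega (\<lambda>x. u x - v x))\<^sup>2)"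

definition element_error :: "real \<Rightarrow> (real \<times> real) set \<Rightarrow> (real \<times> real \<Rightarrow> real) \<Rightarrow> real" where
  "element_error \<epsilon> K u = (INF P\<in>P1 K. (energy_norm \<epsilon> (interior K) K (\<lambda>x. u x - P x))\<^sup>2)"

definition patch_error :: "real \<Rightarrow> (real \<times> real) set \<Rightarrow> (real \<times> real \<Rightarrow> real) \<Rightarrow> real" where
  "patch_error \<epsilon> \<omega> u =
     (INF V\<in>S10_restricted \<omega>. (energy_norm \<epsilon> (interior \<omega>) \<omega> (\<lambda>x. u x - V x))\<^sup>2)"

end

theory Submission
  imports Defs
begin

text \<open>
  The coefficient is \<open>1\<close> on the two triangles \<open>K1\<close> and \<open>K4\<close>, which touch only at the origin. A finite
  element function \<open>v\<close> with zero boundary values is \<open>\<alpha> (1 - x - y)\<close> on \<open>K1\<close> and \<open>\<alpha> (1 + x + y)\<close> on \<open>K4\<close>, where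
  \<open>\<alpha>\<close> is its value at the origin. A function \<open>u\<close> that is close to \<open>1 - x - y\<close> on \<open>K1\<close> and vanishes on \<open>K4\<close> is
  therefore far from all \<open>v\<close> in the energy norm (\<open>global_error_ge\<close>), although it is well approximated on
  each triangle, and on each edge patch, since no patch contains both \<open>K1\<close> and \<open>K4\<close>
  (\<open>local_errors_le\<close>, \<open>not_edge_of_K1_K4\<close>).

  Such \<open>u\<close> exist because a point has capacity zero in the plane and the other coefficients are small. In
  polar coordinates take \<open>u = r\<^sup>\<epsilon> \<psi> (1 - x - y)\<close>, where the angular factor \<open>\<psi>\<close> is \<open>1\<close> on \<open>K1\<close> and falls to \<open>0\<close> inside
  the neighbouring triangles. On \<open>K1\<close> the factor \<open>r\<^sup>\<epsilon>\<close> costs the energy \<open>\<integral> \<epsilon>\<^sup>2 r\<^bsup>2 \<epsilon> - 2\<^esup>\<close>, and on the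
  neighbours the angular factor costs \<open>\<epsilon>\<^sup>2 \<integral> r\<^bsup>2 \<epsilon> - 2\<^esup>\<close>; both are of order \<open>\<epsilon>\<close> because the integral is of
  order \<open>1 / \<epsilon>\<close> (\<open>integral_reg_square_powr_le\<close>).

  To stay with test functions, whose weak gradients are classical and which lie in \<open>H\<^sup>1\<^sub>0\<close> trivially, \<open>u\<close> is
  regularized: \<open>r\<^sup>2\<close> is replaced by \<open>r\<^sup>2 + d\<^sup>2\<close> with \<open>d\<^bsup>2 \<epsilon>\<^esup> = \<epsilon>\<close>, and a smooth cut-off acts in a layer of width \<open>\<epsilon>\<close>
  along the boundary. Both changes cost energy of order \<open>\<epsilon>\<close> (\<open>grad_singular_function_K1\<close>,
  \<open>grad_singular_function\<close>, \<open>energy_majorant_integral\<close>).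

  Weak gradients are chosen by the definition of \<^const>\<open>weak_grad\<close>, so their uniqueness up to null sets is
  needed (\<open>is_weak_grad_AE_unique\<close>). That functions in \<^term>\<open>S10 \<inter> H10 Omega\<close> vanish at the boundary vertices
  (\<open>S10_H10_boundary_values\<close>) follows by testing them on thin boxes along the sides of the hexagon: the
  integral of a test function over such a box is at most its width times the integral of the gradient.
\<close>

section \<open>Functions with continuous derivatives of all orders\<close>

lemma frechet_derivative_eqI:
  "(f has_derivative f') (at x) \<Longrightarrow> frechet_derivative f (at x) v = f' v"
  using frechet_derivative_at by metis

lemma C_k_Suc_I:
  assumes "\<And>x. (f has_derivative f' x) (at x)" and "\<And>v. C_k k (\<lambda>x. f' x v)"
  shows "C_k (Suc k) f"
proof -
  have "frechet_derivative f (at x) v = f' x v" for x v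
    using assms(1) by (rule frechet_derivative_eqI)
  moreover have "f differentiable_on UNIV"
    using assms(1) unfolding differentiable_on_def differentiable_def by auto
  ultimately show ?thesis using assms(2) by simp
qed

lemma C_k_SucD:
  assumes "C_k (Suc k) f"
  shows "(f has_derivative frechet_derivative f (at x)) (at x)"
    and "C_k k (\<lambda>x. frechet_derivative f (at x) v)"
  using assms by (auto simp: differentiable_on_def frechet_derivative_works)

lemma C_k_continuous: "C_k k f \<Longrightarrow> continuous_on UNIV f"
  by (cases k) (simp_all add: differentiable_imp_continuous_on)

lemma C_k_Suc_imp: "C_k (Suc k) f \<Longrightarrow> C_k k f"
proof (induction k arbitrary: f)
  case 0
  then show ?case using C_k_continuous[of "Suc 0"] by (simp only: C_k.simps(1))
next
  case (Suc k)
  then show ?case by (metis C_k.simps(2))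
qed

lemma C_k_const: "C_k k (\<lambda>x. c)"
proof (induction k arbitrary: c)
  case (Suc k)
  show ?case by (rule C_k_Suc_I[OF has_derivative_const]) (rule Suc.IH)
qed simp

lemma C_k_linear:
  assumes "bounded_linear l"
  shows "C_k k (\<lambda>x. l x)"
proof (cases k)
  case 0
  then show ?thesis using assms by (simp add: linear_continuous_on)
next
  case (Suc j)
  show ?thesis unfolding Suc
    by (rule C_k_Suc_I[OF bounded_linear_imp_has_derivative[OF assms]]) (rule C_k_const)
qed

lemma C_k_add:
  assumes "C_k k f" "C_k k g"
  shows "C_k k (\<lambda>x. f x + g x)"
  using assms
proof (induction k arbitrary: f g)
  case 0
  then show ?case by (auto intro: continuous_intros)
next
  case (Suc k)
  show ?case
    by (rule C_k_Suc_I[OF has_derivative_add[OF C_k_SucD(1)[OF Suc.prems(1)] C_k_SucD(1)[OF Suc.prems(2)]]])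
       (intro Suc.IH C_k_SucD(2) Suc.prems)
qed

lemma C_k_mult:
  assumes "C_k k f" "C_k k g"
  shows "C_k k (\<lambda>x. f x * g x)"
  using assms
proof (induction k arbitrary: f g)
  case 0
  then show ?case by (auto intro: continuous_intros)
next
  case (Suc k)
  show ?case
    by (rule C_k_Suc_I[OF has_derivative_mult[OF C_k_SucD(1)[OF Suc.prems(1)] C_k_SucD(1)[OF Suc.prems(2)]]])
       (intro C_k_add Suc.IH C_k_SucD(2) Suc.prems C_k_Suc_imp)
qed

lemma C_k_diff:
  assumes "C_k k f" "C_k k g"
  shows "C_k k (\<lambda>x. f x - g x)"
  using C_k_add[OF assms(1) C_k_mult[OF C_k_const[of k "-1"] assms(2)]] by simp

lemma C_k_compose:
  fixes h :: "real \<Rightarrow> real"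
  assumes "C_k k h" "C_k k f"
  shows "C_k k (\<lambda>x. h (f x))"
  using assms
proof (induction k arbitrary: h f)
  case 0
  then show ?case by (auto intro: continuous_on_compose2)
next
  case (Suc k)
  define h' where "h' t = frechet_derivative h (at t) 1" for t
  have lin: "frechet_derivative h (at t) v = h' t * v" for t v
  proof -
    have "linear (frechet_derivative h (at t))"
      using C_k_SucD(1)[OF Suc.prems(1)] has_derivative_linear by blast
    from linear_scale[OF this, of v 1] show ?thesis by (simp add: h'_def)
  qed
  have h': "C_k k h'" unfolding h'_def by (rule C_k_SucD(2)[OF Suc.prems(1)])
  have "((\<lambda>x. h (f x)) has_derivative (\<lambda>v. h' (f x) * frechet_derivative f (at x) v)) (at x)" for x
    using has_derivative_compose[OF C_k_SucD(1)[OF Suc.prems(2)] C_k_SucD(1)[OF Suc.prems(1)], of x]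
    by (simp add: lin)
  then show ?case
    by (rule C_k_Suc_I)
      (rule C_k_mult[OF Suc.IH[OF h' C_k_Suc_imp[OF Suc.prems(2)]] C_k_SucD(2)[OF Suc.prems(2)]])
qed

lemma C_k_powr:
  assumes "C_k k f" "\<And>x. f x > 0"
  shows "C_k k (\<lambda>x. f x powr a)"
  using assms
proof (induction k arbitrary: a)
  case 0
  then show ?case by (auto intro!: continuous_intros simp: less_imp_neq[symmetric])
next
  case (Suc k)
  have "((\<lambda>x. f x powr a) has_derivative
      (\<lambda>v. (a * f x powr (a - 1)) * frechet_derivative f (at x) v)) (at x)" for x
  proof -
    have "((\<lambda>t. t powr a) has_real_derivative a * f x powr (a - 1)) (at (f x))"
      using Suc.prems(2)[of x] by (auto intro!: derivative_eq_intros)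
    from has_derivative_compose[OF C_k_SucD(1)[OF Suc.prems(1)] this[unfolded has_field_derivative_def]]
    show ?thesis by simp
  qed
  then show ?case
    by (rule C_k_Suc_I) (intro C_k_mult C_k_const Suc.IH Suc.prems C_k_SucD(2) C_k_Suc_imp[OF Suc.prems(1)])
qed

section \<open>A smooth step\<close>

text \<open>The functions \<open>t\<^bsup>-n\<^esup> exp (- 1 / t)\<close> for \<open>t > 0\<close>, continued by zero. This family is closed under
  differentiation up to linear combinations.\<close>

definition flat_exp :: "nat \<Rightarrow> real \<Rightarrow> real" where
  "flat_exp n t = (if t > 0 then exp (- (1 / t)) / t ^ n else 0)"

lemma flat_exp_tendsto_0: "(flat_exp n \<longlongrightarrow> 0) (at 0)"
proof -
  have "((\<lambda>s. s ^ n / exp s) \<longlongrightarrow> 0) (at_top :: real filter)"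
    by (rule tendsto_power_div_exp_0)
  then have "((\<lambda>t::real. (inverse t) ^ n / exp (inverse t)) \<longlongrightarrow> 0) (at_right 0)"
    using filterlim_inverse_at_top_right by (rule filterlim_compose)
  then have "(flat_exp n \<longlongrightarrow> 0) (at_right 0)"
    by (rule Lim_transform_eventually)
       (auto simp: flat_exp_def eventually_at_filter exp_minus field_simps)
  moreover have "(flat_exp n \<longlongrightarrow> 0) (at_left 0)"
    by (rule Lim_transform_eventually[OF tendsto_const])
       (auto simp: flat_exp_def eventually_at_filter)
  ultimately show ?thesis by (simp add: filterlim_at_split)
qed

lemma flat_exp_deriv:
  "(flat_exp n has_real_derivative flat_exp (n + 2) t - real n * flat_exp (n + 1) t) (at t)"
proof (cases t "0::real" rule: linorder_cases)
  case less
  have "((\<lambda>_. 0) has_real_derivative 0) (at t)" by simp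
  then have "(flat_exp n has_real_derivative 0) (at t)"
    by (rule DERIV_cong_ev[THEN iffD1, rotated -1])
       (use less in \<open>auto simp: flat_exp_def intro!: eventually_nhds_in_open[of "{..<0}", THEN eventually_mono]\<close>)
  then show ?thesis using less by (simp add: flat_exp_def)
next
  case equal
  have "((\<lambda>h. (flat_exp n (0 + h) - flat_exp n 0) / h) \<longlongrightarrow> 0) (at 0)"
    by (rule Lim_transform_eventually[OF flat_exp_tendsto_0[of "Suc n"]])
       (auto simp: flat_exp_def eventually_at_filter)
  then show ?thesis using equal by (simp add: flat_exp_def DERIV_def)
next
  case greater
  have "((\<lambda>t. exp (- (1 / t)) / t ^ n) has_real_derivative
      flat_exp (n + 2) t - real n * flat_exp (n + 1) t) (at t)"
  proof (cases n)
    case 0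
    then show ?thesis using greater
      by (auto intro!: derivative_eq_intros simp: flat_exp_def field_simps power2_eq_square)
  next
    case (Suc m)
    have "t ^ n = t * t ^ m" by (simp add: Suc)
    then show ?thesis using greater
      by (auto intro!: derivative_eq_intros simp: flat_exp_def divide_simps power_add Suc)
        (cases m; simp add: algebra_simps power2_eq_square)
  qed
  then show ?thesis
    by (rule DERIV_cong_ev[THEN iffD1, rotated -1])
       (use greater in \<open>auto simp: flat_exp_def intro!: eventually_nhds_in_open[of "{0<..}", THEN eventually_mono]\<close>)
qed

lemma C_k_flat_exp: "C_k k (flat_exp n)"
proof (induction k arbitrary: n)
  case 0
  show ?case using flat_exp_deriv
    by (auto intro!: continuous_at_imp_continuous_on DERIV_isCont)
next
  case (Suc k)
  show ?case
    by (rule C_k_Suc_I[OF flat_exp_deriv[unfolded has_field_derivative_def]])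
       (intro C_k_mult C_k_diff C_k_const Suc.IH)
qed

text \<open>A smooth transition: \<open>0\<close> for \<open>t \<le> 1/4\<close>, \<open>1\<close> for \<open>t \<ge> 1\<close>, with values in \<open>[0, 1]\<close>. The
  reciprocal is written as a real power so that \<open>C_k_powr\<close> applies.\<close>

definition smooth_step :: "real \<Rightarrow> real" where
  "smooth_step t = flat_exp 0 (t - 1/4) * (flat_exp 0 (t - 1/4) + flat_exp 0 (1 - t)) powr (-1)"

lemma smooth_step_denominator_pos: "flat_exp 0 (t - 1/4) + flat_exp 0 (1 - t) > 0"
  by (auto simp: flat_exp_def add_pos_pos)

lemma smooth_step_ge_0: "0 \<le> smooth_step t"
  by (simp add: smooth_step_def flat_exp_def)

lemma smooth_step_le_1: "smooth_step t \<le> 1"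
proof -
  have "flat_exp 0 (1 - t) \<ge> 0" by (simp add: flat_exp_def)
  then show ?thesis
    using smooth_step_denominator_pos[of t] by (simp add: smooth_step_def powr_minus field_simps)
qed

lemma smooth_step_eq_0: "t \<le> 1/4 \<Longrightarrow> smooth_step t = 0"
  by (simp add: smooth_step_def flat_exp_def)

lemma smooth_step_eq_1: "t \<ge> 1 \<Longrightarrow> smooth_step t = 1"
  using smooth_step_denominator_pos[of t] by (simp add: smooth_step_def flat_exp_def powr_minus)

lemma C_k_smooth_step: "C_k k smooth_step"
proof -
  have a: "C_k k (\<lambda>t. flat_exp 0 (t - 1/4))"
    by (intro C_k_compose[OF C_k_flat_exp] C_k_diff C_k_const C_k_linear bounded_linear_ident)
  have b: "C_k k (\<lambda>t. flat_exp 0 (1 - t))"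
    by (intro C_k_compose[OF C_k_flat_exp] C_k_diff C_k_const C_k_linear bounded_linear_ident)
  show ?thesis unfolding smooth_step_def[abs_def]
    by (intro C_k_mult C_k_powr C_k_add a b smooth_step_denominator_pos)
qed

lemma smooth_step_deriv: "(smooth_step has_real_derivative deriv smooth_step t) (at t)"
proof -
  have "smooth_step differentiable (at t)"
    using C_k_smooth_step[of "Suc 0"] by (simp add: differentiable_on_def)
  then show ?thesis using DERIV_deriv_iff_real_differentiable by blast
qed

text \<open>At these points the step attains its minimum or its maximum.\<close>

lemma smooth_step_deriv_eq_0:
  assumes "t \<le> 1/4 \<or> t \<ge> 1"
  shows "deriv smooth_step t = 0"
proof (cases "t \<le> 1/4")
  case True
  then show ?thesis
    using smooth_step_deriv smooth_step_ge_0 smooth_step_eq_0 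
    by (metis DERIV_local_min zero_less_one)
next
  case False
  then show ?thesis
    using assms smooth_step_deriv smooth_step_le_1 smooth_step_eq_1 
    by (metis DERIV_local_max zero_less_one)
qed

lemma smooth_step_deriv_bounded: "\<exists>M\<ge>1. \<forall>t. \<bar>deriv smooth_step t\<bar> \<le> M"
proof -
  have eq: "deriv smooth_step t = frechet_derivative smooth_step (at t) 1" for t
    using frechet_derivative_eqI[OF smooth_step_deriv[unfolded has_field_derivative_def], of t 1] by simp
  have "continuous_on UNIV (deriv smooth_step)"
    unfolding eq[abs_def] by (rule C_k_continuous[OF C_k_SucD(2)[OF C_k_smooth_step, of 0]])
  then have "compact (deriv smooth_step ` {1/4..1})"
    by (intro compact_continuous_image) (auto intro: continuous_on_subset)
  then obtain M where M: "\<And>t. t \<in> {1/4..1} \<Longrightarrow> \<bar>deriv smooth_step t\<bar> \<le> M"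
    using compact_imp_bounded bounded_iff by (metis imageI real_norm_def)
  have "\<bar>deriv smooth_step t\<bar> \<le> max 1 M" for t
    using M[of t] smooth_step_deriv_eq_0[of t] by (cases "t \<le> 1/4 \<or> t \<ge> 1") auto
  then show ?thesis by (intro exI[of _ "max 1 M"]) auto
qed

section \<open>Gradients of functions of two variables\<close>

lemma grad_pair:
  fixes f :: "real \<times> real \<Rightarrow> real"
  shows "grad f z = (frechet_derivative f (at z) (1, 0), frechet_derivative f (at z) (0, 1))"
  by (simp add: grad_def Basis_prod_def sum.union_disjoint image_iff scaleR_prod_def)

lemma has_derivative_imp_grad:
  fixes f :: "real \<times> real \<Rightarrow> real"
  assumes "(f has_derivative f') (at z)"
  shows "grad f z = (f' (1, 0), f' (0, 1))" and "f' v = grad f z \<bullet> v"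
proof -
  show eq: "grad f z = (f' (1, 0), f' (0, 1))"
    using assms by (simp add: grad_pair frechet_derivative_eqI)
  interpret linear f' using assms by (rule has_derivative_linear)
  have "v = fst v *\<^sub>R (1, 0) + snd v *\<^sub>R (0, 1)" by (cases v) simp
  then have "f' v = fst v * f' (1, 0) + snd v * f' (0, 1)"
    by (metis add scale real_scaleR_def)
  then show "f' v = grad f z \<bullet> v" by (simp add: eq inner_prod_def mult.commute)
qed

lemma norm_grad_le:
  fixes f :: "real \<times> real \<Rightarrow> real"
  assumes "(f has_derivative f') (at z)" "\<And>v. \<bar>f' v\<bar> \<le> L * norm v" "L \<ge> 0"
  shows "norm (grad f z) \<le> L"
proof -
  have "norm (grad f z) * norm (grad f z) = f' (grad f z)"
    unfolding has_derivative_imp_grad(2)[OF assms(1)]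
    by (simp add: power2_norm_eq_inner flip: power2_eq_square)
  also have "\<dots> \<le> L * norm (grad f z)" using assms(2)[of "grad f z"] by simp
  finally show ?thesis using assms(3)
    by (metis mult_right_le_imp_le norm_ge_zero norm_zero order_le_less)
qed

lemma grad_mult:
  fixes f g :: "real \<times> real \<Rightarrow> real"
  assumes "C_k (Suc 0) f" "C_k (Suc 0) g"
  shows "grad (\<lambda>z. f z * g z) z = f z *\<^sub>R grad g z + g z *\<^sub>R grad f z"
  using has_derivative_imp_grad(1)[OF has_derivative_mult[OF C_k_SucD(1)[OF assms(1)] C_k_SucD(1)[OF assms(2)]]]
  by (simp add: grad_pair mult.commute)

lemma grad_diff:
  fixes f g :: "real \<times> real \<Rightarrow> real"
  assumes "C_k (Suc 0) f" "C_k (Suc 0) g"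
  shows "grad (\<lambda>z. f z - g z) z = grad f z - grad g z"
  using has_derivative_imp_grad(1)[OF has_derivative_diff[OF C_k_SucD(1)[OF assms(1)] C_k_SucD(1)[OF assms(2)]]]
  by (simp add: grad_pair)

lemma continuous_on_grad:
  fixes f :: "real \<times> real \<Rightarrow> real"
  assumes "C_k (Suc 0) f"
  shows "continuous_on UNIV (grad f)"
  unfolding grad_pair[abs_def]
  by (intro continuous_on_Pair C_k_continuous[OF C_k_SucD(2)[OF assms]])

lemma grad_eq_0_if_locally_0:
  fixes f :: "real \<times> real \<Rightarrow> real"
  assumes "open S" "z \<in> S" "\<And>w. w \<in> S \<Longrightarrow> f w = 0"
  shows "grad f z = 0"
proof -
  have "(f has_derivative (\<lambda>_. 0)) (at z)"
    by (rule has_derivative_transform_within_open[OF has_derivative_const assms(1,2)])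
      (simp add: assms(3))
  from has_derivative_imp_grad(1)[OF this] show ?thesis unfolding zero_prod_def .
qed

lemma test_function_C_k: "\<phi> \<in> test_functions U \<Longrightarrow> C_k k \<phi>"
  by (simp add: test_functions_def)

lemma test_function_eq_0: "\<phi> \<in> test_functions U \<Longrightarrow> z \<notin> U \<Longrightarrow> \<phi> z = 0"
  using closure_subset[of "{x. \<phi> x \<noteq> 0}"] unfolding test_functions_def by blast

lemma grad_test_function_eq_0:
  fixes \<phi> :: "real \<times> real \<Rightarrow> real"
  assumes "z \<notin> closure {x. \<phi> x \<noteq> 0}"
  shows "grad \<phi> z = 0"
  by (rule grad_eq_0_if_locally_0[of "- closure {x. \<phi> x \<noteq> 0}"])
     (use assms closure_subset[of "{x. \<phi> x \<noteq> 0}"] in \<open>auto simp: open_Compl\<close>)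

lemma test_functions_mono: "U \<subseteq> V \<Longrightarrow> test_functions U \<subseteq> test_functions V"
  by (auto simp: test_functions_def)

section \<open>Integration over boxes\<close>

lemma integral_partial_derivatives_box:
  fixes w :: "real \<times> real \<Rightarrow> real"
  assumes w: "C_k (Suc 0) w" and "a1 \<le> b1" "a2 \<le> b2"
  shows "integral (cbox (a1, a2) (b1, b2)) (\<lambda>z. frechet_derivative w (at z) (1, 0))
      = integral {a2..b2} (\<lambda>y. w (b1, y) - w (a1, y))" (is ?x)
    and "integral (cbox (a1, a2) (b1, b2)) (\<lambda>z. frechet_derivative w (at z) (0, 1))
      = integral {a1..b1} (\<lambda>x. w (x, b2) - w (x, a2))" (is ?y)
proof -
  have cont: "continuous_on S (\<lambda>z. frechet_derivative w (at z) v)" for v S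
    using C_k_continuous[OF C_k_SucD(2)[OF w]] continuous_on_subset by blast
  have dx: "((\<lambda>x. w (x, y)) has_vector_derivative frechet_derivative w (at (x, y)) (1, 0)) (at x within S)"
    for x y S
  proof -
    have lin: "linear (frechet_derivative w (at (x, y)))"
      using C_k_SucD(1)[OF w] has_derivative_linear by blast
    have "((\<lambda>x. (x, y)) has_derivative (\<lambda>h. (h, 0))) (at x within S)"
      by (auto intro!: derivative_eq_intros)
    from has_derivative_compose[OF this C_k_SucD(1)[OF w]]
    moreover have "(\<lambda>h. frechet_derivative w (at (x, y)) (h, 0)) = (\<lambda>h. h *\<^sub>R frechet_derivative w (at (x, y)) (1, 0))"
      unfolding linear_scale[OF lin, symmetric] by (simp add: scaleR_prod_def)
    ultimately show ?thesis by (simp only: has_vector_derivative_def)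
  qed
  have dy: "((\<lambda>y. w (x, y)) has_vector_derivative frechet_derivative w (at (x, y)) (0, 1)) (at y within S)"
    for x y S
  proof -
    have lin: "linear (frechet_derivative w (at (x, y)))"
      using C_k_SucD(1)[OF w] has_derivative_linear by blast
    have "((\<lambda>y. (x, y)) has_derivative (\<lambda>h. (0, h))) (at y within S)"
      by (auto intro!: derivative_eq_intros)
    from has_derivative_compose[OF this C_k_SucD(1)[OF w]]
    moreover have "(\<lambda>h. frechet_derivative w (at (x, y)) (0, h)) = (\<lambda>h. h *\<^sub>R frechet_derivative w (at (x, y)) (0, 1))"
      unfolding linear_scale[OF lin, symmetric] by (simp add: scaleR_prod_def)
    ultimately show ?thesis by (simp only: has_vector_derivative_def)
  qed
  have "integral {a1..b1} (\<lambda>x. frechet_derivative w (at (x, y)) (1, 0)) = w (b1, y) - w (a1, y)" for y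
    by (intro integral_unique fundamental_theorem_of_calculus assms dx)
  then show ?x
    using integral_prod_continuous[OF cont, of a1 a2 b1 b2 "(1, 0)"]
      integral_swap_continuous[of a1 a2 b1 b2 "\<lambda>x y. frechet_derivative w (at (x, y)) (1, 0)"]
      cont[of "cbox (a1, a2) (b1, b2)" "(1, 0)"]
    by (simp add: split_def)
  have "integral {a2..b2} (\<lambda>y. frechet_derivative w (at (x, y)) (0, 1)) = w (x, b2) - w (x, a2)" for x
    by (intro integral_unique fundamental_theorem_of_calculus assms dy)
  then show ?y
    using integral_prod_continuous[OF cont, of a1 a2 b1 b2 "(0, 1)"] by simp
qed

lemma borel_measurable_lebesgue_on_continuous:
  fixes f :: "'a::euclidean_space \<Rightarrow> 'b::topological_space"
  shows "continuous_on UNIV f \<Longrightarrow> f \<in> borel_measurable (lebesgue_on S)"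
  by (intro measurable_restrict_space1 measurable_completion) (simp add: borel_measurable_continuous_onI)

lemma integral_lebesgue_on_eq:
  fixes f :: "'a::euclidean_space \<Rightarrow> 'b::euclidean_space"
  assumes "S \<in> sets lebesgue" "T \<in> sets lebesgue"
    and "\<And>x. x \<in> S \<Longrightarrow> x \<notin> T \<Longrightarrow> f x = 0" "\<And>x. x \<in> T \<Longrightarrow> x \<notin> S \<Longrightarrow> f x = 0"
  shows "integral\<^sup>L (lebesgue_on S) f = integral\<^sup>L (lebesgue_on T) f"
proof -
  have "(\<lambda>x. if x \<in> S then f x else 0) = (\<lambda>x. if x \<in> T then f x else 0)"
    using assms(3,4) by auto
  then show ?thesis
    using Lebesgue_Measure.integral_restrict_UNIV[OF assms(1), of f]
      Lebesgue_Measure.integral_restrict_UNIV[OF assms(2), of f] by simp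
qed

lemma integral_grad_compact_support:
  fixes w :: "real \<times> real \<Rightarrow> real"
  assumes w: "C_k (Suc 0) w" and S: "compact S" "\<And>z. z \<notin> S \<Longrightarrow> w z = 0"
    and U: "S \<subseteq> U" "U \<in> sets lebesgue"
  shows "(\<integral>z. grad w z \<partial>lebesgue_on U) = 0"
proof -
  obtain r where r: "r > 0" "\<And>z. z \<in> S \<Longrightarrow> norm z < r"
    using S(1) compact_imp_bounded bounded_pos_less by metis
  let ?B = "cbox (-r, -r) (r, r) :: (real \<times> real) set"
  have out: "z \<notin> S" if "\<bar>fst z\<bar> \<ge> r \<or> \<bar>snd z\<bar> \<ge> r" for z
    using that r(2)[of z] norm_fst_le[of "fst z" "snd z"] norm_snd_le[of "snd z" "fst z"] by auto
  have SB: "S \<subseteq> ?B" using out by (force simp: cbox_Pair_eq)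
  have grad0: "grad w z = 0" if "z \<notin> S" for z
    by (rule grad_eq_0_if_locally_0[of "- S"]) (use that S in \<open>auto simp: compact_imp_closed\<close>)
  have int: "integrable (lebesgue_on ?B) (grad w)"
    by (rule continuous_imp_integrable) (use continuous_on_grad[OF w] continuous_on_subset in blast)
  have "(\<integral>z. grad w z \<partial>lebesgue_on U) = (\<integral>z. grad w z \<partial>lebesgue_on ?B)"
    using U SB grad0 by (intro integral_lebesgue_on_eq) auto
  also have "\<dots> = 0"
  proof (rule prod_eqI)
    have *: "(\<integral>z. frechet_derivative w (at z) v \<partial>lebesgue_on ?B) = integral ?B (\<lambda>z. frechet_derivative w (at z) v)" for v
      by (intro lebesgue_integral_eq_integral continuous_imp_integrable)
        (use C_k_continuous[OF C_k_SucD(2)[OF w]] continuous_on_subset in blast, simp)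
    have "fst (\<integral>z. grad w z \<partial>lebesgue_on ?B) = (\<integral>z. fst (grad w z) \<partial>lebesgue_on ?B)"
      using integral_bounded_linear[OF bounded_linear_fst int] by simp
    also have "\<dots> = 0"
      using integral_partial_derivatives_box(1)[OF w, of "-r" r "-r" r] r out S(2) by (simp add: grad_pair *)
    finally show "fst (\<integral>z. grad w z \<partial>lebesgue_on ?B) = fst 0" by simp
    have "snd (\<integral>z. grad w z \<partial>lebesgue_on ?B) = (\<integral>z. snd (grad w z) \<partial>lebesgue_on ?B)"
      using integral_bounded_linear[OF bounded_linear_snd int] by simp
    also have "\<dots> = 0"
      using integral_partial_derivatives_box(2)[OF w, of "-r" r "-r" r] r out S(2) by (simp add: grad_pair *)
    finally show "snd (\<integral>z. grad w z \<partial>lebesgue_on ?B) = snd 0" by simp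
  qed
  finally show ?thesis .
qed

section \<open>Square integrable functions\<close>

lemma integrable_square_integrable_bound:
  fixes f :: "'a::euclidean_space \<Rightarrow> 'b::euclidean_space" and w :: "'a \<Rightarrow> 'c::euclidean_space"
  assumes f: "f square_integrable_on U" and U: "U \<in> sets lebesgue" and S: "S \<in> lmeasurable"
    and w: "w \<in> borel_measurable (lebesgue_on U)"
    and bound: "\<And>x. x \<in> U \<Longrightarrow> norm (w x) \<le> C * norm (f x) * indicator S x"
  shows "integrable (lebesgue_on U) w"
proof (rule Bochner_Integration.integrable_bound[OF _ w])
  have "integrable lebesgue (indicator (S \<inter> U) :: 'a \<Rightarrow> real)"
    using fmeasurable_Int_fmeasurable[OF S U] by (intro integrable_real_indicator) (auto simp: fmeasurable_def)
  moreover have "(indicator (S \<inter> U) :: 'a \<Rightarrow> real) = (\<lambda>x. if x \<in> U then indicator S x else 0)"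
    by (auto simp: indicator_def)
  ultimately have "integrable (lebesgue_on U) (indicator S :: 'a \<Rightarrow> real)"
    using Lebesgue_Measure.integrable_restrict_UNIV[OF U, of "indicator S :: 'a \<Rightarrow> real"] by simp
  then show "integrable (lebesgue_on U) (\<lambda>x. \<bar>C\<bar> * (indicator S x + (norm (f x))\<^sup>2))"
    using f by (simp add: square_integrable_on_def)
  show "AE x in lebesgue_on U. norm (w x) \<le> norm (\<bar>C\<bar> * (indicator S x + (norm (f x))\<^sup>2))"
  proof (rule AE_I2)
    fix x assume "x \<in> space (lebesgue_on U)"
    then have x: "x \<in> U" by simp
    have *: "t \<le> 1 + t\<^sup>2" for t :: real
      using zero_le_power2[of "t - 1/2"] by (simp add: power2_eq_square algebra_simps)
    have "norm (w x) \<le> C * norm (f x) * indicator S x" by (rule bound[OF x])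
    also have "\<dots> \<le> \<bar>C\<bar> * norm (f x) * indicator S x" by (intro mult_right_mono) auto
    also have "\<dots> \<le> \<bar>C\<bar> * (indicator S x + (norm (f x))\<^sup>2)"
      using *[of "norm (f x)"] by (auto simp: indicator_def intro!: mult_left_mono)
    also have "\<dots> = norm (\<bar>C\<bar> * (indicator S x + (norm (f x))\<^sup>2))" by simp
    finally show "norm (w x) \<le> norm (\<bar>C\<bar> * (indicator S x + (norm (f x))\<^sup>2))" .
  qed
qed

lemma square_integrable_on_add:
  fixes f g :: "'a::euclidean_space \<Rightarrow> 'b::euclidean_space"
  assumes "f square_integrable_on U" "g square_integrable_on U"
  shows "(\<lambda>x. f x + g x) square_integrable_on U"
proof -
  have m: "(\<lambda>x. f x + g x) \<in> borel_measurable (lebesgue_on U)"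
    using assms by (auto simp: square_integrable_on_def)
  have "integrable (lebesgue_on U) (\<lambda>x. (norm (f x + g x))\<^sup>2)"
  proof (rule Bochner_Integration.integrable_bound)
    show "integrable (lebesgue_on U) (\<lambda>x. 2 * (norm (f x))\<^sup>2 + 2 * (norm (g x))\<^sup>2)"
      using assms by (simp add: square_integrable_on_def)
    show "(\<lambda>x. (norm (f x + g x))\<^sup>2) \<in> borel_measurable (lebesgue_on U)" using m by simp
    have "(norm (f x + g x))\<^sup>2 \<le> 2 * (norm (f x))\<^sup>2 + 2 * (norm (g x))\<^sup>2" for x
    proof -
      have "(norm (f x + g x))\<^sup>2 \<le> (norm (f x) + norm (g x))\<^sup>2"
        by (intro power_mono norm_triangle_ineq) simp
      also have "\<dots> \<le> 2 * (norm (f x))\<^sup>2 + 2 * (norm (g x))\<^sup>2"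
        using zero_le_power2[of "norm (f x) - norm (g x)"] by (simp add: power2_eq_square algebra_simps)
      finally show ?thesis .
    qed
    then show "AE x in lebesgue_on U. norm ((norm (f x + g x))\<^sup>2) \<le> norm (2 * (norm (f x))\<^sup>2 + 2 * (norm (g x))\<^sup>2)"
      by simp
  qed
  with m show ?thesis by (simp add: square_integrable_on_def)
qed

lemma square_integrable_on_uminus:
  "f square_integrable_on U \<Longrightarrow> (\<lambda>x. - f x) square_integrable_on U"
  by (auto simp: square_integrable_on_def)

lemma square_integrable_on_diff:
  fixes f g :: "'a::euclidean_space \<Rightarrow> 'b::euclidean_space"
  assumes "f square_integrable_on U" "g square_integrable_on U"
  shows "(\<lambda>x. f x - g x) square_integrable_on U"
  using square_integrable_on_add[OF assms(1) square_integrable_on_uminus[OF assms(2)]] by simp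

lemma square_integrable_on_subset:
  fixes f :: "'a::euclidean_space \<Rightarrow> 'b::euclidean_space"
  assumes f: "f square_integrable_on U" and "V \<subseteq> U" "V \<in> sets lebesgue" "U \<in> sets lebesgue"
  shows "f square_integrable_on V"
proof -
  have m: "f \<in> borel_measurable (lebesgue_on V)"
    using f assms(2) by (auto simp: square_integrable_on_def intro: measurable_restrict_mono)
  have "integrable lebesgue (\<lambda>x. if x \<in> U then (norm (f x))\<^sup>2 else 0)"
    using f by (intro Lebesgue_Measure.integrable_restrict_UNIV[THEN iffD2] assms) (simp add: square_integrable_on_def)
  then have "integrable lebesgue (\<lambda>x. if x \<in> V then (norm (f x))\<^sup>2 else 0)"
  proof (rule Bochner_Integration.integrable_bound)
    show "(\<lambda>x. if x \<in> V then (norm (f x))\<^sup>2 else 0) \<in> borel_measurable lebesgue"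
      using m by (intro borel_measurable_if_I assms) simp
  qed (use assms(2) in auto)
  then have "integrable (lebesgue_on V) (\<lambda>x. (norm (f x))\<^sup>2)"
    by (rule Lebesgue_Measure.integrable_restrict_UNIV[THEN iffD1, OF assms(3)])
  with m show ?thesis by (simp add: square_integrable_on_def)
qed

lemma square_integrable_on_continuous:
  fixes f :: "'a::euclidean_space \<Rightarrow> 'b::euclidean_space"
  assumes f: "continuous_on UNIV f" and U: "bounded U" "U \<in> sets lebesgue"
  shows "f square_integrable_on U"
proof -
  obtain c where c: "U \<subseteq> cbox (-c) c" using bounded_subset_cbox_symmetric[OF U(1)] by blast
  have "integrable (lebesgue_on (cbox (-c) c)) (\<lambda>x. (norm (f x))\<^sup>2)"
    by (intro continuous_imp_integrable continuous_intros continuous_on_subset[OF f]) simp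
  then have "f square_integrable_on (cbox (-c) c)"
    using f by (simp add: square_integrable_on_def borel_measurable_lebesgue_on_continuous)
  from square_integrable_on_subset[OF this c U(2)] show ?thesis by simp
qed

section \<open>Uniqueness of weak gradients\<close>

text \<open>The open boxes form an intersection-stable generator of the Borel sets, so the integrals
  over all Borel sets vanish as well, in particular over the sets where \<open>h\<close> is positive or negative.\<close>

lemma AE_eq_0_if_integrals_over_boxes_0:
  fixes h :: "'a::euclidean_space \<Rightarrow> real"
  assumes int: "integrable lebesgue h"
    and box: "\<And>a b. (\<integral>x. indicator (box a b) x * h x \<partial>lebesgue) = 0"
  shows "AE x in lebesgue. h x = 0"
proof -
  obtain h' where h'[measurable]: "h' \<in> borel_measurable lborel" and ae: "AE x in lborel. h x = h' x"
    using completion_ex_borel_measurable_real[of h lborel] int by auto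
  have ae': "AE x in lebesgue. h x = h' x" using ae by (rule AE_completion)
  have "integrable lebesgue h'"
    by (rule integrable_cong_AE_imp[OF int measurable_completion[OF h'] ae'])
  then have int': "integrable lborel h'" by (simp add: integrable_completion)
  have ind: "integrable lborel (\<lambda>x. indicator A x * h' x)" if "A \<in> sets borel" for A
    using integrable_mult_indicator[OF _ int', of A] that by simp
  have box': "(\<integral>x. indicator (box a b) x * h' x \<partial>lborel) = 0" for a b
  proof -
    have "(\<integral>x. indicator (box a b) x * h' x \<partial>lborel) = (\<integral>x. indicator (box a b) x * h' x \<partial>lebesgue)"
      by (rule integral_completion[symmetric]) simp
    also have "\<dots> = (\<integral>x. indicator (box a b) x * h x \<partial>lebesgue)"
    proof (rule integral_cong_AE)
      show "(\<lambda>x. indicator (box a b) x * h' x) \<in> borel_measurable lebesgue"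
        by (rule measurable_completion) simp
      have "(\<lambda>x. indicator (box a b) x :: real) \<in> borel_measurable lebesgue"
        by (rule measurable_completion) simp
      then show "(\<lambda>x. indicator (box a b) x * h x) \<in> borel_measurable lebesgue"
        using borel_measurable_integrable[OF int] by (rule borel_measurable_times)
    qed (use ae' in auto)
    finally show ?thesis by (simp add: box)
  qed
  have total: "(\<integral>x. h' x \<partial>lborel) = 0"
  proof -
    have "(\<lambda>n. \<integral>x. indicator (box (- (real n *\<^sub>R One)) (real n *\<^sub>R One)) x * h' x \<partial>lborel)
        \<longlonglongrightarrow> (\<integral>x. h' x \<partial>lborel)"
    proof (rule integral_dominated_convergence[where w = "\<lambda>x. norm (h' x)"])
      show "AE x in lborel. (\<lambda>n. indicator (box (- (real n *\<^sub>R One)) (real n *\<^sub>R One)) x * h' x) \<longlonglongrightarrow> h' x"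
      proof (rule AE_I2)
        fix x :: 'a
        obtain N :: nat where N: "norm x < real N" using reals_Archimedean2 by blast
        have "indicator (box (- (real n *\<^sub>R One)) (real n *\<^sub>R One)) x = (1::real)" if "n \<ge> N" for n
        proof -
          have "\<bar>x \<bullet> b\<bar> < real n" if "b \<in> Basis" for b
            using Basis_le_norm[OF that, of x] N \<open>n \<ge> N\<close> by linarith
          then show ?thesis by (auto simp: indicator_def mem_box abs_less_iff) (smt (verit))+
        qed
        then have "eventually (\<lambda>n. h' x = indicator (box (- (real n *\<^sub>R One)) (real n *\<^sub>R One)) x * h' x) sequentially"
          unfolding eventually_sequentially by (intro exI[of _ N]) simp
        from Lim_transform_eventually[OF tendsto_const this]
        show "(\<lambda>n. indicator (box (- (real n *\<^sub>R One)) (real n *\<^sub>R One)) x * h' x) \<longlonglongrightarrow> h' x" .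
      qed
    qed (use int' in \<open>auto simp: indicator_def\<close>)
    then show ?thesis by (simp add: box' LIMSEQ_const_iff)
  qed
  have zero: "(\<integral>x. indicator A x * h' x \<partial>lborel) = 0" if "A \<in> sets borel" for A
  proof -
    have "Int_stable (range (\<lambda>(a, b). box a b :: 'a set))"
      by (auto simp: Int_stable_def box_Int_box)
    moreover have "range (\<lambda>(a, b). box a b :: 'a set) \<subseteq> Pow UNIV" by auto
    moreover have "A \<in> sigma_sets UNIV (range (\<lambda>(a, b). box a b))"
      using that unfolding borel_eq_box by simp
    ultimately show ?thesis
    proof (induction rule: sigma_sets_induct_disjoint)
      case (basic A)
      then show ?case using box' by auto
    next
      case empty
      then show ?case by simp
    next
      case (compl A)
      then have A: "A \<in> sets borel" by (simp add: borel_eq_box)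
      have "(\<integral>x. indicator (UNIV - A) x * h' x \<partial>lborel) = (\<integral>x. h' x - indicator A x * h' x \<partial>lborel)"
        by (intro Bochner_Integration.integral_cong) (auto simp: indicator_def)
      also have "\<dots> = 0" using compl total ind[OF A] int' by simp
      finally show ?case .
    next
      case (union F)
      then have F: "\<And>i. F i \<in> sets borel" by (simp add: borel_eq_box subset_eq)
      have "(LINT x:(\<Union>i. F i)|lborel. h' x) = (\<Sum>i. (LINT x:(F i)|lborel. h' x))"
      proof (rule lebesgue_integral_countable_add)
        show "set_integrable lborel (\<Union>i. F i) h'"
          using ind[of "\<Union>i. F i"] F by (simp add: set_integrable_def)
      qed (use F union(1) in \<open>auto simp: disjoint_family_on_def\<close>)
      then show ?case using union.IH by (simp add: set_lebesgue_integral_def)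
    qed
  qed
  have "AE x in lborel. indicator {x. h' x > 0} x * h' x = 0"
    using zero[of "{x. h' x > 0}"] ind[of "{x. h' x > 0}"]
    by (subst integral_nonneg_eq_0_iff_AE[symmetric]) (auto simp: indicator_def)
  moreover have "AE x in lborel. - (indicator {x. h' x < 0} x * h' x) = 0"
    using zero[of "{x. h' x < 0}"] ind[of "{x. h' x < 0}"]
    by (subst integral_nonneg_eq_0_iff_AE[symmetric]) (auto simp: indicator_def)
  ultimately have "AE x in lborel. h x = 0"
    using ae by eventually_elim (auto simp: indicator_def split: if_splits)
  then show ?thesis by (rule AE_completion)
qed

text \<open>Products of smooth steps approximate the indicator of a box from below.\<close>

definition box_bump :: "real \<times> real \<Rightarrow> real \<times> real \<Rightarrow> nat \<Rightarrow> real \<times> real \<Rightarrow> real" where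
  "box_bump a b n z =
     smooth_step (real n * (fst z - fst a)) * smooth_step (real n * (fst b - fst z)) *
     (smooth_step (real n * (snd z - snd a)) * smooth_step (real n * (snd b - snd z)))"

lemma C_k_fst: "C_k k (fst :: real \<times> real \<Rightarrow> real)" and C_k_snd: "C_k k (snd :: real \<times> real \<Rightarrow> real)"
  using C_k_linear[OF bounded_linear_fst, of k] C_k_linear[OF bounded_linear_snd, of k] by auto

lemma C_k_box_bump: "C_k k (box_bump a b n)"
  unfolding box_bump_def[abs_def]
  by (intro C_k_mult C_k_compose[OF C_k_smooth_step] C_k_diff C_k_const C_k_fst C_k_snd)

lemma box_bump_eq_0: "z \<notin> box a b \<Longrightarrow> box_bump a b n z = 0"
proof -
  have 0: "smooth_step (real n * d) = 0" if "d \<le> 0" for d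
    using that mult_nonneg_nonpos[of "real n" d] by (simp add: smooth_step_eq_0)
  assume "z \<notin> box a b"
  then consider "fst z \<le> fst a" | "fst b \<le> fst z" | "snd z \<le> snd a" | "snd b \<le> snd z"
    by (cases z; cases a; cases b) (auto simp: box_def Basis_prod_def not_less)
  then show ?thesis by cases (simp_all add: box_bump_def 0)
qed

lemma box_bump_bounds: "0 \<le> box_bump a b n z" "box_bump a b n z \<le> 1"
  by (simp_all add: box_bump_def smooth_step_ge_0 smooth_step_le_1 mult_le_one)

lemma box_bump_tendsto: "(\<lambda>n. box_bump a b n z) \<longlonglongrightarrow> indicator (box a b) z"
proof (cases "z \<in> box a b")
  case False
  then show ?thesis by (simp add: box_bump_eq_0)
next
  case True
  then have pos: "fst z - fst a > 0" "fst b - fst z > 0" "snd z - snd a > 0" "snd b - snd z > 0"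
    by (cases z; cases a; cases b; auto simp: box_def Basis_prod_def)+
  have ev: "eventually (\<lambda>n. smooth_step (real n * d) = 1) sequentially" if "d > 0" for d
  proof -
    obtain N :: nat where N: "1 / d < real N" using reals_Archimedean2 by blast
    have "real n * d \<ge> 1" if "n \<ge> N" for n
    proof -
      have "1 / d \<le> real n" using N that by linarith
      then show ?thesis using \<open>d > 0\<close> by (simp add: field_simps)
    qed
    then show ?thesis unfolding eventually_sequentially using smooth_step_eq_1 by blast
  qed
  have "eventually (\<lambda>n. 1 = box_bump a b n z) sequentially"
    using ev[OF pos(1)] ev[OF pos(2)] ev[OF pos(3)] ev[OF pos(4)]
    by eventually_elim (simp add: box_bump_def)
  from Lim_transform_eventually[OF tendsto_const this] True show ?thesis by simp
qed

lemma box_bump_test_function: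
  assumes "cbox a b \<subseteq> U"
  shows "box_bump a b n \<in> test_functions U"
proof -
  have "closure {x. box_bump a b n x \<noteq> 0} \<subseteq> cbox a b"
    using box_bump_eq_0[of _ a b n] box_subset_cbox[of a b] by (intro closure_minimal) blast+
  moreover from this have "compact (closure {x. box_bump a b n x \<noteq> 0})"
    using compact_cbox[of a b] by (metis closed_closure compact_Int_closed inf.absorb_iff2)
  ultimately show ?thesis using assms C_k_box_bump by (auto simp: test_functions_def)
qed

lemma integrable_mult_compact_support:
  fixes f :: "'a::euclidean_space \<Rightarrow> 'b::euclidean_space" and \<psi> :: "'a \<Rightarrow> 'c::euclidean_space"
    and w :: "'a \<Rightarrow> 'd::euclidean_space"
  assumes f: "f square_integrable_on U" and U: "U \<in> sets lebesgue"
    and \<psi>: "continuous_on UNIV \<psi>" and S: "compact S" "\<And>x. x \<notin> S \<Longrightarrow> \<psi> x = 0"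
    and w: "w \<in> borel_measurable (lebesgue_on U)" "\<And>x. norm (w x) = norm (\<psi> x) * norm (f x)"
  shows "integrable (lebesgue_on U) w"
proof -
  have "compact (\<psi> ` S)" by (intro compact_continuous_image S continuous_on_subset[OF \<psi>]) simp
  then obtain C where C: "\<And>x. x \<in> S \<Longrightarrow> norm (\<psi> x) \<le> C"
    using compact_imp_bounded bounded_iff by (metis imageI)
  show ?thesis
  proof (rule integrable_square_integrable_bound[OF f U lmeasurable_compact[OF S(1)] w(1)])
    show "norm (w x) \<le> C * norm (f x) * indicator S x" for x
      using mult_right_mono[OF C, of x "norm (f x)"] S(2)[of x] w(2)[of x] by (cases "x \<in> S") auto
  qed
qed

lemma integrable_test_function_scaleR:
  fixes g :: "real \<times> real \<Rightarrow> real \<times> real"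
  assumes g: "g square_integrable_on U" and U: "U \<in> sets lebesgue" and \<phi>: "\<phi> \<in> test_functions U"
  shows "integrable (lebesgue_on U) (\<lambda>x. \<phi> x *\<^sub>R g x)"
proof -
  have cont: "continuous_on UNIV \<phi>" using test_function_C_k[OF \<phi>] by (rule C_k_continuous)
  show ?thesis
  proof (rule integrable_mult_compact_support[OF g U cont, of "closure {x. \<phi> x \<noteq> 0}"])
    show "(\<lambda>x. \<phi> x *\<^sub>R g x) \<in> borel_measurable (lebesgue_on U)"
      using g borel_measurable_lebesgue_on_continuous[OF cont]
      by (intro borel_measurable_scaleR) (auto simp: square_integrable_on_def)
    show "\<phi> x = 0" if "x \<notin> closure {x. \<phi> x \<noteq> 0}" for x
      using that closure_subset[of "{x. \<phi> x \<noteq> 0}"] by blast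
  qed (use \<phi> in \<open>simp_all add: test_functions_def\<close>)
qed

lemma integrable_scaleR_grad_test_function:
  fixes u :: "real \<times> real \<Rightarrow> real"
  assumes u: "u square_integrable_on U" and U: "U \<in> sets lebesgue" and \<phi>: "\<phi> \<in> test_functions U"
  shows "integrable (lebesgue_on U) (\<lambda>x. u x *\<^sub>R grad \<phi> x)"
proof -
  have cont: "continuous_on UNIV (grad \<phi>)" using test_function_C_k[OF \<phi>] by (rule continuous_on_grad)
  show ?thesis
  proof (rule integrable_mult_compact_support[OF u U cont, of "closure {x. \<phi> x \<noteq> 0}"])
    show "(\<lambda>x. u x *\<^sub>R grad \<phi> x) \<in> borel_measurable (lebesgue_on U)"
      using u borel_measurable_lebesgue_on_continuous[OF cont]
      by (intro borel_measurable_scaleR) (auto simp: square_integrable_on_def)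
  qed (use \<phi> grad_test_function_eq_0 in \<open>simp_all add: test_functions_def mult.commute\<close>)
qed

text \<open>The fundamental lemma of the calculus of variations.\<close>

lemma AE_eq_0_if_test_integrals_0:
  fixes g :: "real \<times> real \<Rightarrow> real \<times> real"
  assumes g: "g square_integrable_on U" and U: "open U"
    and zero: "\<And>\<phi>. \<phi> \<in> test_functions U \<Longrightarrow> (\<integral>x. \<phi> x *\<^sub>R g x \<partial>lebesgue_on U) = 0"
  shows "AE x in lebesgue_on U. g x = 0"
proof -
  have Um: "U \<in> sets lebesgue" using U by simp
  have gm: "g \<in> borel_measurable (lebesgue_on U)" using g by (simp add: square_integrable_on_def)
  have int: "integrable (lebesgue_on U) (\<lambda>x. indicator (box a b) x *\<^sub>R g x)" for a b
  proof (rule integrable_square_integrable_bound[OF g Um, of "box a b" _ 1])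
    have "(indicator (box a b) :: real \<times> real \<Rightarrow> real) \<in> borel_measurable (lebesgue_on U)"
      by (intro measurable_restrict_space1 measurable_completion) simp
    then show "(\<lambda>x. indicat_real (box a b) x *\<^sub>R g x) \<in> borel_measurable (lebesgue_on U)"
      using gm by (rule borel_measurable_scaleR)
  qed (auto simp: indicator_def)
  have box0: "(\<integral>x. indicator (box a b) x *\<^sub>R g x \<partial>lebesgue_on U) = 0" if ab: "cbox a b \<subseteq> U" for a b
  proof -
    have "(\<lambda>n. \<integral>x. box_bump a b n x *\<^sub>R g x \<partial>lebesgue_on U)
        \<longlonglongrightarrow> (\<integral>x. indicator (box a b) x *\<^sub>R g x \<partial>lebesgue_on U)"
    proof (rule integral_dominated_convergence[where w = "\<lambda>x. norm (indicator (box a b) x *\<^sub>R g x)"])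
      show "(\<lambda>x. indicat_real (box a b) x *\<^sub>R g x) \<in> borel_measurable (lebesgue_on U)"
        using int by auto
      show "(\<lambda>x. box_bump a b n x *\<^sub>R g x) \<in> borel_measurable (lebesgue_on U)" for n
        using integrable_test_function_scaleR[OF g Um box_bump_test_function[OF ab, of n]] by auto
      show "integrable (lebesgue_on U) (\<lambda>x. norm (indicat_real (box a b) x *\<^sub>R g x))"
        using int by (rule integrable_norm)
      show "AE x in lebesgue_on U. norm (box_bump a b n x *\<^sub>R g x) \<le> norm (indicator (box a b) x *\<^sub>R g x)" for n
      proof (rule AE_I2)
        fix x
        show "norm (box_bump a b n x *\<^sub>R g x) \<le> norm (indicator (box a b) x *\<^sub>R g x)"
          using box_bump_bounds[of a b n x] box_bump_eq_0[of x a b n]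
          by (cases "x \<in> box a b") (auto intro: mult_left_le_one_le)
      qed
    qed (auto intro!: tendsto_scaleR box_bump_tendsto)
    then show ?thesis
      by (simp add: zero[OF box_bump_test_function[OF ab]] LIMSEQ_const_iff)
  qed
  have AE_box: "AE x in lebesgue. x \<in> box a b \<longrightarrow> g x = 0" if ab: "cbox a b \<subseteq> U" for a b
  proof -
    have sub: "box a b \<subseteq> U" using ab box_subset_cbox by blast
    have "AE x in lebesgue. indicator (box a b) x * (T (g x)) = 0" if T: "bounded_linear T"
      for T :: "real \<times> real \<Rightarrow> real"
    proof (rule AE_eq_0_if_integrals_over_boxes_0)
      interpret T: bounded_linear T by (rule T)
      have *: "(\<lambda>x. T (indicator B x *\<^sub>R g x)) = (\<lambda>x. indicator B x * T (g x))" for B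
        by (simp add: T.scaleR)
      have i: "integrable (lebesgue_on U) (\<lambda>x. indicator (box c d) x * T (g x))" for c d
        using integrable_bounded_linear[OF T int[of c d]] by (simp add: *)
      have "integrable lebesgue (\<lambda>x. if x \<in> U then indicator (box a b) x * T (g x) else 0)"
        by (rule Lebesgue_Measure.integrable_restrict_UNIV[THEN iffD2, OF Um i])
      moreover have "(\<lambda>x. if x \<in> U then indicator (box a b) x * T (g x) else 0) = (\<lambda>x. indicator (box a b) x * T (g x))"
        using sub by (auto simp: indicator_def fun_eq_iff)
      ultimately show "integrable lebesgue (\<lambda>x. indicator (box a b) x * T (g x))" by simp
      fix c d
      obtain p q where pq: "box c d \<inter> box a b = box p q" and pqU: "cbox p q \<subseteq> U"
      proof (cases "box c d \<inter> box a b = {}")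
        case True
        have "cbox (1,1) (0,0::real) = ({} :: (real \<times> real) set)" "box (1,1) (0,0::real) = ({} :: (real \<times> real) set)"
          by (auto simp: cbox_Pair_eq box_def Basis_prod_def)
        with True that[of "(1,1)" "(0,0)"] show thesis by simp
      next
        case False
        obtain p q where pq: "box c d \<inter> box a b = box p q" using box_Int_box by blast
        have "cbox p q = closure (box p q)" using False pq by (metis closure_box)
        also have "\<dots> \<subseteq> closure (box a b)" using pq by (intro closure_mono) auto
        also have "\<dots> \<subseteq> cbox a b" by (intro closure_minimal box_subset_cbox closed_cbox)
        finally show thesis using that[OF pq] ab by blast
      qed
      have "(\<integral>x. indicator (box c d) x * (indicator (box a b) x * T (g x)) \<partial>lebesgue)
          = (\<integral>x. (if x \<in> U then indicator (box p q) x * T (g x) else 0) \<partial>lebesgue)"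
        using sub by (intro Bochner_Integration.integral_cong) (auto simp: indicator_def simp flip: pq)
      also have "\<dots> = (\<integral>x. indicator (box p q) x * T (g x) \<partial>lebesgue_on U)"
        by (rule Lebesgue_Measure.integral_restrict_UNIV[OF Um])
      also have "\<dots> = T (\<integral>x. indicator (box p q) x *\<^sub>R g x \<partial>lebesgue_on U)"
        unfolding *[symmetric] by (rule integral_bounded_linear[OF T int])
      also have "\<dots> = 0" by (simp add: box0[OF pqU] T.zero)
      finally show "(\<integral>x. indicator (box c d) x * (indicator (box a b) x * T (g x)) \<partial>lebesgue) = 0" .
    qed
    from this[OF bounded_linear_fst] this[OF bounded_linear_snd]
    show ?thesis by eventually_elim (auto simp: indicator_def prod_eq_iff)
  qed
  have AE_cbox: "AE x in lebesgue. x \<in> cbox a b \<longrightarrow> g x = 0" if "cbox a b \<subseteq> U" for a b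
  proof -
    have "cbox a b - box a b \<in> null_sets lebesgue"
      using negligible_frontier_interval[of a b] by (simp add: negligible_iff_null_sets)
    from AE_not_in[OF this] AE_box[OF that] show ?thesis by eventually_elim blast
  qed
  obtain \<D> where \<D>: "countable \<D>" "\<D> \<subseteq> Pow U" "\<And>X. X \<in> \<D> \<Longrightarrow> \<exists>a b. X = cbox a b" "\<Union>\<D> = U"
    using open_countable_Union_open_cbox[OF U] by metis
  have "AE x in lebesgue. x \<in> X \<longrightarrow> g x = 0" if "X \<in> \<D>" for X
  proof -
    obtain a b where X: "X = cbox a b" using \<D>(3) \<open>X \<in> \<D>\<close> by blast
    moreover have "X \<subseteq> U" using \<D>(2) that by blast
    ultimately show ?thesis using AE_cbox[of a b] by simp
  qed
  then have "AE x in lebesgue. \<forall>X\<in>\<D>. x \<in> X \<longrightarrow> g x = 0"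
    by (intro AE_ball_countable[OF \<D>(1), THEN iffD2] ballI)
  then have "AE x in lebesgue. x \<in> U \<longrightarrow> g x = 0"
    by eventually_elim (use \<D>(4) in blast)
  then show ?thesis by (simp add: AE_restrict_space_iff Um)
qed

section \<open>Weak gradients\<close>

lemma is_weak_grad_square_integrable: "is_weak_grad U u g \<Longrightarrow> g square_integrable_on U"
  unfolding is_weak_grad_def by (rule conjunct1)

lemma is_weak_gradD:
  assumes "is_weak_grad U u g" "\<phi> \<in> test_functions U"
  shows "(\<integral>x. u x *\<^sub>R grad \<phi> x \<partial>lebesgue_on U) = - (\<integral>x. \<phi> x *\<^sub>R g x \<partial>lebesgue_on U)"
  using assms unfolding is_weak_grad_def by blast

lemma is_weak_grad_AE_unique:
  fixes u :: "real \<times> real \<Rightarrow> real"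
  assumes g: "is_weak_grad U u g" and h: "is_weak_grad U u h" and U: "open U"
  shows "AE x in lebesgue_on U. g x = h x"
proof -
  have gh: "g square_integrable_on U" "h square_integrable_on U"
    by (rule is_weak_grad_square_integrable[OF g], rule is_weak_grad_square_integrable[OF h])
  have Um: "U \<in> sets lebesgue" using U by simp
  have "AE x in lebesgue_on U. g x - h x = 0"
  proof (rule AE_eq_0_if_test_integrals_0[OF square_integrable_on_diff[OF gh] U])
    fix \<phi> assume \<phi>: "\<phi> \<in> test_functions U"
    have "- (\<integral>x. \<phi> x *\<^sub>R g x \<partial>lebesgue_on U) = - (\<integral>x. \<phi> x *\<^sub>R h x \<partial>lebesgue_on U)"
      unfolding is_weak_gradD[OF g \<phi>, symmetric] is_weak_gradD[OF h \<phi>, symmetric] ..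
    moreover have "(\<integral>x. \<phi> x *\<^sub>R (g x - h x) \<partial>lebesgue_on U)
        = (\<integral>x. \<phi> x *\<^sub>R g x \<partial>lebesgue_on U) - (\<integral>x. \<phi> x *\<^sub>R h x \<partial>lebesgue_on U)"
      unfolding scaleR_diff_right
      by (intro Bochner_Integration.integral_diff integrable_test_function_scaleR gh Um \<phi>)
    ultimately show "(\<integral>x. \<phi> x *\<^sub>R (g x - h x) \<partial>lebesgue_on U) = 0" by simp
  qed
  then show ?thesis by simp
qed

lemma is_weak_grad_cong:
  assumes "\<And>x. x \<in> U \<Longrightarrow> u x = v x"
  shows "is_weak_grad U u g \<longleftrightarrow> is_weak_grad U v g"
proof -
  have "(\<integral>x. u x *\<^sub>R grad \<phi> x \<partial>lebesgue_on U) = (\<integral>x. v x *\<^sub>R grad \<phi> x \<partial>lebesgue_on U)" for \<phi>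
    using assms by (intro Bochner_Integration.integral_cong) auto
  then show ?thesis by (simp add: is_weak_grad_def)
qed

lemma is_weak_grad_subset:
  fixes u :: "real \<times> real \<Rightarrow> real"
  assumes g: "is_weak_grad U u g" and VU: "V \<subseteq> U" and V: "open V" and U: "open U"
  shows "is_weak_grad V u g"
  unfolding is_weak_grad_def
proof (intro conjI ballI)
  show "g square_integrable_on V"
    using V U by (intro square_integrable_on_subset[OF is_weak_grad_square_integrable[OF g] VU]) auto
  fix \<phi> assume \<phi>: "\<phi> \<in> test_functions V"
  have 0: "\<phi> x = 0" "grad \<phi> x = 0" if "x \<notin> V" for x
  proof -
    have "x \<notin> closure {x. \<phi> x \<noteq> 0}" using \<phi> that by (auto simp: test_functions_def)
    then show "grad \<phi> x = 0" by (rule grad_test_function_eq_0)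
    show "\<phi> x = 0" using \<phi> that by (rule test_function_eq_0)
  qed
  have "(\<integral>x. u x *\<^sub>R grad \<phi> x \<partial>lebesgue_on V) = (\<integral>x. u x *\<^sub>R grad \<phi> x \<partial>lebesgue_on U)"
    using V U VU 0 by (intro integral_lebesgue_on_eq) auto
  also have "\<dots> = - (\<integral>x. \<phi> x *\<^sub>R g x \<partial>lebesgue_on U)"
    by (rule is_weak_gradD[OF g subsetD[OF test_functions_mono[OF VU] \<phi>]])
  also have "(\<integral>x. \<phi> x *\<^sub>R g x \<partial>lebesgue_on U) = (\<integral>x. \<phi> x *\<^sub>R g x \<partial>lebesgue_on V)"
    using V U VU 0 by (intro integral_lebesgue_on_eq) auto
  finally show "(\<integral>x. u x *\<^sub>R grad \<phi> x \<partial>lebesgue_on V) = - (\<integral>x. \<phi> x *\<^sub>R g x \<partial>lebesgue_on V)" .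
qed

lemma is_weak_grad_diff:
  fixes u v :: "real \<times> real \<Rightarrow> real"
  assumes g: "is_weak_grad U u g" and h: "is_weak_grad U v h" and U: "open U"
    and uv: "u square_integrable_on U" "v square_integrable_on U"
  shows "is_weak_grad U (\<lambda>x. u x - v x) (\<lambda>x. g x - h x)"
  unfolding is_weak_grad_def
proof (intro conjI ballI)
  have gh: "g square_integrable_on U" "h square_integrable_on U"
    by (rule is_weak_grad_square_integrable[OF g], rule is_weak_grad_square_integrable[OF h])
  then show "(\<lambda>x. g x - h x) square_integrable_on U" by (rule square_integrable_on_diff)
  have Um: "U \<in> sets lebesgue" using U by simp
  fix \<phi> assume \<phi>: "\<phi> \<in> test_functions U"
  have "(\<integral>x. (u x - v x) *\<^sub>R grad \<phi> x \<partial>lebesgue_on U)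
      = (\<integral>x. u x *\<^sub>R grad \<phi> x \<partial>lebesgue_on U) - (\<integral>x. v x *\<^sub>R grad \<phi> x \<partial>lebesgue_on U)"
    unfolding scaleR_diff_left
    by (intro Bochner_Integration.integral_diff integrable_scaleR_grad_test_function uv Um \<phi>)
  also have "\<dots> = - ((\<integral>x. \<phi> x *\<^sub>R g x \<partial>lebesgue_on U) - (\<integral>x. \<phi> x *\<^sub>R h x \<partial>lebesgue_on U))"
    by (simp add: is_weak_gradD[OF g \<phi>] is_weak_gradD[OF h \<phi>])
  also have "(\<integral>x. \<phi> x *\<^sub>R g x \<partial>lebesgue_on U) - (\<integral>x. \<phi> x *\<^sub>R h x \<partial>lebesgue_on U)
      = (\<integral>x. \<phi> x *\<^sub>R (g x - h x) \<partial>lebesgue_on U)"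
    unfolding scaleR_diff_right
    by (intro Bochner_Integration.integral_diff[symmetric] integrable_test_function_scaleR gh Um \<phi>)
  finally show "(\<integral>x. (u x - v x) *\<^sub>R grad \<phi> x \<partial>lebesgue_on U)
      = - (\<integral>x. \<phi> x *\<^sub>R (g x - h x) \<partial>lebesgue_on U)" .
qed

lemma is_weak_grad_C_1:
  fixes f :: "real \<times> real \<Rightarrow> real"
  assumes f: "C_k (Suc 0) f" and U: "open U" "bounded U"
  shows "is_weak_grad U f (grad f)"
  unfolding is_weak_grad_def
proof (intro conjI ballI)
  have Um: "U \<in> sets lebesgue" using U by simp
  show g: "grad f square_integrable_on U"
    by (rule square_integrable_on_continuous[OF continuous_on_grad[OF f] U(2) Um])
  have fs: "f square_integrable_on U"
    by (rule square_integrable_on_continuous[OF C_k_continuous[OF f] U(2) Um])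
  fix \<phi> assume \<phi>: "\<phi> \<in> test_functions U"
  let ?S = "closure {x. \<phi> x \<noteq> 0}"
  have "(\<integral>x. grad (\<lambda>z. f z * \<phi> z) x \<partial>lebesgue_on U) = 0"
  proof (rule integral_grad_compact_support[OF C_k_mult[OF f test_function_C_k[OF \<phi>]], of ?S])
    show "f z * \<phi> z = 0" if "z \<notin> ?S" for z
      using that closure_subset[of "{x. \<phi> x \<noteq> 0}"] by auto
  qed (use \<phi> Um in \<open>auto simp: test_functions_def\<close>)
  also have "(\<integral>x. grad (\<lambda>z. f z * \<phi> z) x \<partial>lebesgue_on U)
      = (\<integral>x. f x *\<^sub>R grad \<phi> x \<partial>lebesgue_on U) + (\<integral>x. \<phi> x *\<^sub>R grad f x \<partial>lebesgue_on U)"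
    unfolding grad_mult[OF f test_function_C_k[OF \<phi>]]
    by (intro Bochner_Integration.integral_add integrable_scaleR_grad_test_function
        integrable_test_function_scaleR g fs Um \<phi>)
  finally show "(\<integral>x. f x *\<^sub>R grad \<phi> x \<partial>lebesgue_on U) = - (\<integral>x. \<phi> x *\<^sub>R grad f x \<partial>lebesgue_on U)"
    by (simp add: eq_neg_iff_add_eq_0)
qed

lemma is_weak_grad_weak_grad: "is_weak_grad U u g \<Longrightarrow> is_weak_grad U u (weak_grad U u)"
  unfolding weak_grad_def by (rule someI[where P = "is_weak_grad U u"])

lemma weak_grad_AE_eq:
  fixes u :: "real \<times> real \<Rightarrow> real"
  assumes "is_weak_grad U u g" "open U"
  shows "AE x in lebesgue_on U. weak_grad U u x = g x"
  using is_weak_grad_AE_unique[OF is_weak_grad_weak_grad[OF assms(1)] assms] .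

lemma test_function_in_H1:
  fixes \<phi> :: "real \<times> real \<Rightarrow> real"
  assumes "\<phi> \<in> test_functions U" "open U" "bounded U"
  shows "\<phi> \<in> H1 U"
  using assms is_weak_grad_C_1[OF test_function_C_k[OF assms(1)] assms(2,3)]
    square_integrable_on_continuous[OF C_k_continuous[OF test_function_C_k[OF assms(1)]] assms(3)]
  by (auto simp: H1_def)

lemma test_function_in_H10:
  fixes \<phi> :: "real \<times> real \<Rightarrow> real"
  assumes "\<phi> \<in> test_functions U" "open U" "bounded U"
  shows "\<phi> \<in> H10 U"
proof -
  have "is_weak_grad U (\<lambda>_. 0) (\<lambda>_. 0 :: real \<times> real)"
    by (auto simp: is_weak_grad_def square_integrable_on_def)
  then have "AE x in lebesgue_on U. weak_grad U (\<lambda>_. 0) x = (0 :: real \<times> real)"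
    using assms(2) by (rule weak_grad_AE_eq)
  then have "AE x in lebesgue_on U. (norm (weak_grad U (\<lambda>_. 0) x :: real \<times> real))\<^sup>2 = 0"
    by eventually_elim simp
  from integral_eq_zero_AE[OF this] have "H1_norm U (\<lambda>x. \<phi> x - \<phi> x) = 0"
    by (simp add: H1_norm_def L2_norm_def)
  then have "(\<lambda>n::nat. H1_norm U (\<lambda>x. \<phi> x - \<phi> x)) \<longlonglongrightarrow> 0" by simp
  then show ?thesis
    unfolding H10_def using test_function_in_H1[OF assms] assms(1)
    by (intro CollectI conjI exI[of _ "\<lambda>_. \<phi>"]) auto
qed

lemma compact_K: "compact K1" "compact K2" "compact K3" "compact K4" "compact K5" "compact K6"
  by (simp_all add: K1_def K2_def K3_def K4_def K5_def K6_def finite_imp_compact_convex_hull)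

lemma borel_measurable_coeff: "coeff \<epsilon> \<in> borel_measurable (lebesgue_on S)"
proof -
  have "K1 \<union> K4 \<in> sets borel" using compact_K(1,4) by (intro sets.Un borel_closed compact_imp_closed)
  then have "coeff \<epsilon> \<in> borel_measurable borel"
    unfolding coeff_def[abs_def] by (intro measurable_If_set) auto
  then show ?thesis by (intro measurable_restrict_space1 measurable_completion) simp
qed

lemma coeff_nonneg: "0 \<le> coeff \<epsilon> x" by (simp add: coeff_def)

text \<open>The energy norm may be computed with any weak gradient, and \<open>\<omega>\<close> may be replaced by the open
  set \<open>U\<close>.\<close>

lemma energy_norm_square:
  fixes w :: "real \<times> real \<Rightarrow> real"
  assumes g: "is_weak_grad U w g" and U: "open U" "U \<subseteq> \<omega>"
    and \<omega>: "\<omega> \<in> sets lebesgue" "negligible (\<omega> - U)"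
  shows "(energy_norm \<epsilon> U \<omega> w)\<^sup>2 = (\<integral>x. coeff \<epsilon> x * (norm (g x))\<^sup>2 \<partial>lebesgue_on U)"
proof -
  let ?F = "\<lambda>x. coeff \<epsilon> x * (norm (weak_grad U w x))\<^sup>2" and ?G = "\<lambda>x. coeff \<epsilon> x * (norm (g x))\<^sup>2"
  have Um: "U \<in> sets lebesgue" using U by simp
  have meas: "(\<lambda>x. if x \<in> U then ?G x else 0) \<in> borel_measurable lebesgue"
    using is_weak_grad_square_integrable[OF g] Um
    by (intro borel_measurable_if_I borel_measurable_times borel_measurable_coeff)
      (auto simp: square_integrable_on_def)
  have ae: "AE x in lebesgue. (if x \<in> U then ?G x else 0) = (if x \<in> \<omega> then ?F x else 0)"
  proof -
    have "AE x in lebesgue. x \<in> U \<longrightarrow> weak_grad U w x = g x"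
      using weak_grad_AE_eq[OF g U(1)] Um by (simp add: AE_restrict_space_iff)
    moreover have "AE x in lebesgue. x \<notin> \<omega> - U"
      using \<omega>(2) by (intro AE_not_in) (simp add: negligible_iff_null_sets)
    ultimately show ?thesis by eventually_elim (use U(2) in auto)
  qed
  have "(energy_norm \<epsilon> U \<omega> w)\<^sup>2 = (\<integral>x. ?F x \<partial>lebesgue_on \<omega>)"
    by (simp add: energy_norm_def L2_norm_def power_mult_distrib coeff_nonneg)
  also have "\<dots> = (\<integral>x. (if x \<in> \<omega> then ?F x else 0) \<partial>lebesgue)"
    by (rule Lebesgue_Measure.integral_restrict_UNIV[OF \<omega>(1), symmetric])
  also have "\<dots> = (\<integral>x. (if x \<in> U then ?G x else 0) \<partial>lebesgue)"
    using ae by (intro integral_cong_AE meas borel_measurable_AE[OF meas]) auto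
  also have "\<dots> = (\<integral>x. ?G x \<partial>lebesgue_on U)"
    by (rule Lebesgue_Measure.integral_restrict_UNIV[OF Um])
  finally show ?thesis .
qed

section \<open>The hexagon and its triangles\<close>

lemma convex_hull_triangle_origin:
  fixes p q :: "real \<times> real"
  shows "convex hull {(0, 0), p, q} = {u *\<^sub>R p + v *\<^sub>R q |u v. 0 \<le> u \<and> 0 \<le> v \<and> u + v \<le> 1}"
  using convex_hull_3_alt[of "0 :: real \<times> real" p q] by (simp flip: zero_prod_def)

lemma convex_hull_triangle_coordinates:
  fixes p q :: "real \<times> real"
  assumes "\<And>u v. f (u *\<^sub>R p + v *\<^sub>R q) = u" "\<And>u v. g (u *\<^sub>R p + v *\<^sub>R q) = v" "\<And>z. z = f z *\<^sub>R p + g z *\<^sub>R q"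
  shows "convex hull {(0, 0), p, q} = {z. 0 \<le> f z \<and> 0 \<le> g z \<and> f z + g z \<le> 1}"
  unfolding convex_hull_triangle_origin using assms by (auto; metis)

lemma K1_eq: "K1 = {(x, y). 0 \<le> x \<and> 0 \<le> y \<and> x + y \<le> 1}"
  unfolding K1_def
  by (subst convex_hull_triangle_coordinates[of "\<lambda>(x, y). x" _ _ "\<lambda>(x, y). y"]) auto

lemma K2_eq: "K2 = {(x, y). x \<le> 0 \<and> 0 \<le> x + y \<and> y \<le> 1}"
  unfolding K2_def
  by (subst convex_hull_triangle_coordinates[of "\<lambda>(x, y). x + y" _ _ "\<lambda>(x, y). - x"]) auto

lemma K3_eq: "K3 = {(x, y). 0 \<le> y \<and> x + y \<le> 0 \<and> -1 \<le> x}"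
  unfolding K3_def
  by (subst convex_hull_triangle_coordinates[of "\<lambda>(x, y). y" _ _ "\<lambda>(x, y). - x - y"]) auto

lemma K4_eq: "K4 = {(x, y). x \<le> 0 \<and> y \<le> 0 \<and> -1 \<le> x + y}"
  unfolding K4_def
  by (subst convex_hull_triangle_coordinates[of "\<lambda>(x, y). - x" _ _ "\<lambda>(x, y). - y"]) auto

lemma K5_eq: "K5 = {(x, y). 0 \<le> x \<and> x + y \<le> 0 \<and> -1 \<le> y}"
  unfolding K5_def
  by (subst convex_hull_triangle_coordinates[of "\<lambda>(x, y). - x - y" _ _ "\<lambda>(x, y). x"]) auto

lemma K6_eq: "K6 = {(x, y). y \<le> 0 \<and> 0 \<le> x + y \<and> x \<le> 1}"
  unfolding K6_def
  by (subst convex_hull_triangle_coordinates[of "\<lambda>(x, y). - y" _ _ "\<lambda>(x, y). x + y"]) auto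

lemmas K_eqs = K1_eq K2_eq K3_eq K4_eq K5_eq K6_eq

lemma Omega_eq: "Omega = {(x, y). -1 < x \<and> x < 1 \<and> -1 < y \<and> y < 1 \<and> -1 < x + y \<and> x + y < 1}"
proof -
  have eq: "{(x, y). -1 \<le> x \<and> x \<le> 1 \<and> -1 \<le> y \<and> y \<le> 1 \<and> -1 \<le> x + y \<and> x + y \<le> (1::real)}
    = {z. (1, 0) \<bullet> z \<le> 1} \<inter> {z. (-1, 0) \<bullet> z \<le> 1} \<inter> {z. (0, 1) \<bullet> z \<le> 1} \<inter> {z. (0, -1) \<bullet> z \<le> 1}
      \<inter> {z. (1, 1) \<bullet> z \<le> 1} \<inter> {z. (-1, -1) \<bullet> z \<le> 1}"
    by auto
  show ?thesis unfolding Omega_def eq interior_Int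
    by (subst interior_halfspace_le, simp add: zero_prod_def)+ auto
qed

lemma open_Omega: "open Omega" by (simp add: Omega_def)

lemma Omega_subset_box: "Omega \<subseteq> cbox (-1, -1) (1, 1)"
  by (auto simp: Omega_eq cbox_Pair_eq)

lemma bounded_Omega: "bounded Omega"
  using bounded_subset[OF bounded_cbox Omega_subset_box] .

lemma Triangulation_subset_box: "K \<in> Triangulation \<Longrightarrow> K \<subseteq> cbox (-1, -1) (1, 1)"
  by (auto simp: Triangulation_def K_eqs cbox_Pair_eq)

lemma compact_Triangulation: "K \<in> Triangulation \<Longrightarrow> compact K"
  using compact_K by (auto simp: Triangulation_def)

lemma convex_Triangulation: "K \<in> Triangulation \<Longrightarrow> convex K"
  by (auto simp: Triangulation_def K1_def K2_def K3_def K4_def K5_def K6_def)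

section \<open>The boundary values of piecewise affine functions\<close>

text \<open>A function vanishing on one of the sides orthogonal to an axis is controlled on the box by
  its gradient, with the width of the box as a factor: integrate by parts against the
  distance from the opposite side.\<close>

lemma integral_box_le_grad:
  fixes \<phi> :: "real \<times> real \<Rightarrow> real"
  assumes \<phi>: "C_k (Suc 0) \<phi>" and ab: "a1 \<le> b1" "a2 \<le> b2"
    and side: "(\<forall>y. \<phi> (a1, y) = 0) \<and> d = b1 - a1 \<or> (\<forall>y. \<phi> (b1, y) = 0) \<and> d = b1 - a1
      \<or> (\<forall>x. \<phi> (x, a2) = 0) \<and> d = b2 - a2 \<or> (\<forall>x. \<phi> (x, b2) = 0) \<and> d = b2 - a2"
  shows "\<bar>integral (cbox (a1, a2) (b1, b2)) \<phi>\<bar> \<le> d * integral (cbox (a1, a2) (b1, b2)) (\<lambda>z. norm (grad \<phi> z))"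
proof -
  let ?B = "cbox (a1, a2) (b1, b2)"
  have cont: "continuous_on S \<phi>" "continuous_on S (grad \<phi>)" for S
    using C_k_continuous[OF \<phi>] continuous_on_grad[OF \<phi>] continuous_on_subset by blast+
  have main: "\<bar>integral ?B \<phi>\<bar> \<le> d * integral ?B (\<lambda>z. norm (grad \<phi> z))"
    if l: "C_k (Suc 0) l" and v: "v \<in> {(1, 0), (0, 1)}"
      and lv: "\<And>z. frechet_derivative l (at z) v = 1" and ld: "\<And>z. z \<in> ?B \<Longrightarrow> \<bar>l z\<bar> \<le> d"
      and zero: "integral ?B (\<lambda>z. frechet_derivative (\<lambda>z. l z * \<phi> z) (at z) v) = 0" for l v
  proof -
    have lcont: "continuous_on S l" for S
      using C_k_continuous[OF l] continuous_on_subset by blast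
    have "frechet_derivative (\<lambda>z. l z * \<phi> z) (at z) v = \<phi> z + l z * (grad \<phi> z \<bullet> v)" for z
      using frechet_derivative_eqI[OF has_derivative_mult[OF C_k_SucD(1)[OF l] C_k_SucD(1)[OF \<phi>]], of z v]
        has_derivative_imp_grad(2)[OF C_k_SucD(1)[OF \<phi>]] lv by simp
    then have "integral ?B (\<lambda>z. \<phi> z + l z * (grad \<phi> z \<bullet> v)) = 0" using zero by simp
    moreover have "integral ?B (\<lambda>z. \<phi> z + l z * (grad \<phi> z \<bullet> v))
        = integral ?B \<phi> + integral ?B (\<lambda>z. l z * (grad \<phi> z \<bullet> v))"
      by (intro Henstock_Kurzweil_Integration.integral_add integrable_continuous continuous_intros cont lcont)
    ultimately have "\<bar>integral ?B \<phi>\<bar> = norm (integral ?B (\<lambda>z. l z * (grad \<phi> z \<bullet> v)))" by simp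
    also have "\<dots> \<le> integral ?B (\<lambda>z. d * norm (grad \<phi> z))"
    proof (rule integral_norm_bound_integral)
      fix z assume z: "z \<in> ?B"
      have "norm (grad \<phi> z \<bullet> v) \<le> norm (grad \<phi> z) * norm v"
        using Cauchy_Schwarz_ineq2 by simp
      then have "norm (grad \<phi> z \<bullet> v) \<le> norm (grad \<phi> z)" using v by (auto simp: norm_Pair)
      then show "norm (l z * (grad \<phi> z \<bullet> v)) \<le> d * norm (grad \<phi> z)"
        unfolding norm_mult using ld[OF z] by (intro mult_mono) auto
    qed (intro integrable_continuous continuous_intros cont lcont)+
    finally show ?thesis by simp
  qed
  have lx1: "C_k (Suc 0) (\<lambda>z :: real \<times> real. fst z - c)" for c :: real by (rule C_k_diff[OF C_k_fst C_k_const])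
  have ly1: "C_k (Suc 0) (\<lambda>z :: real \<times> real. snd z - c)" for c :: real by (rule C_k_diff[OF C_k_snd C_k_const])
  have lx2: "frechet_derivative (\<lambda>z. fst z - c) (at z) (1, 0) = 1"
    and ly2: "frechet_derivative (\<lambda>z. snd z - c) (at z) (0, 1) = 1" for c :: real and z :: "real \<times> real"
  proof -
    have "((\<lambda>z :: real \<times> real. fst z - c) has_derivative fst) (at z)" by (auto intro!: derivative_eq_intros)
    then show "frechet_derivative (\<lambda>z. fst z - c) (at z) (1, 0) = 1" by (simp add: frechet_derivative_eqI)
    have "((\<lambda>z :: real \<times> real. snd z - c) has_derivative snd) (at z)" by (auto intro!: derivative_eq_intros)
    then show "frechet_derivative (\<lambda>z. snd z - c) (at z) (0, 1) = 1" by (simp add: frechet_derivative_eqI)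
  qed
  have wx: "integral ?B (\<lambda>z. frechet_derivative (\<lambda>z. (fst z - c) * \<phi> z) (at z) (1, 0)) = 0"
    if "\<And>y. (b1 - c) * \<phi> (b1, y) = 0" "\<And>y. (a1 - c) * \<phi> (a1, y) = 0" for c
    using integral_partial_derivatives_box(1)[OF C_k_mult[OF lx1 \<phi>] ab, of c] that by (auto simp del: mult_eq_0_iff)
  have wy: "integral ?B (\<lambda>z. frechet_derivative (\<lambda>z. (snd z - c) * \<phi> z) (at z) (0, 1)) = 0"
    if "\<And>x. (b2 - c) * \<phi> (x, b2) = 0" "\<And>x. (a2 - c) * \<phi> (x, a2) = 0" for c
    using integral_partial_derivatives_box(2)[OF C_k_mult[OF ly1 \<phi>] ab, of c] that by (auto simp del: mult_eq_0_iff)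
  show ?thesis using side
  proof (elim disjE conjE)
    assume "\<forall>y. \<phi> (a1, y) = 0" "d = b1 - a1"
    then show ?thesis
      by (intro main[OF lx1[of b1], of "(1, 0)"] lx2 wx) (auto simp: cbox_Pair_eq)
  next
    assume "\<forall>y. \<phi> (b1, y) = 0" "d = b1 - a1"
    then show ?thesis
      by (intro main[OF lx1[of a1], of "(1, 0)"] lx2 wx) (auto simp: cbox_Pair_eq)
  next
    assume "\<forall>x. \<phi> (x, a2) = 0" "d = b2 - a2"
    then show ?thesis
      by (intro main[OF ly1[of b2], of "(0, 1)"] ly2 wy) (auto simp: cbox_Pair_eq)
  next
    assume "\<forall>x. \<phi> (x, b2) = 0" "d = b2 - a2"
    then show ?thesis
      by (intro main[OF ly1[of a2], of "(0, 1)"] ly2 wy) (auto simp: cbox_Pair_eq)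
  qed
qed

text \<open>Young's inequality with the free parameter \<open>t\<close>, in place of the Cauchy--Schwarz inequality.\<close>

lemma integral_norm_le_square:
  fixes f :: "'a::euclidean_space \<Rightarrow> 'b::euclidean_space"
  assumes f: "f square_integrable_on U" and U: "U \<in> lmeasurable" and V: "V \<in> sets lebesgue" "V \<subseteq> U" and t: "t > 0"
  shows "(\<integral>x. norm (f x) \<partial>lebesgue_on V) \<le> t * measure lebesgue V / 2 + (\<integral>x. (norm (f x))\<^sup>2 \<partial>lebesgue_on U) / (2 * t)"
proof -
  have Um: "U \<in> sets lebesgue" using U by (rule fmeasurableD)
  have Vl: "V \<in> lmeasurable" using U V by (metis fmeasurableI2)
  have fV: "f square_integrable_on V" by (rule square_integrable_on_subset[OF f V(2,1) Um])
  have fin: "finite_measure (lebesgue_on V)" using Vl by (rule finite_measure_lebesgue_on)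
  have int2: "integrable (lebesgue_on V) (\<lambda>x. (norm (f x))\<^sup>2)" using fV by (simp add: square_integrable_on_def)
  have const: "integrable (lebesgue_on V) (\<lambda>_. t / 2)" using fin by (rule finite_measure.integrable_const)
  have "(\<integral>x. norm (f x) \<partial>lebesgue_on V) \<le> (\<integral>x. t / 2 + (norm (f x))\<^sup>2 / (2 * t) \<partial>lebesgue_on V)"
  proof (rule Bochner_Integration.integral_mono')
    show "integrable (lebesgue_on V) (\<lambda>x. t / 2 + (norm (f x))\<^sup>2 / (2 * t))"
      using int2 const by simp
    show "norm (f x) \<le> t / 2 + (norm (f x))\<^sup>2 / (2 * t)" for x
      using t zero_le_power2[of "norm (f x) - t"] by (simp add: field_simps power2_eq_square)
  qed (use t in simp)
  also have "\<dots> = (\<integral>x. t / 2 \<partial>lebesgue_on V) + (\<integral>x. (norm (f x))\<^sup>2 \<partial>lebesgue_on V) / (2 * t)"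
    using int2 const by simp
  also have "(\<integral>x. t / 2 \<partial>lebesgue_on V) = t * measure lebesgue V / 2"
    using V(1) by (simp add: measure_restrict_space)
  also have "(\<integral>x. (norm (f x))\<^sup>2 \<partial>lebesgue_on V) \<le> (\<integral>x. (norm (f x))\<^sup>2 \<partial>lebesgue_on U)"
    using f Um V by (intro integral_mono_lebesgue_on_AE) (auto simp: square_integrable_on_def)
  finally show ?thesis using t by (simp add: divide_right_mono)
qed


text \<open>The hypothesis on the test functions passes to their limits, with the right-hand side
  estimated by the energy.\<close>

lemma H10_integral_bound:
  assumes v: "v \<in> H10 Omega"
  obtains M where "M \<ge> 0"
    and "\<And>V d t. V \<in> sets lebesgue \<Longrightarrow> V \<subseteq> Omega \<Longrightarrow> d \<ge> 0 \<Longrightarrow> t > 0 \<Longrightarrow>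
      (\<And>\<phi>. \<phi> \<in> test_functions Omega \<Longrightarrow>
        \<bar>\<integral>z. \<phi> z \<partial>lebesgue_on V\<bar> \<le> d * (\<integral>z. norm (grad \<phi> z) \<partial>lebesgue_on V)) \<Longrightarrow>
      \<bar>\<integral>z. v z \<partial>lebesgue_on V\<bar> \<le> d * (t * measure lebesgue V / 2 + M / (2 * t))"
proof -
  have O: "Omega \<in> lmeasurable" "Omega \<in> sets lebesgue"
    using lmeasurable_open[OF bounded_Omega open_Omega] by (auto simp: fmeasurableD)
  obtain \<phi> where \<phi>: "\<And>n::nat. \<phi> n \<in> test_functions Omega"
    and lim: "(\<lambda>n. H1_norm Omega (\<lambda>x. v x - \<phi> n x)) \<longlonglongrightarrow> 0"
    using v by (auto simp: H10_def)
  obtain G where vs: "v square_integrable_on Omega" and G: "is_weak_grad Omega v G"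
    using v by (auto simp: H10_def H1_def)
  define d where "d n = (\<lambda>x. v x - \<phi> n x)" for n
  define e where "e n = H1_norm Omega (d n)" for n
  have e_lim: "e \<longlonglongrightarrow> 0" using lim by (simp add: e_def[abs_def] d_def)
  have \<phi>s: "\<phi> n square_integrable_on Omega" for n
    by (rule square_integrable_on_continuous[OF C_k_continuous[OF test_function_C_k[OF \<phi>]] bounded_Omega O(2)])
  have \<phi>g: "is_weak_grad Omega (\<phi> n) (grad (\<phi> n))" for n
    by (rule is_weak_grad_C_1[OF test_function_C_k[OF \<phi>] open_Omega bounded_Omega])
  have ds: "d n square_integrable_on Omega" for n
    unfolding d_def by (rule square_integrable_on_diff[OF vs \<phi>s])
  have dg: "is_weak_grad Omega (d n) (\<lambda>x. G x - grad (\<phi> n) x)" for n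
    unfolding d_def by (rule is_weak_grad_diff[OF G \<phi>g open_Omega vs \<phi>s])
  define w where "w n = weak_grad Omega (d n)" for n
  have ws: "w n square_integrable_on Omega" for n
    unfolding w_def by (rule is_weak_grad_square_integrable[OF is_weak_grad_weak_grad[OF dg]])
  have wae: "AE x in lebesgue_on Omega. w n x = G x - grad (\<phi> n) x" for n
    unfolding w_def by (rule weak_grad_AE_eq[OF dg open_Omega])
  have e_sq: "(e n)\<^sup>2 = (\<integral>x. (norm (d n x))\<^sup>2 \<partial>lebesgue_on Omega) + (\<integral>x. (norm (w n x))\<^sup>2 \<partial>lebesgue_on Omega)" for n
    by (simp add: e_def H1_norm_def L2_norm_def w_def)
  have Gs: "G square_integrable_on Omega" by (rule is_weak_grad_square_integrable[OF G])
  define M where "M = 2 * (\<integral>x. (norm (G x))\<^sup>2 \<partial>lebesgue_on Omega) + 2"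
  have grad_le: "(\<integral>x. (norm (grad (\<phi> n) x))\<^sup>2 \<partial>lebesgue_on Omega) \<le> M - 2 + 2 * (e n)\<^sup>2" for n
  proof -
    have "(\<integral>x. (norm (grad (\<phi> n) x))\<^sup>2 \<partial>lebesgue_on Omega)
        \<le> (\<integral>x. 2 * (norm (G x))\<^sup>2 + 2 * (norm (w n x))\<^sup>2 \<partial>lebesgue_on Omega)"
    proof (rule Bochner_Integration.integral_mono_AE)
      show "integrable (lebesgue_on Omega) (\<lambda>x. (norm (grad (\<phi> n) x))\<^sup>2)"
        using is_weak_grad_square_integrable[OF \<phi>g] by (simp add: square_integrable_on_def)
      show "integrable (lebesgue_on Omega) (\<lambda>x. 2 * (norm (G x))\<^sup>2 + 2 * (norm (w n x))\<^sup>2)"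
        using Gs ws by (simp add: square_integrable_on_def)
      show "AE x in lebesgue_on Omega. (norm (grad (\<phi> n) x))\<^sup>2 \<le> 2 * (norm (G x))\<^sup>2 + 2 * (norm (w n x))\<^sup>2"
        using wae[of n]
      proof eventually_elim
        case (elim x)
        have "norm (grad (\<phi> n) x) \<le> norm (G x) + norm (w n x)"
          using norm_triangle_ineq4[of "G x" "w n x"] elim by simp
        then have "(norm (grad (\<phi> n) x))\<^sup>2 \<le> (norm (G x) + norm (w n x))\<^sup>2" by (intro power_mono) auto
        also have "\<dots> \<le> 2 * (norm (G x))\<^sup>2 + 2 * (norm (w n x))\<^sup>2"
          using zero_le_power2[of "norm (G x) - norm (w n x)"] by (simp add: power2_eq_square algebra_simps)
        finally show ?case .
      qed
    qed
    also have "\<dots> = 2 * (\<integral>x. (norm (G x))\<^sup>2 \<partial>lebesgue_on Omega) + 2 * (\<integral>x. (norm (w n x))\<^sup>2 \<partial>lebesgue_on Omega)"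
      using Gs ws by (simp add: square_integrable_on_def)
    also have "\<dots> \<le> M - 2 + 2 * (e n)\<^sup>2"
      unfolding e_sq M_def by simp
    finally show ?thesis .
  qed
  show thesis
  proof (rule that[of M])
    show "M \<ge> 0" by (simp add: M_def)
    fix V and \<delta> t :: real
    assume V: "V \<in> sets lebesgue" "V \<subseteq> Omega" and \<delta>: "\<delta> \<ge> 0" and t: "t > 0"
      and bound: "\<And>\<phi>. \<phi> \<in> test_functions Omega \<Longrightarrow>
        \<bar>\<integral>z. \<phi> z \<partial>lebesgue_on V\<bar> \<le> \<delta> * (\<integral>z. norm (grad \<phi> z) \<partial>lebesgue_on V)"
    have int1: "integrable (lebesgue_on V) f" if "f square_integrable_on Omega" for f :: "real \<times> real \<Rightarrow> real"
    proof (rule integrable_square_integrable_bound[of f V Omega f 1])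
      show "f square_integrable_on V" by (rule square_integrable_on_subset[OF that V(2,1) O(2)])
      then show "f \<in> borel_measurable (lebesgue_on V)" by (simp add: square_integrable_on_def)
    qed (use V O in auto)
    have step: "\<bar>\<integral>z. v z \<partial>lebesgue_on V\<bar> \<le> s * measure lebesgue V / 2 + (e n)\<^sup>2 / (2 * s)
        + \<delta> * (t * measure lebesgue V / 2 + (M - 2 + 2 * (e n)\<^sup>2) / (2 * t))" if s: "s > 0" for s n
    proof -
      have "(\<integral>z. v z \<partial>lebesgue_on V) = (\<integral>z. d n z \<partial>lebesgue_on V) + (\<integral>z. \<phi> n z \<partial>lebesgue_on V)"
        using int1[OF ds[of n]] int1[OF \<phi>s[of n]]
        by (simp add: d_def flip: Bochner_Integration.integral_add)
      then have "\<bar>\<integral>z. v z \<partial>lebesgue_on V\<bar> \<le> \<bar>\<integral>z. d n z \<partial>lebesgue_on V\<bar> + \<bar>\<integral>z. \<phi> n z \<partial>lebesgue_on V\<bar>"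
        by linarith
      moreover have "\<bar>\<integral>z. d n z \<partial>lebesgue_on V\<bar> \<le> s * measure lebesgue V / 2 + (e n)\<^sup>2 / (2 * s)"
      proof -
        have "\<bar>\<integral>z. d n z \<partial>lebesgue_on V\<bar> \<le> (\<integral>z. norm (d n z) \<partial>lebesgue_on V)"
          using integral_norm_bound[of "lebesgue_on V" "d n"] by simp
        also have "\<dots> \<le> s * measure lebesgue V / 2 + (\<integral>x. (norm (d n x))\<^sup>2 \<partial>lebesgue_on Omega) / (2 * s)"
          by (rule integral_norm_le_square[OF ds O(1) V s])
        also have "(\<integral>x. (norm (d n x))\<^sup>2 \<partial>lebesgue_on Omega) \<le> (e n)\<^sup>2"
          unfolding e_sq by simp
        finally show ?thesis using s by (simp add: divide_right_mono)
      qed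
      moreover have "\<bar>\<integral>z. \<phi> n z \<partial>lebesgue_on V\<bar> \<le> \<delta> * (t * measure lebesgue V / 2 + (M - 2 + 2 * (e n)\<^sup>2) / (2 * t))"
      proof -
        have "(\<integral>z. norm (grad (\<phi> n) z) \<partial>lebesgue_on V)
            \<le> t * measure lebesgue V / 2 + (\<integral>x. (norm (grad (\<phi> n) x))\<^sup>2 \<partial>lebesgue_on Omega) / (2 * t)"
          by (rule integral_norm_le_square[OF is_weak_grad_square_integrable[OF \<phi>g] O(1) V t])
        also have "\<dots> \<le> t * measure lebesgue V / 2 + (M - 2 + 2 * (e n)\<^sup>2) / (2 * t)"
          using grad_le[of n] t by (intro add_left_mono divide_right_mono) auto
        finally show ?thesis
          using bound[OF \<phi>, of n] \<delta> by (meson mult_left_mono order_trans)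
      qed
      ultimately show ?thesis by linarith
    qed
    have lim_n: "\<bar>\<integral>z. v z \<partial>lebesgue_on V\<bar> \<le> s * measure lebesgue V / 2 + 0\<^sup>2 / (2 * s)
        + \<delta> * (t * measure lebesgue V / 2 + (M - 2 + 2 * 0\<^sup>2) / (2 * t))" if s: "s > 0" for s
    proof (rule LIMSEQ_le_const)
      show "(\<lambda>n. s * measure lebesgue V / 2 + (e n)\<^sup>2 / (2 * s)
          + \<delta> * (t * measure lebesgue V / 2 + (M - 2 + 2 * (e n)\<^sup>2) / (2 * t)))
        \<longlonglongrightarrow> s * measure lebesgue V / 2 + 0\<^sup>2 / (2 * s)
          + \<delta> * (t * measure lebesgue V / 2 + (M - 2 + 2 * 0\<^sup>2) / (2 * t))"
        using s t by (intro tendsto_intros e_lim) auto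
    qed (use step[OF s] in blast)
    have "\<bar>\<integral>z. v z \<partial>lebesgue_on V\<bar> \<le> 0 * measure lebesgue V / 2
        + \<delta> * (t * measure lebesgue V / 2 + (M - 2) / (2 * t))"
    proof (rule tendsto_lowerbound[of "\<lambda>s. s * measure lebesgue V / 2
        + \<delta> * (t * measure lebesgue V / 2 + (M - 2) / (2 * t))" _ "at_right 0"])
      show "\<forall>\<^sub>F s in at_right 0. \<bar>\<integral>z. v z \<partial>lebesgue_on V\<bar> \<le> s * measure lebesgue V / 2
        + \<delta> * (t * measure lebesgue V / 2 + (M - 2) / (2 * t))"
        using lim_n by (auto simp: eventually_at_filter)
      show "((\<lambda>s. s * measure lebesgue V / 2 + \<delta> * (t * measure lebesgue V / 2 + (M - 2) / (2 * t)))
          \<longlongrightarrow> 0 * measure lebesgue V / 2 + \<delta> * (t * measure lebesgue V / 2 + (M - 2) / (2 * t))) (at_right 0)"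
        using t by (intro tendsto_intros) auto
    qed simp
    also have "\<dots> \<le> \<delta> * (t * measure lebesgue V / 2 + M / (2 * t))"
      using \<delta> t by (auto intro!: mult_left_mono divide_right_mono)
    finally show "\<bar>\<integral>z. v z \<partial>lebesgue_on V\<bar> \<le> \<delta> * (t * measure lebesgue V / 2 + M / (2 * t))" .
  qed
qed


lemma integral_affine_interval:
  fixes p q :: real
  assumes "a \<le> b"
  shows "integral {a..b} (\<lambda>x. p + q * x) = (b - a) * (p + q * ((a + b) / 2))"
proof -
  have "((\<lambda>x. p + q * x) has_integral ((p * b + q * b\<^sup>2 / 2) - (p * a + q * a\<^sup>2 / 2))) {a..b}"
    by (intro fundamental_theorem_of_calculus assms)
      (auto intro!: derivative_eq_intros simp flip: has_real_derivative_iff_has_vector_derivative)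
  then show ?thesis
    by (auto dest!: integral_unique simp: power2_eq_square field_simps)
qed

lemma integral_affine_box:
  fixes A B C a1 a2 b1 b2 :: real
  assumes ab: "a1 \<le> b1" "a2 \<le> b2"
  shows "integral (cbox (a1, a2) (b1, b2)) (\<lambda>z. A + B * fst z + C * snd z)
    = (b1 - a1) * (b2 - a2) * (A + B * ((a1 + b1) / 2) + C * ((a2 + b2) / 2))" (is "?l = ?r")
proof -
  have "?l = integral {a1..b1} (\<lambda>x. integral {a2..b2} (\<lambda>y. (A + B * x) + C * y))"
  proof -
    have "continuous_on (cbox (a1, a2) (b1, b2)) (\<lambda>z. A + B * fst z + C * snd z)"
      by (intro continuous_intros)
    from integral_prod_continuous[OF this] show ?thesis by simp
  qed
  also have "\<dots> = integral {a1..b1} (\<lambda>x. ((b2 - a2) * (A + C * ((a2 + b2) / 2))) + ((b2 - a2) * B) * x)"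
    unfolding integral_affine_interval[OF ab(2)]
    by (intro Henstock_Kurzweil_Integration.integral_cong) (simp add: algebra_simps)
  also have "\<dots> = ?r"
    unfolding integral_affine_interval[OF ab(1)] by (simp add: field_simps)
  finally show ?thesis .
qed

lemma mem_box_pair:
  fixes a1 a2 b1 b2 :: real
  shows "z \<in> box (a1, a2) (b1, b2) \<longleftrightarrow> a1 < fst z \<and> fst z < b1 \<and> a2 < snd z \<and> snd z < b2"
  by (cases z) (auto simp: box_def Basis_prod_def)

lemma measure_box_pair:
  fixes a1 a2 b1 b2 :: real
  assumes ab: "a1 \<le> b1" "a2 \<le> b2"
  shows "measure lebesgue (box (a1, a2) (b1, b2)) = (b1 - a1) * (b2 - a2)"
proof -
  have "measure lebesgue (box (a1, a2) (b1, b2)) = measure lborel (cbox (a1, a2) (b1, b2))"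
    by (simp add: measure_lborel_box_eq measure_lborel_cbox_eq)
  also have "\<dots> = integral (cbox (a1, a2) (b1, b2)) (\<lambda>z. 1 + 0 * fst z + 0 * snd z)"
    by simp
  also have "\<dots> = (b1 - a1) * (b2 - a2)" unfolding integral_affine_box[OF ab] by simp
  finally show ?thesis .
qed

lemma integral_lebesgue_on_box:
  fixes f :: "'a::euclidean_space \<Rightarrow> 'b::euclidean_space"
  assumes "continuous_on (cbox a b) f"
  shows "(\<integral>z. f z \<partial>lebesgue_on (box a b)) = integral (cbox a b) f"
proof -
  have "integrable (lebesgue_on (box a b)) f"
    using absolutely_integrable_continuous[OF assms]
    by (intro absolutely_integrable_imp_integrable) (simp_all add: absolutely_integrable_on_open_interval)
  then show ?thesis by (simp add: lebesgue_integral_eq_integral integral_open_interval)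
qed

text \<open>A function in \<open>H\<^sup>1\<^sub>0\<close> that is affine near a point \<open>(p, q)\<close> inside a side of the hexagon orthogonal to an
  axis vanishes there. The boxes shrink to a part of this side: \<open>\<delta>\<close> is their width, the length \<open>l\<close> of the
  other side is fixed, and \<open>(p, q)\<close> is the limit of their centers. The integral over the box is the area
  times the value at the center, but the gradient bound makes it of smaller order than the area.\<close>

lemma H10_affine_eq_0:
  fixes a1 b1 a2 b2 :: "real \<Rightarrow> real"
  assumes v: "v \<in> H10 Omega" and aff: "\<And>z. z \<in> K \<Longrightarrow> v z = A + B * fst z + C * snd z"
    and l: "l > 0" and d0: "d0 > 0"
    and sub: "\<And>\<delta> x y. 0 < \<delta> \<Longrightarrow> \<delta> < d0 \<Longrightarrow> a1 \<delta> < x \<Longrightarrow> x < b1 \<delta> \<Longrightarrow> a2 \<delta> < y \<Longrightarrow> y < b2 \<delta> \<Longrightarrow>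
      (x, y) \<in> Omega \<inter> K"
    and box: "\<And>\<delta>. 0 < \<delta> \<Longrightarrow> \<delta> < d0 \<Longrightarrow> a1 \<delta> \<le> b1 \<delta> \<and> a2 \<delta> \<le> b2 \<delta> \<and> (b1 \<delta> - a1 \<delta>) * (b2 \<delta> - a2 \<delta>) = l * \<delta>
      \<and> (a1 \<delta> + b1 \<delta>) / 2 = p + \<delta> * p' \<and> (a2 \<delta> + b2 \<delta>) / 2 = q + \<delta> * q'
      \<and> (b1 \<delta> - a1 \<delta> = \<delta> \<and> (a1 \<delta> = -1 \<or> b1 \<delta> = 1) \<or> b2 \<delta> - a2 \<delta> = \<delta> \<and> (a2 \<delta> = -1 \<or> b2 \<delta> = 1))"
  shows "A + B * p + C * q = 0"
proof -
  obtain M where M: "M \<ge> 0"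
    and bound: "\<And>V d t. V \<in> sets lebesgue \<Longrightarrow> V \<subseteq> Omega \<Longrightarrow> d \<ge> 0 \<Longrightarrow> t > 0 \<Longrightarrow>
      (\<And>\<phi>. \<phi> \<in> test_functions Omega \<Longrightarrow>
        \<bar>\<integral>z. \<phi> z \<partial>lebesgue_on V\<bar> \<le> d * (\<integral>z. norm (grad \<phi> z) \<partial>lebesgue_on V)) \<Longrightarrow>
      \<bar>\<integral>z. v z \<partial>lebesgue_on V\<bar> \<le> d * (t * measure lebesgue V / 2 + M / (2 * t))"
    using H10_integral_bound[OF v] by metis
  define k where "k = A + B * p + C * q"
  define k' where "k' = B * p' + C * q'"
  have est: "\<bar>k + \<delta> * k'\<bar> \<le> (1 / 2 + M / (2 * l)) * sqrt \<delta>" if \<delta>: "0 < \<delta>" "\<delta> < d0" for \<delta>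
  proof -
    define a1' a2' b1' b2' where ab_def: "a1' = a1 \<delta>" "a2' = a2 \<delta>" "b1' = b1 \<delta>" "b2' = b2 \<delta>"
    note B = box[OF \<delta>, folded ab_def]
    then have ab: "a1' \<le> b1'" "a2' \<le> b2'" and area: "(b1' - a1') * (b2' - a2') = l * \<delta>"
      and ctr: "(a1' + b1') / 2 = p + \<delta> * p'" "(a2' + b2') / 2 = q + \<delta> * q'"
      and side: "b1' - a1' = \<delta> \<and> (a1' = -1 \<or> b1' = 1) \<or> b2' - a2' = \<delta> \<and> (a2' = -1 \<or> b2' = 1)"
      by auto
    have in_OK: "z \<in> Omega \<inter> K" if "z \<in> box (a1', a2') (b1', b2')" for z
      using sub[OF \<delta>, of "fst z" "snd z"] that by (simp add: mem_box_pair ab_def)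
    let ?V = "box (a1', a2') (b1', b2')"
    have "(\<integral>z. v z \<partial>lebesgue_on ?V) = (\<integral>z. A + B * fst z + C * snd z \<partial>lebesgue_on ?V)"
      using aff in_OK by (intro Bochner_Integration.integral_cong) auto
    also have "\<dots> = integral (cbox (a1', a2') (b1', b2')) (\<lambda>z. A + B * fst z + C * snd z)"
      by (intro integral_lebesgue_on_box continuous_intros)
    also have "\<dots> = l * \<delta> * (k + \<delta> * k')"
      unfolding integral_affine_box[OF ab] area ctr by (simp add: k_def k'_def algebra_simps)
    finally have int: "(\<integral>z. v z \<partial>lebesgue_on ?V) = l * \<delta> * (k + \<delta> * k')" .
    have meas: "measure lebesgue ?V = l * \<delta>" by (simp add: measure_box_pair[OF ab] area)
    \<comment> \<open>The parameter \<open>t = 1 / sqrt \<delta>\<close> balances the two terms of the bound.\<close>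
    have "\<bar>\<integral>z. v z \<partial>lebesgue_on ?V\<bar> \<le> \<delta> * ((1 / sqrt \<delta>) * measure lebesgue ?V / 2 + M / (2 * (1 / sqrt \<delta>)))"
    proof (rule bound)
      fix \<phi> :: "real \<times> real \<Rightarrow> real" assume \<phi>: "\<phi> \<in> test_functions Omega"
      have z: "\<phi> (-1, y) = 0" "\<phi> (1, y) = 0" "\<phi> (x, -1) = 0" "\<phi> (x, 1) = 0" for x y
        by (rule test_function_eq_0[OF \<phi>], simp add: Omega_eq)+
      have c: "continuous_on S \<phi>" "continuous_on S (\<lambda>z. norm (grad \<phi> z))" for S
        using C_k_continuous[OF test_function_C_k[OF \<phi>]] continuous_on_norm[OF continuous_on_grad[OF test_function_C_k[OF \<phi>]]]
          continuous_on_subset by blast+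
      have "\<bar>integral (cbox (a1', a2') (b1', b2')) \<phi>\<bar> \<le> \<delta> * integral (cbox (a1', a2') (b1', b2')) (\<lambda>z. norm (grad \<phi> z))"
        by (rule integral_box_le_grad[OF test_function_C_k[OF \<phi>] ab]) (use side z in auto)
      then show "\<bar>\<integral>z. \<phi> z \<partial>lebesgue_on ?V\<bar> \<le> \<delta> * (\<integral>z. norm (grad \<phi> z) \<partial>lebesgue_on ?V)"
        by (simp only: integral_lebesgue_on_box[OF c(1)] integral_lebesgue_on_box[OF c(2)])
    qed (use in_OK \<delta> in auto)
    also have "\<dots> = (l * \<delta>) * ((1 / 2 + M / (2 * l)) * sqrt \<delta>)"
    proof -
      define r where "r = sqrt \<delta>"
      have r: "r > 0" "\<delta> = r * r" using \<delta> by (simp_all add: r_def)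
      show ?thesis unfolding meas r_def[symmetric] using r(1) l by (simp add: r(2) field_simps)
    qed
    finally have "l * \<delta> * \<bar>k + \<delta> * k'\<bar> \<le> (l * \<delta>) * ((1 / 2 + M / (2 * l)) * sqrt \<delta>)"
      using l \<delta> by (simp add: int abs_mult)
    then show ?thesis using l \<delta> by (simp add: mult_le_cancel_left_pos)
  qed
  have "\<bar>k + 0 * k'\<bar> \<le> (1 / 2 + M / (2 * l)) * sqrt 0"
  proof (rule tendsto_le[of "at_right 0"])
    show "((\<lambda>\<delta>. (1 / 2 + M / (2 * l)) * sqrt \<delta>) \<longlongrightarrow> (1 / 2 + M / (2 * l)) * sqrt 0) (at_right 0)"
      by (intro tendsto_intros)
    show "((\<lambda>\<delta>. \<bar>k + \<delta> * k'\<bar>) \<longlongrightarrow> \<bar>k + 0 * k'\<bar>) (at_right 0)"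
      by (intro tendsto_intros)
    show "\<forall>\<^sub>F \<delta> in at_right 0. \<bar>k + \<delta> * k'\<bar> \<le> (1 / 2 + M / (2 * l)) * sqrt \<delta>"
      using est d0 unfolding eventually_at_right_field by blast
  qed simp
  then show ?thesis by (simp add: k_def)
qed

lemma P1_affine:
  assumes "v \<in> P1 K"
  obtains A B C where "\<And>z. z \<in> K \<Longrightarrow> v z = A + B * fst z + C * snd z"
proof -
  obtain l b where l: "linear l" and v: "\<And>z. z \<in> K \<Longrightarrow> v z = l z + b"
    using assms by (auto simp: P1_def)
  have "l z = l (1, 0) * fst z + l (0, 1) * snd z" for z
  proof -
    have "l z = l (fst z *\<^sub>R (1, 0) + snd z *\<^sub>R (0, 1))" by (cases z) simp
    also have "\<dots> = fst z * l (1, 0) + snd z * l (0, 1)"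
      unfolding linear_add[OF l] linear_scale[OF l] by simp
    finally show ?thesis by (simp add: mult.commute)
  qed
  note l_eq = this
  show ?thesis
  proof (rule that)
    fix z assume "z \<in> K"
    from v[OF this] show "v z = b + l (1, 0) * fst z + l (0, 1) * snd z"
      using l_eq[of z] by linarith
  qed
qed

text \<open>On the triangle with a side orthogonal to an axis, the vanishing at two inner points of the side
  determines the values at its end points.\<close>

lemma S10_H10_boundary_values:
  assumes v: "v \<in> S10 \<inter> H10 Omega"
  shows "v (1, 0) = 0" "v (0, 1) = 0" "v (-1, 0) = 0" "v (0, -1) = 0"
proof -
  have H: "v \<in> H10 Omega" using v by simp
  have P: "v \<in> P1 K2" "v \<in> P1 K3" "v \<in> P1 K5" "v \<in> P1 K6"
    using v by (auto simp: S10_def Triangulation_def)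
  show "v (1, 0) = 0"
  proof -
    obtain A B C where aff: "\<And>z. z \<in> K6 \<Longrightarrow> v z = A + B * fst z + C * snd z"
      using P1_affine[OF P(4)] by blast
    have "A + B * 1 + C * m = 0" if "m = -1/4 \<or> m = -1/2" for m
      by (rule H10_affine_eq_0[OF H aff, where K = K6 and l = "1/4" and ?d0.0 = "1/4" and ?a1.0 = "\<lambda>\<delta>. 1 - \<delta>" and ?b1.0 = "\<lambda>_. 1"
          and ?a2.0 = "\<lambda>_. m - 1/8" and ?b2.0 = "\<lambda>_. m + 1/8" and p' = "-1/2" and q' = "0"])
        (use that in \<open>auto simp: Omega_eq K6_eq\<close>)
    from this[of "-1/4"] this[of "-1/2"] show ?thesis using aff[of "(1, 0)"] by (simp add: K6_eq)
  qed
  show "v (0, 1) = 0"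
  proof -
    obtain A B C where aff: "\<And>z. z \<in> K2 \<Longrightarrow> v z = A + B * fst z + C * snd z"
      using P1_affine[OF P(1)] by blast
    have "A + B * m + C * 1 = 0" if "m = -1/4 \<or> m = -1/2" for m
      by (rule H10_affine_eq_0[OF H aff, where K = K2 and l = "1/4" and ?d0.0 = "1/4" and ?a1.0 = "\<lambda>_. m - 1/8" and ?b1.0 = "\<lambda>_. m + 1/8"
          and ?a2.0 = "\<lambda>\<delta>. 1 - \<delta>" and ?b2.0 = "\<lambda>_. 1" and p' = "0" and q' = "-1/2"])
        (use that in \<open>auto simp: Omega_eq K2_eq\<close>)
    from this[of "-1/4"] this[of "-1/2"] show ?thesis using aff[of "(0, 1)"] by (simp add: K2_eq)
  qed
  show "v (-1, 0) = 0"
  proof -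
    obtain A B C where aff: "\<And>z. z \<in> K3 \<Longrightarrow> v z = A + B * fst z + C * snd z"
      using P1_affine[OF P(2)] by blast
    have "A + B * (-1) + C * m = 0" if "m = 1/4 \<or> m = 1/2" for m
      by (rule H10_affine_eq_0[OF H aff, where K = K3 and l = "1/4" and ?d0.0 = "1/4" and ?a1.0 = "\<lambda>_. -1" and ?b1.0 = "\<lambda>\<delta>. -1 + \<delta>"
          and ?a2.0 = "\<lambda>_. m - 1/8" and ?b2.0 = "\<lambda>_. m + 1/8" and p' = "1/2" and q' = "0"])
        (use that in \<open>auto simp: Omega_eq K3_eq\<close>)
    from this[of "1/4"] this[of "1/2"] show ?thesis using aff[of "(-1, 0)"] by (simp add: K3_eq)
  qed
  show "v (0, -1) = 0"
  proof -
    obtain A B C where aff: "\<And>z. z \<in> K5 \<Longrightarrow> v z = A + B * fst z + C * snd z"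
      using P1_affine[OF P(3)] by blast
    have "A + B * m + C * (-1) = 0" if "m = 1/4 \<or> m = 1/2" for m
      by (rule H10_affine_eq_0[OF H aff, where K = K5 and l = "1/4" and ?d0.0 = "1/4" and ?a1.0 = "\<lambda>_. m - 1/8" and ?b1.0 = "\<lambda>_. m + 1/8"
          and ?a2.0 = "\<lambda>_. -1" and ?b2.0 = "\<lambda>\<delta>. -1 + \<delta>" and p' = "0" and q' = "1/2"])
        (use that in \<open>auto simp: Omega_eq K5_eq\<close>)
    from this[of "1/4"] this[of "1/2"] show ?thesis using aff[of "(0, -1)"] by (simp add: K5_eq)
  qed
qed

lemma S10_H10_affine:
  assumes v: "v \<in> S10 \<inter> H10 Omega"
  shows "z \<in> K1 \<Longrightarrow> v z = v (0, 0) * (1 - fst z - snd z)"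
    and "z \<in> K4 \<Longrightarrow> v z = v (0, 0) * (1 + fst z + snd z)"
proof -
  have P: "v \<in> P1 K1" "v \<in> P1 K4" using v by (auto simp: S10_def Triangulation_def)
  note bd = S10_H10_boundary_values[OF v]
  show "v z = v (0, 0) * (1 - fst z - snd z)" if "z \<in> K1"
  proof -
    obtain A B C where aff: "\<And>z. z \<in> K1 \<Longrightarrow> v z = A + B * fst z + C * snd z"
      using P1_affine[OF P(1)] by blast
    show ?thesis
    proof -
      have "A = v (0, 0)" "B = - A" "C = - A"
        using aff[of "(0, 0)"] aff[of "(1, 0)"] aff[of "(0, 1)"] bd by (simp_all add: K1_eq)
      then show ?thesis using aff[OF that] by (simp add: algebra_simps)
    qed
  qed
  show "v z = v (0, 0) * (1 + fst z + snd z)" if "z \<in> K4"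
  proof -
    obtain A B C where aff: "\<And>z. z \<in> K4 \<Longrightarrow> v z = A + B * fst z + C * snd z"
      using P1_affine[OF P(2)] by blast
    show ?thesis
      using aff[OF that] aff[of "(0, 0)"] aff[of "(-1, 0)"] aff[of "(0, -1)"] bd
      by (simp add: K4_eq algebra_simps)
  qed
qed

section \<open>The two kinds of errors\<close>

text \<open>The affine function that coincides on \<^const>\<open>K1\<close> with the nodal basis function of the origin.\<close>

definition corner :: "real \<times> real \<Rightarrow> real" where
  "corner z = 1 - fst z - snd z"

lemma C_k_corner: "C_k k corner"
  unfolding corner_def[abs_def] by (intro C_k_diff C_k_const C_k_fst C_k_snd)

lemma corner_has_derivative: "(corner has_derivative (\<lambda>v. - fst v - snd v)) (at z)"
  unfolding corner_def[abs_def] by (auto intro!: derivative_eq_intros)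

lemma grad_diff_scaled_corner:
  assumes "C_k (Suc 0) u"
  shows "grad (\<lambda>z. u z - \<alpha> * corner z) z = grad u z + \<alpha> *\<^sub>R (1, 1)"
proof -
  have "grad (\<lambda>z. \<alpha> * corner z) z = - \<alpha> *\<^sub>R (1, 1)"
    using has_derivative_imp_grad(1)[OF has_derivative_mult_right[OF corner_has_derivative, of \<alpha>]] by simp
  then show ?thesis
    using grad_diff[OF assms C_k_mult[OF C_k_const C_k_corner], of \<alpha>] by simp
qed

lemma grad_diff_opposite_corner:
  assumes "C_k (Suc 0) u"
  shows "grad (\<lambda>z. u z - \<alpha> * (2 - corner z)) z = grad u z - \<alpha> *\<^sub>R (1, 1)"
proof -
  have "(\<lambda>z. u z - \<alpha> * (2 - corner z)) = (\<lambda>z. (u z - 2 * \<alpha>) - (- \<alpha>) * corner z)"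
    by (auto simp: algebra_simps)
  moreover have "grad (\<lambda>z. u z - 2 * \<alpha>) z = grad u z"
    using has_derivative_imp_grad(1)[OF has_derivative_diff[OF C_k_SucD(1)[OF assms] has_derivative_const]]
    by (simp add: grad_pair)
  ultimately show ?thesis
    using grad_diff_scaled_corner[OF C_k_diff[OF assms C_k_const], of "2 * \<alpha>" "- \<alpha>" z] by simp
qed

lemma zero_in_S10_H10: "(\<lambda>_. 0) \<in> S10 \<inter> H10 Omega"
proof -
  have "(\<lambda>_. 0) \<in> test_functions Omega" by (auto simp: test_functions_def C_k_const simp del: C_k.simps)
  moreover have "linear (\<lambda>_ :: real \<times> real. 0 :: real)" by (rule linear_zero)
  ultimately show ?thesis
    using test_function_in_H10[OF _ open_Omega bounded_Omega]
    by (auto simp: S10_def P1_def intro!: exI[of _ "\<lambda>_. 0"])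
qed

lemma norm_square_ge:
  fixes a b :: "'a::real_inner"
  shows "(norm (a + b))\<^sup>2 \<ge> (norm b)\<^sup>2 / 2 - (norm a)\<^sup>2"
proof -
  have "0 \<le> (norm (2 *\<^sub>R a + b))\<^sup>2" by simp
  then show ?thesis by (simp add: power2_norm_eq_inner inner_simps algebra_simps inner_commute)
qed

text \<open>A finite element function vanishing on the boundary has a single degree of freedom \<open>\<alpha>\<close> on
  \<^term>\<open>K1 \<union> K4\<close>, the value at the origin. A small error on \<^const>\<open>K1\<close> wants \<open>\<alpha> = 1\<close>, and a small error
  on \<^const>\<open>K4\<close> wants \<open>\<alpha> = 0\<close>.\<close>

lemma global_error_ge:
  assumes u: "u \<in> test_functions Omega"
    and K4: "\<And>z. z \<in> box (-1/2, -1/2) (0, 0) \<Longrightarrow> grad u z = 0"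
    and K1: "(\<integral>z. (norm (grad u z + (1, 1)))\<^sup>2 \<partial>lebesgue_on (box (0, 0) (1/2, 1/2))) \<le> \<eta>"
  shows "global_error \<epsilon> u \<ge> 1/6 - \<eta>"
  unfolding global_error_def
proof (rule cINF_greatest)
  show "S10 \<inter> H10 Omega \<noteq> {}" using zero_in_S10_H10 by blast
  fix v assume v: "v \<in> S10 \<inter> H10 Omega"
  define \<alpha> where "\<alpha> = v (0, 0)"
  \<comment> \<open>Squares inside \<open>K1\<close> and \<open>K4\<close> suffice for a lower bound.\<close>
  let ?Q1 = "box (0, 0) (1/2, 1/2) :: (real \<times> real) set" and ?Q4 = "box (-1/2, -1/2) (0, 0) :: (real \<times> real) set"
  have uC: "C_k k u" for k by (rule test_function_C_k[OF u])
  have Om: "Omega \<in> sets lebesgue" using open_Omega by simp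
  obtain G where vs: "v square_integrable_on Omega" and G: "is_weak_grad Omega v G"
    using v by (auto simp: H10_def H1_def)
  define w where "w = (\<lambda>x. u x - v x)"
  define g where "g = (\<lambda>x. grad u x - G x)"
  have wg: "is_weak_grad Omega w g"
    unfolding w_def g_def
    by (rule is_weak_grad_diff[OF is_weak_grad_C_1[OF uC open_Omega bounded_Omega] G open_Omega
      square_integrable_on_continuous[OF C_k_continuous[OF uC] bounded_Omega Om] vs])
  have sub: "?Q1 \<subseteq> K1" "?Q4 \<subseteq> K4" "?Q1 \<subseteq> Omega" "?Q4 \<subseteq> Omega"
    by (auto simp: mem_box_pair K1_eq K4_eq Omega_eq)
  have Q: "open ?Q1" "open ?Q4" "bounded ?Q1" "bounded ?Q4" "?Q1 \<in> sets lebesgue" "?Q4 \<in> sets lebesgue"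
    by auto
  have ae1: "AE x in lebesgue. x \<in> ?Q1 \<longrightarrow> g x = grad u x + \<alpha> *\<^sub>R (1, 1)"
  proof -
    have "is_weak_grad ?Q1 (\<lambda>z. u z - \<alpha> * corner z) (grad (\<lambda>z. u z - \<alpha> * corner z))"
      by (intro is_weak_grad_C_1 Q C_k_diff C_k_mult C_k_const C_k_corner uC)
    moreover have eq: "w z = u z - \<alpha> * corner z" if "z \<in> ?Q1" for z
      using S10_H10_affine(1)[OF v subsetD[OF sub(1) that]] by (simp only: w_def corner_def \<alpha>_def)
    ultimately have "is_weak_grad ?Q1 w (grad (\<lambda>z. u z - \<alpha> * corner z))"
      by (simp only: is_weak_grad_cong[OF eq])
    from is_weak_grad_AE_unique[OF is_weak_grad_subset[OF wg sub(3) Q(1) open_Omega] this Q(1)]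
    show ?thesis by (simp add: AE_restrict_space_iff grad_diff_scaled_corner[OF uC])
  qed
  have ae4: "AE x in lebesgue. x \<in> ?Q4 \<longrightarrow> g x = - \<alpha> *\<^sub>R (1, 1)"
  proof -
    have "is_weak_grad ?Q4 (\<lambda>z. u z - \<alpha> * (2 - corner z)) (grad (\<lambda>z. u z - \<alpha> * (2 - corner z)))"
      by (intro is_weak_grad_C_1 Q C_k_diff C_k_mult C_k_const C_k_corner uC)
    moreover have eq: "w z = u z - \<alpha> * (2 - corner z)" if "z \<in> ?Q4" for z
      using S10_H10_affine(2)[OF v subsetD[OF sub(2) that]] by (simp only: w_def corner_def \<alpha>_def) simp
    ultimately have "is_weak_grad ?Q4 w (grad (\<lambda>z. u z - \<alpha> * (2 - corner z)))"
      by (simp only: is_weak_grad_cong[OF eq])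
    from is_weak_grad_AE_unique[OF is_weak_grad_subset[OF wg sub(4) Q(2) open_Omega] this Q(2)]
    have "AE x in lebesgue. x \<in> ?Q4 \<longrightarrow> g x = grad u x - \<alpha> *\<^sub>R (1, 1)"
      by (simp add: AE_restrict_space_iff grad_diff_opposite_corner[OF uC])
    then show ?thesis by eventually_elim (use K4 in auto)
  qed
  have n11: "(norm (t *\<^sub>R (1, 1) :: real \<times> real))\<^sup>2 = 2 * t\<^sup>2" for t
    by (simp add: norm_Pair)
  let ?a = "\<lambda>x. (1 - \<alpha>)\<^sup>2 - (norm (grad u x + (1, 1)))\<^sup>2"
  have cont: "continuous_on UNIV (\<lambda>x. grad u x + (1, 1))"
    by (intro continuous_intros continuous_on_grad uC)
  have int_sq: "integrable (lebesgue_on ?Q1) (\<lambda>x. (norm (grad u x + (1, 1)))\<^sup>2)"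
    using square_integrable_on_continuous[OF cont Q(3,5)] by (simp add: square_integrable_on_def)
  have int_const: "integrable (lebesgue_on ?Q1) (\<lambda>x. c :: real)" "integrable (lebesgue_on ?Q4) (\<lambda>x. c :: real)" for c
    by (simp_all add: finite_measure.integrable_const finite_measure_lebesgue_on)
  have int1: "integrable (lebesgue_on ?Q1) ?a" using int_sq int_const by simp
  have Qm: "measure lborel ?Q1 = 1/4" "measure lborel ?Q4 = 1/4"
    using measure_box_pair[of 0 "1/2" 0 "1/2"] measure_box_pair[of "-1/2" 0 "-1/2" 0] by simp_all
  have I1: "(\<integral>x. ?a x \<partial>lebesgue_on ?Q1) \<ge> (1 - \<alpha>)\<^sup>2 / 4 - \<eta>"
    using K1 int_sq int_const by (simp add: measure_restrict_space Qm)
  have I4: "(\<integral>x. 2 * \<alpha>\<^sup>2 \<partial>lebesgue_on ?Q4) = \<alpha>\<^sup>2 / 2"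
    using Qm(2) by (simp add: measure_restrict_space)
  let ?F1 = "\<lambda>x. if x \<in> ?Q1 then ?a x else 0" and ?F4 = "\<lambda>x. if x \<in> ?Q4 then 2 * \<alpha>\<^sup>2 else 0"
  let ?G = "\<lambda>x. if x \<in> Omega then coeff \<epsilon> x * (norm (g x))\<^sup>2 else 0"
  have intF: "integrable lebesgue ?F1" "integrable lebesgue ?F4"
    using int1 int_const(2) Q by (simp_all add: Lebesgue_Measure.integrable_restrict_UNIV)
  have gs: "g square_integrable_on Omega" by (rule is_weak_grad_square_integrable[OF wg])
  have intG: "integrable lebesgue ?G"
  proof (rule Lebesgue_Measure.integrable_restrict_UNIV[THEN iffD2, OF Om])
    show "integrable (lebesgue_on Omega) (\<lambda>x. coeff \<epsilon> x * (norm (g x))\<^sup>2)"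
    proof (rule Bochner_Integration.integrable_bound)
      show "integrable (lebesgue_on Omega) (\<lambda>x. (1 + \<epsilon>\<^sup>2) * (norm (g x))\<^sup>2)"
        using gs by (simp add: square_integrable_on_def)
      show "(\<lambda>x. coeff \<epsilon> x * (norm (g x))\<^sup>2) \<in> borel_measurable (lebesgue_on Omega)"
        using gs by (intro borel_measurable_times borel_measurable_coeff) (auto simp: square_integrable_on_def)
      show "AE x in lebesgue_on Omega. norm (coeff \<epsilon> x * (norm (g x))\<^sup>2) \<le> norm ((1 + \<epsilon>\<^sup>2) * (norm (g x))\<^sup>2)"
      proof (rule AE_I2)
        fix x
        have "coeff \<epsilon> x * (norm (g x))\<^sup>2 \<le> (1 + \<epsilon>\<^sup>2) * (norm (g x))\<^sup>2"
          by (intro mult_right_mono) (simp_all add: coeff_def)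
        then show "norm (coeff \<epsilon> x * (norm (g x))\<^sup>2) \<le> norm ((1 + \<epsilon>\<^sup>2) * (norm (g x))\<^sup>2)"
          by (simp add: abs_mult coeff_nonneg)
      qed
    qed
  qed
  have "1/6 - \<eta> \<le> (1 - \<alpha>)\<^sup>2 / 4 + \<alpha>\<^sup>2 / 2 - \<eta>"
    using zero_le_power2[of "3 * \<alpha> - 1"] by (simp add: power2_eq_square field_simps)
  also have "\<dots> \<le> (\<integral>x. ?F1 x \<partial>lebesgue) + (\<integral>x. ?F4 x \<partial>lebesgue)"
    unfolding Lebesgue_Measure.integral_restrict_UNIV[OF Q(5)] Lebesgue_Measure.integral_restrict_UNIV[OF Q(6)] I4
    using I1 by linarith
  also have "\<dots> = (\<integral>x. ?F1 x + ?F4 x \<partial>lebesgue)"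
    using intF by simp
  also have "\<dots> \<le> (\<integral>x. ?G x \<partial>lebesgue)"
  proof (rule Bochner_Integration.integral_mono_AE)
    show "AE x in lebesgue. ?F1 x + ?F4 x \<le> ?G x"
      using ae1 ae4
    proof eventually_elim
      case (elim x)
      consider "x \<in> ?Q1" "x \<notin> ?Q4" | "x \<in> ?Q4" "x \<notin> ?Q1" | "x \<notin> ?Q1" "x \<notin> ?Q4"
        by (auto simp: mem_box_pair)
      then show ?case
      proof cases
        case 1
        have "g x = (grad u x + (1, 1)) + (\<alpha> - 1) *\<^sub>R (1, 1)"
          using elim(1) 1 by (simp add: prod_eq_iff)
        then have "(norm (g x))\<^sup>2 \<ge> (norm ((\<alpha> - 1) *\<^sub>R (1, 1) :: real \<times> real))\<^sup>2 / 2 - (norm (grad u x + (1, 1)))\<^sup>2"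
          by (simp only: norm_square_ge)
        then have "?a x \<le> (norm (g x))\<^sup>2"
          unfolding n11 by (simp add: power2_commute)
        moreover have "coeff \<epsilon> x = 1" using 1 sub by (auto simp: coeff_def)
        ultimately show ?thesis using 1 sub by auto
      next
        case 2
        then have "(norm (g x))\<^sup>2 = 2 * \<alpha>\<^sup>2" using elim(2) n11[of "- \<alpha>"] by simp
        moreover have "coeff \<epsilon> x = 1" using 2 sub by (auto simp: coeff_def)
        ultimately show ?thesis using 2 sub by auto
      next
        case 3
        then show ?thesis by (simp add: coeff_nonneg)
      qed
    qed
  qed (use intF intG in auto)
  also have "\<dots> = (\<integral>x. coeff \<epsilon> x * (norm (g x))\<^sup>2 \<partial>lebesgue_on Omega)"
    by (rule Lebesgue_Measure.integral_restrict_UNIV[OF Om])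
  also have "\<dots> = (energy_norm \<epsilon> Omega Omega w)\<^sup>2"
    using energy_norm_square[OF wg open_Omega order_refl Om] by simp
  finally show "1/6 - \<eta> \<le> (energy_norm \<epsilon> Omega Omega (\<lambda>x. u x - v x))\<^sup>2"
    by (simp add: w_def)
qed

lemma negligible_Union_minus_interior:
  assumes "\<T> \<subseteq> Triangulation"
  shows "negligible (\<Union>\<T> - interior (\<Union>\<T>))" and "closed (\<Union>\<T>)"
proof -
  have fin: "finite \<T>" using assms by (rule finite_subset) (simp add: Triangulation_def)
  show cl: "closed (\<Union>\<T>)"
    using assms compact_Triangulation fin by (intro closed_Union) (auto intro: compact_imp_closed)
  have "\<Union>\<T> - interior (\<Union>\<T>) = frontier (\<Union>\<T>)"
    using cl by (simp add: frontier_def)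
  also have "\<dots> \<subseteq> (\<Union>K\<in>\<T>. frontier K)" using fin by (rule frontier_Union_subset)
  finally show "negligible (\<Union>\<T> - interior (\<Union>\<T>))"
    using fin assms convex_Triangulation
    by (elim negligible_subset[rotated]) (auto intro!: negligible_Union negligible_convex_frontier)
qed

lemma local_energy_le:
  fixes f w E :: "real \<times> real \<Rightarrow> real"
  assumes f: "C_k (Suc 0) f" and \<T>: "\<T> \<subseteq> Triangulation" and w: "\<And>x. x \<in> \<Union>\<T> \<Longrightarrow> w x = f x"
    and E: "integrable (lebesgue_on (cbox (-1, -1) (1, 1))) E" "\<And>x. x \<in> cbox (-1, -1) (1, 1) \<Longrightarrow> 0 \<le> E x"
    and bound: "AE x in lebesgue. x \<in> \<Union>\<T> \<longrightarrow> coeff \<epsilon> x * (norm (grad f x))\<^sup>2 \<le> E x"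
  shows "(energy_norm \<epsilon> (interior (\<Union>\<T>)) (\<Union>\<T>) w)\<^sup>2 \<le> (\<integral>x. E x \<partial>lebesgue_on (cbox (-1, -1) (1, 1)))"
proof -
  let ?\<omega> = "\<Union>\<T>" and ?U = "interior (\<Union>\<T>)" and ?Q = "cbox (-1, -1) (1, 1) :: (real \<times> real) set"
  have \<omega>Q: "?\<omega> \<subseteq> ?Q" using \<T> Triangulation_subset_box by blast
  then have U: "?U \<subseteq> ?Q" "bounded ?U" "?U \<subseteq> ?\<omega>"
    using interior_subset bounded_subset[OF bounded_cbox] by (meson order_trans)+
  have "is_weak_grad ?U f (grad f)" by (rule is_weak_grad_C_1[OF f open_interior U(2)])
  then have g: "is_weak_grad ?U w (grad f)"
    using is_weak_grad_cong[of ?U w f "grad f"] w U(3) by (meson subsetD)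
  have "(energy_norm \<epsilon> ?U ?\<omega> w)\<^sup>2 = (\<integral>x. coeff \<epsilon> x * (norm (grad f x))\<^sup>2 \<partial>lebesgue_on ?U)"
    using negligible_Union_minus_interior[OF \<T>]
    by (intro energy_norm_square[OF g open_interior U(3)]) auto
  also have "\<dots> \<le> (\<integral>x. E x \<partial>lebesgue_on ?Q)"
  proof (rule integral_mono_lebesgue_on_AE[OF E(1) _ _ U(1)])
    show "AE x in lebesgue_on ?U. coeff \<epsilon> x * (norm (grad f x))\<^sup>2 \<le> E x"
      unfolding AE_restrict_space_iff[of ?U lebesgue, simplified]
      using bound by eventually_elim (use U(3) in auto)
    show "AE x in lebesgue_on ?Q. 0 \<le> E x" by (rule AE_I2) (use E(2) in auto)
  qed auto
  finally show ?thesis .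
qed

lemma affine_in_P1: "(\<lambda>_. 0) \<in> P1 K" "corner \<in> P1 K"
proof -
  show "(\<lambda>_. 0) \<in> P1 K"
    unfolding P1_def by (rule CollectI, rule exI[of _ "\<lambda>_. 0"]) (auto intro: linear_zero)
  have "linear (\<lambda>z :: real \<times> real. - fst z - snd z)"
    by (auto simp: linear_iff algebra_simps)
  moreover have "\<forall>z\<in>K. corner z = (- fst z - snd z) + 1" by (simp add: corner_def)
  ultimately show "corner \<in> P1 K" unfolding P1_def by blast
qed

lemma affine_in_S10: "(\<lambda>_. 0) \<in> S10" "corner \<in> S10"
  using affine_in_P1 continuous_on_subset[OF C_k_continuous[OF C_k_corner] subset_UNIV]
  by (auto simp: S10_def)

lemma element_error_le:
  "P \<in> P1 K \<Longrightarrow> element_error \<epsilon> K u \<le> (energy_norm \<epsilon> (interior K) K (\<lambda>x. u x - P x))\<^sup>2"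
  unfolding element_error_def by (rule cINF_lower[OF bdd_belowI2[of _ 0]]) auto

lemma patch_error_le:
  "V \<in> S10 \<Longrightarrow> patch_error \<epsilon> \<omega> u \<le> (energy_norm \<epsilon> (interior \<omega>) \<omega> (\<lambda>x. u x - restrict V \<omega> x))\<^sup>2"
  unfolding patch_error_def S10_restricted_def
  by (rule cINF_lower[OF bdd_belowI2[of _ 0]]) (simp, rule imageI)

lemma element_error_nonneg: "0 \<le> element_error \<epsilon> K u"
  unfolding element_error_def using affine_in_P1 by (intro cINF_greatest) auto

lemma patch_error_nonneg: "0 \<le> patch_error \<epsilon> \<omega> u"
  unfolding patch_error_def S10_restricted_def using affine_in_S10 by (intro cINF_greatest) auto

text \<open>The two triangles meet only at the origin.\<close>

lemma not_edge_of_K1_K4: "\<not> (F edge_of K1 \<and> F edge_of K4)"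
proof
  assume F: "F edge_of K1 \<and> F edge_of K4"
  then have "F \<subseteq> K1 \<inter> K4" by (auto simp: edge_of_def dest: face_of_imp_subset)
  also have "\<dots> \<subseteq> {(0, 0)}" by (auto simp: K1_eq K4_eq)
  finally have "aff_dim F \<le> aff_dim {(0, 0) :: real \<times> real}" by (rule aff_dim_subset)
  then show False using F by (simp add: edge_of_def)
qed

text \<open>A patch that does not contain \<^const>\<open>K1\<close> may still meet it, and likewise for \<^const>\<open>K4\<close>; but the points of these
  triangles that lie in another triangle lie on the axes.\<close>

lemma AE_not_on_axes: "AE z in lebesgue. fst z \<noteq> (0::real) \<and> snd z \<noteq> (0::real)"
proof -
  have "negligible {z :: real \<times> real. (1, 0) \<bullet> z = 0}" "negligible {z :: real \<times> real. (0, 1) \<bullet> z = 0}"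
    by (rule negligible_hyperplane, simp add: zero_prod_def)+
  then have "{z :: real \<times> real. (1, 0) \<bullet> z = 0} \<in> null_sets lebesgue"
    "{z :: real \<times> real. (0, 1) \<bullet> z = 0} \<in> null_sets lebesgue"
    by (simp_all only: negligible_iff_null_sets)
  from this[THEN AE_not_in] show ?thesis by eventually_elim (auto simp: inner_prod_def)
qed

text \<open>On an element or a patch that does not contain \<^const>\<open>K1\<close> the function \<open>u\<close> is compared with \<open>0\<close>, on the
  others, which do not contain \<^const>\<open>K4\<close>, with \<^const>\<open>corner\<close>. Wherever the approximation is poor the
  coefficient is \<open>\<epsilon>\<^sup>2\<close>.\<close>

lemma local_errors_le:
  fixes u E :: "real \<times> real \<Rightarrow> real"
  assumes u: "C_k (Suc 0) u"
    and E: "integrable (lebesgue_on (cbox (-1, -1) (1, 1))) E" "\<And>x. x \<in> cbox (-1, -1) (1, 1) \<Longrightarrow> 0 \<le> E x"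
    and K1: "\<And>z. z \<in> K1 \<Longrightarrow> (norm (grad u z + (1, 1)))\<^sup>2 \<le> E z"
    and K4: "\<And>z. z \<in> K4 \<Longrightarrow> grad u z = 0"
    and K: "\<And>z. z \<in> \<Union>Triangulation \<Longrightarrow> \<epsilon>\<^sup>2 * (norm (grad u z))\<^sup>2 \<le> E z"
    and K': "\<And>z. z \<in> \<Union>Triangulation \<Longrightarrow> \<epsilon>\<^sup>2 * (norm (grad u z + (1, 1)))\<^sup>2 \<le> E z"
  shows "K \<in> Triangulation \<Longrightarrow> element_error \<epsilon> K u \<le> (\<integral>x. E x \<partial>lebesgue_on (cbox (-1, -1) (1, 1)))" (is "_ \<Longrightarrow> ?element")
    and "patch_error \<epsilon> (edge_patch F) u \<le> (\<integral>x. E x \<partial>lebesgue_on (cbox (-1, -1) (1, 1)))" (is ?patch)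
proof -
  let ?I = "\<integral>x. E x \<partial>lebesgue_on (cbox (-1, -1) (1, 1))"
  have local: "\<exists>V\<in>{\<lambda>_. 0, corner}. \<forall>w. (\<forall>x\<in>\<Union>\<T>. w x = u x - V x) \<longrightarrow> (energy_norm \<epsilon> (interior (\<Union>\<T>)) (\<Union>\<T>) w)\<^sup>2 \<le> ?I"
    if \<T>: "\<T> \<subseteq> Triangulation" "K1 \<notin> \<T> \<or> K4 \<notin> \<T>" for \<T>
  proof (cases "K1 \<in> \<T>")
    case False
    have "AE x in lebesgue. x \<in> \<Union>\<T> \<longrightarrow> coeff \<epsilon> x * (norm (grad u x))\<^sup>2 \<le> E x"
      using AE_not_on_axes
    proof eventually_elim
      case (elim z)
      show ?case
      proof
        assume z: "z \<in> \<Union>\<T>"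
        then have zT: "z \<in> \<Union>Triangulation" using \<T>(1) by blast
        have "z \<notin> K1"
        proof
          assume "z \<in> K1"
          moreover obtain K where "K \<in> Triangulation - {K1}" "z \<in> K" using z \<T>(1) False by auto
          ultimately show False using elim by (auto simp: Triangulation_def K_eqs)
        qed
        then show "coeff \<epsilon> z * (norm (grad u z))\<^sup>2 \<le> E z"
          using K[OF zT] K4[of z] by (cases "z \<in> K4") (auto simp: coeff_def)
      qed
    qed
    from local_energy_le[OF u \<T>(1) _ E this]
    show ?thesis by (intro bexI[of _ "\<lambda>_. 0"]) auto
  next
    case True
    have "AE x in lebesgue. x \<in> \<Union>\<T> \<longrightarrow> coeff \<epsilon> x * (norm (grad (\<lambda>z. u z - corner z) x))\<^sup>2 \<le> E x"
      using AE_not_on_axes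
    proof eventually_elim
      case (elim z)
      show ?case
      proof
        assume z: "z \<in> \<Union>\<T>"
        then have zT: "z \<in> \<Union>Triangulation" using \<T>(1) by blast
        have "z \<notin> K4"
        proof
          assume "z \<in> K4"
          moreover obtain K where "K \<in> Triangulation - {K4}" "z \<in> K" using z \<T> True by auto
          ultimately show False using elim by (auto simp: Triangulation_def K_eqs)
        qed
        then show "coeff \<epsilon> z * (norm (grad (\<lambda>z. u z - corner z) z))\<^sup>2 \<le> E z"
          using K'[OF zT] K1[of z] grad_diff_scaled_corner[OF u, of 1 z]
          by (cases "z \<in> K1") (auto simp: coeff_def)
      qed
    qed
    from local_energy_le[OF C_k_diff[OF u C_k_corner] \<T>(1) _ E this]
    show ?thesis by (intro bexI[of _ corner]) auto
  qed
  show ?element if "K \<in> Triangulation"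
  proof -
    have "K1 \<noteq> K4"
    proof
      assume "K1 = K4"
      moreover have "(1, 0) \<in> K1" "(1, 0) \<notin> K4" by (auto simp: K1_eq K4_eq)
      ultimately show False by simp
    qed
    then obtain V where V: "V \<in> {\<lambda>_. 0, corner}" "(energy_norm \<epsilon> (interior K) K (\<lambda>x. u x - V x))\<^sup>2 \<le> ?I"
      using local[of "{K}"] \<open>K \<in> Triangulation\<close> by force
    then show ?thesis using element_error_le[of V K \<epsilon> u] affine_in_P1 by auto
  qed
  let ?\<T> = "{K \<in> Triangulation. F edge_of K}"
  have "?\<T> \<subseteq> Triangulation" "K1 \<notin> ?\<T> \<or> K4 \<notin> ?\<T>" using not_edge_of_K1_K4 by auto
  from local[OF this] obtain V where V: "V \<in> {\<lambda>_. 0, corner}"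
    "(energy_norm \<epsilon> (interior (edge_patch F)) (edge_patch F) (\<lambda>x. u x - restrict V (edge_patch F) x))\<^sup>2 \<le> ?I"
    unfolding edge_patch_def by fastforce
  then show ?patch using patch_error_le[of V \<epsilon> "edge_patch F" u] affine_in_S10 by auto
qed

section \<open>The singular function\<close>

text \<open>The regularization length is chosen so that its power \<open>2 \<epsilon>\<close> equals \<open>\<epsilon>\<close>.\<close>

definition reg_length :: "real \<Rightarrow> real" where
  "reg_length \<epsilon> = \<epsilon> powr (1 / (2 * \<epsilon>))"

text \<open>A third of the regularized squared distance from the origin; the factor makes it at most one
  on the square \<open>[-1, 1]\<^sup>2\<close> that contains the hexagon.\<close>

definition reg_square :: "real \<Rightarrow> real \<times> real \<Rightarrow> real" where
  "reg_square \<epsilon> z = ((fst z)\<^sup>2 + (snd z)\<^sup>2 + (reg_length \<epsilon>)\<^sup>2) / 3"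

text \<open>Up to a constant factor, approximately \<open>r\<^sup>\<epsilon> \<psi>\<close> in polar coordinates, where the angular factor \<open>\<psi>\<close> equals \<open>1\<close> on \<^const>\<open>K1\<close>
  and \<open>0\<close> for \<open>x + y \<le> 0\<close>.\<close>

definition origin_profile :: "real \<Rightarrow> real \<times> real \<Rightarrow> real" where
  "origin_profile \<epsilon> z =
     smooth_step ((fst z + snd z) * reg_square \<epsilon> z powr (- (1/2))) * reg_square \<epsilon> z powr (\<epsilon> / 2)"

text \<open>The function \<^const>\<open>corner\<close>, cut off where one of the affine functions \<open>1 - x - y\<close>, \<open>1 - x\<close>, \<open>1 - y\<close> is below \<open>\<epsilon>\<close>.
  Each of them vanishes on one of the three sides of the hexagon whose inner points satisfy \<open>x + y > 0\<close>.\<close>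

definition boundary_profile :: "real \<Rightarrow> real \<times> real \<Rightarrow> real" where
  "boundary_profile \<epsilon> z = corner z *
     (smooth_step (corner z / \<epsilon>) * (smooth_step ((1 - fst z) / \<epsilon>) * smooth_step ((1 - snd z) / \<epsilon>)))"

text \<open>The counterexample: close to \<^const>\<open>corner\<close> on \<^const>\<open>K1\<close>, zero for \<open>x + y \<le> 0\<close>, and smooth with compact
  support in the hexagon.\<close>

definition singular_function :: "real \<Rightarrow> real \<times> real \<Rightarrow> real" where
  "singular_function \<epsilon> z = boundary_profile \<epsilon> z * origin_profile \<epsilon> z"

lemma reg_length_pos: "0 < \<epsilon> \<Longrightarrow> 0 < reg_length \<epsilon>"
  by (simp add: reg_length_def)

lemma reg_length_powr: "0 < \<epsilon> \<Longrightarrow> reg_length \<epsilon> powr (2 * \<epsilon>) = \<epsilon>"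
  by (simp add: reg_length_def powr_powr)

lemma reg_length_le_1: "0 < \<epsilon> \<Longrightarrow> \<epsilon> < 1 \<Longrightarrow> reg_length \<epsilon> \<le> 1"
  unfolding reg_length_def by (intro powr_le1) auto

lemma reg_square_pos: "0 < \<epsilon> \<Longrightarrow> 0 < reg_square \<epsilon> z"
  using reg_length_pos[of \<epsilon>] by (simp add: reg_square_def add_nonneg_pos)

lemma reg_square_le_1:
  assumes "0 < \<epsilon>" "\<epsilon> < 1" "z \<in> cbox (-1, -1) (1, 1)"
  shows "reg_square \<epsilon> z \<le> 1"
proof -
  have "\<bar>fst z\<bar> \<le> 1" "\<bar>snd z\<bar> \<le> 1"
    using assms(3) by (cases z; auto simp: cbox_Pair_eq)+
  then have "(fst z)\<^sup>2 \<le> 1" "(snd z)\<^sup>2 \<le> 1" by (simp_all add: abs_square_le_1)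
  moreover have "(reg_length \<epsilon>)\<^sup>2 \<le> 1"
    using reg_length_le_1[OF assms(1,2)] reg_length_pos[OF assms(1)] by (simp add: abs_square_le_1)
  ultimately show ?thesis by (simp add: reg_square_def)
qed

lemma C_k_reg_square: "C_k k (reg_square \<epsilon>)"
proof -
  have "C_k k (\<lambda>z. (fst z * fst z + snd z * snd z + reg_length \<epsilon> * reg_length \<epsilon>) * (1/3))"
    by (intro C_k_mult C_k_add C_k_fst C_k_snd C_k_const)
  then show ?thesis by (simp add: reg_square_def[abs_def] power2_eq_square)
qed

lemma C_k_origin_profile: "0 < \<epsilon> \<Longrightarrow> C_k k (origin_profile \<epsilon>)"
  unfolding origin_profile_def[abs_def]
  by (intro C_k_mult[OF C_k_compose[OF C_k_smooth_step C_k_mult[OF C_k_add[OF C_k_fst C_k_snd]]]]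
      C_k_powr[OF C_k_reg_square] reg_square_pos)

lemma C_k_boundary_profile: "C_k k (boundary_profile \<epsilon>)"
proof -
  have "C_k k (\<lambda>z. corner z * (smooth_step (corner z * (1 / \<epsilon>)) *
      (smooth_step ((1 - fst z) * (1 / \<epsilon>)) * smooth_step ((1 - snd z) * (1 / \<epsilon>)))))"
    by (intro C_k_mult[OF C_k_corner] C_k_mult[OF C_k_compose[OF C_k_smooth_step] C_k_mult[OF C_k_compose[OF C_k_smooth_step] C_k_compose[OF C_k_smooth_step]]]
       C_k_mult[OF C_k_corner C_k_const] C_k_mult[OF C_k_diff[OF C_k_const C_k_fst] C_k_const]
       C_k_mult[OF C_k_diff[OF C_k_const C_k_snd] C_k_const])
  then show ?thesis by (simp add: boundary_profile_def[abs_def])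
qed

lemma C_k_singular_function: "0 < \<epsilon> \<Longrightarrow> C_k k (singular_function \<epsilon>)"
  unfolding singular_function_def[abs_def] by (intro C_k_mult C_k_boundary_profile C_k_origin_profile)

lemma origin_profile_eq_0:
  assumes "0 < \<epsilon>" "fst z + snd z \<le> reg_length \<epsilon> / 8"
  shows "origin_profile \<epsilon> z = 0"
proof -
  let ?q = "reg_square \<epsilon> z" and ?d = "reg_length \<epsilon>"
  have q: "?q > 0" and d: "?d > 0" using assms reg_square_pos reg_length_pos by auto
  have "(?d / 2)\<^sup>2 \<le> ?q"
    by (simp add: reg_square_def power_divide field_simps)
  then have "?d / 2 \<le> sqrt ?q" by (rule real_le_rsqrt)
  then have "fst z + snd z \<le> sqrt ?q / 4" using assms(2) by linarith
  then have "(fst z + snd z) / sqrt ?q \<le> 1/4" using q by (simp add: field_simps)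
  moreover have "?q powr (- (1/2)) = 1 / sqrt ?q"
    using q by (simp add: powr_minus powr_half_sqrt inverse_eq_divide)
  ultimately show ?thesis by (simp add: origin_profile_def smooth_step_eq_0)
qed

lemma singular_function_test_function:
  assumes \<epsilon>: "0 < \<epsilon>"
  shows "singular_function \<epsilon> \<in> test_functions Omega"
proof -
  let ?S = "{z. \<epsilon> / 4 \<le> corner z} \<inter> {z. \<epsilon> / 4 \<le> 1 - fst z} \<inter> {z. \<epsilon> / 4 \<le> 1 - snd z} \<inter> {z. reg_length \<epsilon> / 8 \<le> fst z + snd z}"
  have "z \<in> ?S" if "singular_function \<epsilon> z \<noteq> 0" for z
  proof -
    have *: "\<epsilon> / 4 \<le> t" if "smooth_step (t / \<epsilon>) \<noteq> 0" for t
      using smooth_step_eq_0[of "t / \<epsilon>"] that \<epsilon> by (force simp: field_simps)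
    have "smooth_step (corner z / \<epsilon>) \<noteq> 0" "smooth_step ((1 - fst z) / \<epsilon>) \<noteq> 0" "smooth_step ((1 - snd z) / \<epsilon>) \<noteq> 0"
      "origin_profile \<epsilon> z \<noteq> 0"
      using that by (auto simp: singular_function_def boundary_profile_def)
    then show ?thesis using *[of "corner z"] *[of "1 - fst z"] *[of "1 - snd z"] origin_profile_eq_0[OF \<epsilon>, of z] by force
  qed
  moreover have "closed ?S"
    unfolding corner_def by (intro closed_Int closed_Collect_le continuous_intros)
  ultimately have cl: "closure {z. singular_function \<epsilon> z \<noteq> 0} \<subseteq> ?S"
    by (intro closure_minimal) blast+
  have "?S \<subseteq> Omega"
    using \<epsilon> reg_length_pos[OF \<epsilon>] by (auto simp: Omega_eq corner_def)
  with cl have "closure {z. singular_function \<epsilon> z \<noteq> 0} \<subseteq> Omega" by blast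
  moreover from this have "compact (closure {z. singular_function \<epsilon> z \<noteq> 0})"
    using bounded_subset[OF bounded_Omega] by (simp add: compact_eq_bounded_closed)
  ultimately show ?thesis
    using C_k_singular_function[OF \<epsilon>] by (simp add: test_functions_def)
qed

lemma grad_singular_function_eq_0:
  assumes \<epsilon>: "0 < \<epsilon>" and z: "fst z + snd z \<le> 0"
  shows "grad (singular_function \<epsilon>) z = 0"
proof (rule grad_eq_0_if_locally_0)
  show "open {z :: real \<times> real. fst z + snd z < reg_length \<epsilon> / 8}"
    by (intro open_Collect_less continuous_intros)
  show "z \<in> {z. fst z + snd z < reg_length \<epsilon> / 8}" using z reg_length_pos[OF \<epsilon>] by simp
qed (simp add: singular_function_def origin_profile_eq_0[OF \<epsilon>])

section \<open>Pointwise bounds for the gradient\<close>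

lemma smooth_step_compose_has_derivative:
  assumes "(f has_derivative f') (at z)"
  shows "((\<lambda>z. smooth_step (f z)) has_derivative (\<lambda>v. deriv smooth_step (f z) * f' v)) (at z)"
  using has_derivative_compose[OF assms smooth_step_deriv[of "f z", unfolded has_field_derivative_def]] .

lemma powr_compose_has_derivative:
  fixes f :: "'a::real_normed_vector \<Rightarrow> real"
  assumes "(f has_derivative f') (at z)" "f z > 0"
  shows "((\<lambda>z. f z powr a) has_derivative (\<lambda>v. a * f z powr (a - 1) * f' v)) (at z)"
proof -
  have "((\<lambda>t. t powr a) has_real_derivative a * f z powr (a - 1)) (at (f z))"
    using assms(2) by (auto intro!: derivative_eq_intros)
  from has_derivative_compose[OF assms(1) this[unfolded has_field_derivative_def]] show ?thesis .
qed

lemma abs_fst_le_norm: "\<bar>fst v\<bar> \<le> norm v" and abs_snd_le_norm: "\<bar>snd v\<bar> \<le> norm v" for v :: "real \<times> real"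
  using norm_fst_le[of "fst v" "snd v"] norm_snd_le[of "snd v" "fst v"] by auto

text \<open>The indicator of the set outside which \<^const>\<open>boundary_profile\<close> coincides with \<^const>\<open>corner\<close>.\<close>

definition layer :: "real \<Rightarrow> real \<times> real \<Rightarrow> real" where
  "layer \<epsilon> z = (if corner z < \<epsilon> \<or> 1 - fst z < \<epsilon> \<or> 1 - snd z < \<epsilon> then 1 else 0)"

text \<open>In general the cut-off costs a factor \<open>1 / \<epsilon>\<close> in the layer. On \<^const>\<open>K1\<close> it does not, because
  \<^const>\<open>corner\<close> is at most \<open>1 - x\<close> and \<open>1 - y\<close> there, hence at most \<open>\<epsilon>\<close> wherever a cut-off factor varies.\<close>

lemma boundary_profile_has_derivative:
  assumes \<epsilon>: "0 < \<epsilon>" and M: "M \<ge> 1" "\<And>t. \<bar>deriv smooth_step t\<bar> \<le> M"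
  obtains A' where "(boundary_profile \<epsilon> has_derivative A') (at z)"
    and "\<And>v. \<bar>A' v\<bar> \<le> (2 + 4 * M * \<bar>corner z\<bar> / \<epsilon> * layer \<epsilon> z) * norm v"
    and "\<And>v. layer \<epsilon> z = 0 \<Longrightarrow> A' v = - fst v - snd v"
    and "\<And>v. z \<in> K1 \<Longrightarrow> \<bar>A' v\<bar> \<le> (2 + 4 * M) * norm v"
proof -
  let ?c = "corner z" and ?D = "deriv smooth_step"
  let ?s1 = "smooth_step (corner z / \<epsilon>)" and ?s2 = "smooth_step ((1 - fst z) / \<epsilon>)" and ?s3 = "smooth_step ((1 - snd z) / \<epsilon>)"
  let ?d1 = "?D (corner z / \<epsilon>)" and ?d2 = "?D ((1 - fst z) / \<epsilon>)" and ?d3 = "?D ((1 - snd z) / \<epsilon>)"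
  define dc where "dc v = - fst v - snd v" for v :: "real \<times> real"
  have dc: "(corner has_derivative dc) (at z)"
    using corner_has_derivative by (simp add: dc_def[abs_def])
  define A' where "A' v = ?c * (?s1 * (?s2 * (?d3 * (- snd v / \<epsilon>)) + ?d2 * (- fst v / \<epsilon>) * ?s3) + ?d1 * (dc v / \<epsilon>) * (?s2 * ?s3))
     + dc v * (?s1 * (?s2 * ?s3))" for v
  have 1: "((\<lambda>z. smooth_step (corner z / \<epsilon>)) has_derivative (\<lambda>v. ?d1 * (dc v / \<epsilon>))) (at z)"
    by (rule smooth_step_compose_has_derivative[OF bounded_linear.has_derivative[OF bounded_linear_divide dc]])
  have "((\<lambda>z :: real \<times> real. (1 - fst z) / \<epsilon>) has_derivative (\<lambda>v. - fst v / \<epsilon>)) (at z)"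
    using \<epsilon> by (auto intro!: derivative_eq_intros)
  note 2 = smooth_step_compose_has_derivative[OF this]
  have "((\<lambda>z :: real \<times> real. (1 - snd z) / \<epsilon>) has_derivative (\<lambda>v. - snd v / \<epsilon>)) (at z)"
    using \<epsilon> by (auto intro!: derivative_eq_intros)
  note 3 = smooth_step_compose_has_derivative[OF this]
  have der: "(boundary_profile \<epsilon> has_derivative A') (at z)"
    unfolding boundary_profile_def[abs_def] A'_def
    by (rule has_derivative_mult[OF dc has_derivative_mult[OF 1 has_derivative_mult[OF 2 3]]])
  have s: "\<bar>?s1\<bar> \<le> 1" "\<bar>?s2\<bar> \<le> 1" "\<bar>?s3\<bar> \<le> 1"
    using smooth_step_ge_0 smooth_step_le_1 by simp_all
  have dcn: "\<bar>dc v\<bar> \<le> 2 * norm v" for v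
    using abs_fst_le_norm[of v] abs_snd_le_norm[of v] by (simp add: dc_def)
  have bound: "\<bar>A' v\<bar> \<le> (\<bar>?c * ?d1\<bar> * 2 / \<epsilon> + \<bar>?c * ?d2\<bar> / \<epsilon> + \<bar>?c * ?d3\<bar> / \<epsilon> + 2) * norm v" for v
  proof -
    have m: "\<bar>a * b\<bar> \<le> t" if "\<bar>a\<bar> \<le> 1" "\<bar>b\<bar> \<le> t" for a b t :: real
      using mult_mono[OF that] that by (simp add: abs_mult)
    have h: "\<bar>a * (w / \<epsilon>)\<bar> \<le> \<bar>a\<bar> * k / \<epsilon> * norm v" if "\<bar>w\<bar> \<le> k * norm v" for a w k
    proof -
      have "\<bar>a * (w / \<epsilon>)\<bar> = \<bar>a\<bar> / \<epsilon> * \<bar>w\<bar>" using \<epsilon> by (simp add: abs_mult)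
      also have "\<dots> \<le> \<bar>a\<bar> / \<epsilon> * (k * norm v)" using that \<epsilon> by (intro mult_left_mono) auto
      finally show ?thesis by simp
    qed
    have t3: "\<bar>?s1 * (?s2 * ((?c * ?d3) * (- snd v / \<epsilon>)))\<bar> \<le> \<bar>?c * ?d3\<bar> * 1 / \<epsilon> * norm v"
      by (rule m[OF s(1) m[OF s(2) h]]) (simp add: abs_snd_le_norm)
    have t2: "\<bar>?s1 * (?s3 * ((?c * ?d2) * (- fst v / \<epsilon>)))\<bar> \<le> \<bar>?c * ?d2\<bar> * 1 / \<epsilon> * norm v"
      by (rule m[OF s(1) m[OF s(3) h]]) (simp add: abs_fst_le_norm)
    have t1: "\<bar>?s2 * (?s3 * ((?c * ?d1) * (dc v / \<epsilon>)))\<bar> \<le> \<bar>?c * ?d1\<bar> * 2 / \<epsilon> * norm v"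
      by (rule m[OF s(2) m[OF s(3) h[OF dcn]]])
    have t0: "\<bar>?s1 * (?s2 * (?s3 * dc v))\<bar> \<le> 2 * norm v"
      by (rule m[OF s(1) m[OF s(2) m[OF s(3) dcn]]])
    have "A' v = ?s1 * (?s2 * ((?c * ?d3) * (- snd v / \<epsilon>))) + ?s1 * (?s3 * ((?c * ?d2) * (- fst v / \<epsilon>)))
        + ?s2 * (?s3 * ((?c * ?d1) * (dc v / \<epsilon>))) + ?s1 * (?s2 * (?s3 * dc v))"
      unfolding A'_def by (simp only: algebra_simps)
    moreover have "\<bar>a + b + c + d\<bar> \<le> k1 + k2 + k3 + k0"
      if "\<bar>a\<bar> \<le> k3" "\<bar>b\<bar> \<le> k2" "\<bar>c\<bar> \<le> k1" "\<bar>d\<bar> \<le> k0" for a b c d k0 k1 k2 k3 :: real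
      using that by linarith
    from this[OF t3 t2 t1 t0] show ?thesis
      unfolding distrib_right mult_1_right calculation .
  qed
  have D0: "?D t = 0" if "t \<ge> 1" for t using smooth_step_deriv_eq_0[of t] that by simp
  have D0': "?D t = 0" if "t \<le> 1/4" for t using smooth_step_deriv_eq_0[of t] that by simp
  have lay: "layer \<epsilon> z = 1 \<or> layer \<epsilon> z = 0 \<and> corner z / \<epsilon> \<ge> 1 \<and> (1 - fst z) / \<epsilon> \<ge> 1 \<and> (1 - snd z) / \<epsilon> \<ge> 1"
    using \<epsilon> by (auto simp: layer_def field_simps)
  have sum3: "p1 * 2 / \<epsilon> + p2 / \<epsilon> + p3 / \<epsilon> + 2 \<le> 2 + 4 * k"
    if "p1 / \<epsilon> \<le> k" "p2 / \<epsilon> \<le> k" "p3 / \<epsilon> \<le> k" for p1 p2 p3 k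
  proof -
    have "2 * x + y + w + 2 \<le> 2 + 4 * k" if "x \<le> k" "y \<le> k" "w \<le> k" for x y w :: real
      using that by linarith
    from this[OF that] show ?thesis by (simp add: mult.commute)
  qed
  show thesis
  proof (rule that[OF der])
    fix v
    show "\<bar>A' v\<bar> \<le> (2 + 4 * M * \<bar>corner z\<bar> / \<epsilon> * layer \<epsilon> z) * norm v"
      using lay
    proof
      assume l: "layer \<epsilon> z = 1"
      have *: "\<bar>?c * ?D t\<bar> / \<epsilon> \<le> M * \<bar>?c\<bar> / \<epsilon>" for t
        using mult_left_mono[OF M(2)[of t], of "\<bar>?c\<bar>"] \<epsilon>
        by (intro divide_right_mono) (simp_all add: abs_mult mult.commute[of M])
      have "\<bar>?c * ?d1\<bar> * 2 / \<epsilon> + \<bar>?c * ?d2\<bar> / \<epsilon> + \<bar>?c * ?d3\<bar> / \<epsilon> + 2 \<le> 2 + 4 * M * \<bar>corner z\<bar> / \<epsilon> * layer \<epsilon> z"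
        using sum3[OF *[of "corner z / \<epsilon>"] *[of "(1 - fst z) / \<epsilon>"] *[of "(1 - snd z) / \<epsilon>"]] l by simp
      then show ?thesis using bound[of v] by (meson mult_right_mono norm_ge_zero order_trans)
    next
      assume "layer \<epsilon> z = 0 \<and> corner z / \<epsilon> \<ge> 1 \<and> (1 - fst z) / \<epsilon> \<ge> 1 \<and> (1 - snd z) / \<epsilon> \<ge> 1"
      then show ?thesis using bound[of v] by (simp add: D0)
    qed
    show "A' v = - fst v - snd v" if "layer \<epsilon> z = 0"
      using lay that by (auto simp: A'_def dc_def D0 smooth_step_eq_1)
    show "\<bar>A' v\<bar> \<le> (2 + 4 * M) * norm v" if K1: "z \<in> K1"
    proof -
      have c: "0 \<le> ?c" "?c \<le> 1 - fst z" "?c \<le> 1 - snd z"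
        using K1 by (cases z; simp add: K1_eq corner_def)+
      have *: "\<bar>?c * ?D (t / \<epsilon>)\<bar> / \<epsilon> \<le> M" if "?c \<le> t" for t
      proof (cases "t \<ge> \<epsilon>")
        case True
        then show ?thesis using M(1) \<epsilon> by (simp add: D0)
      next
        case False
        then have "\<bar>?c * ?D (t / \<epsilon>)\<bar> \<le> \<epsilon> * M"
          using c(1) that M unfolding abs_mult by (intro mult_mono) auto
        then show ?thesis using \<epsilon> by (simp add: field_simps)
      qed
      have "\<bar>?c * ?d1\<bar> * 2 / \<epsilon> + \<bar>?c * ?d2\<bar> / \<epsilon> + \<bar>?c * ?d3\<bar> / \<epsilon> + 2 \<le> 2 + 4 * M"
        using sum3[OF *[OF order_refl] *[OF c(2)] *[OF c(3)]] by simp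
      then show ?thesis using bound[of v] by (meson mult_right_mono norm_ge_zero order_trans)
    qed
  qed
qed

lemma boundary_profile_abs_le: "\<bar>boundary_profile \<epsilon> z\<bar> \<le> \<bar>corner z\<bar>"
  unfolding boundary_profile_def abs_mult
  by (intro mult_left_le mult_le_one) (simp_all add: smooth_step_ge_0 smooth_step_le_1)

lemma origin_profile_bounds:
  assumes "0 < \<epsilon>" "reg_square \<epsilon> z \<le> 1"
  shows "0 \<le> origin_profile \<epsilon> z" "origin_profile \<epsilon> z \<le> 1"
proof -
  have "reg_square \<epsilon> z powr (\<epsilon> / 2) \<le> 1" using assms reg_square_pos by (intro powr_le1) (auto simp: less_imp_le)
  then show "0 \<le> origin_profile \<epsilon> z" "origin_profile \<epsilon> z \<le> 1"
    unfolding origin_profile_def by (simp_all add: smooth_step_ge_0 smooth_step_le_1 mult_le_one)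
qed

text \<open>With \<open>q\<close> the regularized squared distance, the gradient is of order \<open>\<epsilon> q\<^bsup>(\<epsilon> - 1) / 2\<^esup>\<close> where the angular factor
  is constant; elsewhere the factor \<open>\<epsilon>\<close> is lost.\<close>

lemma origin_profile_has_derivative:
  assumes \<epsilon>: "0 < \<epsilon>" and M: "M \<ge> 1" "\<And>t. \<bar>deriv smooth_step t\<bar> \<le> M"
  obtains B' where "(origin_profile \<epsilon> has_derivative B') (at z)"
    and "\<And>v. \<bar>B' v\<bar> \<le> (\<epsilon> + 5 * M) * reg_square \<epsilon> z powr ((\<epsilon> - 1) / 2) * norm v"
    and "\<And>v. (fst z + snd z) * reg_square \<epsilon> z powr (- (1/2)) \<ge> 1 \<Longrightarrow>
      \<bar>B' v\<bar> \<le> \<epsilon> * reg_square \<epsilon> z powr ((\<epsilon> - 1) / 2) * norm v"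
proof -
  let ?q = "reg_square \<epsilon> z" and ?s = "fst z + snd z"
  have q: "?q > 0" using \<epsilon> by (rule reg_square_pos)
  define r where "r = sqrt ?q"
  have r: "r > 0" "?q = r * r" using q by (simp_all add: r_def)
  define q' where "q' v = (2 * fst z * fst v + 2 * snd z * snd v) / 3" for v :: "real \<times> real"
  have dq: "(reg_square \<epsilon> has_derivative q') (at z)"
    unfolding reg_square_def[abs_def] q'_def by (auto intro!: derivative_eq_intros)
  have z2: "(fst z)\<^sup>2 + (snd z)\<^sup>2 \<le> 3 * (r * r)" unfolding r(2)[symmetric] reg_square_def by simp
  have zn: "norm z \<le> 2 * r"
  proof (rule power2_le_imp_le)
    have "(norm z)\<^sup>2 = (fst z)\<^sup>2 + (snd z)\<^sup>2" by (cases z) (simp add: norm_Pair)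
    also have "\<dots> \<le> (2 * r)\<^sup>2"
      using order_trans[OF z2, of "4 * (r * r)"] by (simp add: power2_eq_square)
    finally show "(norm z)\<^sup>2 \<le> (2 * r)\<^sup>2" .
  qed (use r in simp)
  have q'b: "\<bar>q' v\<bar> \<le> 2 * r * norm v" for v
  proof -
    have "q' v = 2 / 3 * (z \<bullet> v)" by (simp add: q'_def inner_prod_def)
    then have "\<bar>q' v\<bar> \<le> 2 / 3 * (norm z * norm v)" using Cauchy_Schwarz_ineq2[of z v] by (simp add: abs_mult)
    also have "\<dots> \<le> 2 / 3 * ((2 * r) * norm v)" using zn by (intro mult_left_mono mult_right_mono) auto
    also have "\<dots> \<le> 2 * r * norm v" using r by simp
    finally show ?thesis .
  qed
  have sb: "\<bar>?s\<bar> \<le> 3 * r"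
  proof (rule power2_le_imp_le)
    have "(\<bar>?s\<bar>)\<^sup>2 \<le> 2 * ((fst z)\<^sup>2 + (snd z)\<^sup>2)"
      using zero_le_power2[of "fst z - snd z"] by (simp add: power2_eq_square algebra_simps)
    also have "\<dots> \<le> 2 * (3 * (r * r))" using z2 by (rule mult_left_mono) simp
    also have "\<dots> \<le> (3 * r)\<^sup>2" by (simp add: power2_eq_square)
    finally show "(\<bar>?s\<bar>)\<^sup>2 \<le> (3 * r)\<^sup>2" .
  qed (use r in simp)
  have p1: "?q powr (- (1/2)) = 1 / r"
    using q by (simp add: r_def powr_minus powr_half_sqrt inverse_eq_divide)
  have p2: "?q powr (- (1/2) - 1) = 1 / (r * r * r)"
    unfolding powr_diff p1 using q r by simp
  define R where "R = ?q powr (\<epsilon> / 2)"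
  have R: "R > 0" using q by (simp add: R_def)
  have p3: "?q powr (\<epsilon> / 2 - 1) = R / (r * r)"
    unfolding powr_diff using q r by (simp add: R_def)
  have p4: "?q powr ((\<epsilon> - 1) / 2) = R / r"
    using q p1 by (simp add: diff_divide_distrib powr_diff powr_half_sqrt R_def r_def)
  let ?m = "smooth_step (?s * ?q powr (- (1/2)))" and ?m' = "deriv smooth_step (?s * ?q powr (- (1/2)))"
  define t' where "t' v = ?s * (- (1/2) * (1 / (r * r * r)) * q' v) + (fst v + snd v) * (1 / r)" for v
  define R' where "R' v = \<epsilon> / 2 * (R / (r * r)) * q' v" for v
  have dt: "((\<lambda>z. (fst z + snd z) * reg_square \<epsilon> z powr (- (1/2))) has_derivative t') (at z)"
  proof -
    have s: "((\<lambda>z :: real \<times> real. fst z + snd z) has_derivative (\<lambda>v. fst v + snd v)) (at z)"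
      by (auto intro!: derivative_eq_intros)
    show ?thesis
      using has_derivative_mult[OF s powr_compose_has_derivative[OF dq q, of "- (1/2)"]]
      unfolding p1 p2 t'_def[abs_def] .
  qed
  have dR: "((\<lambda>z. reg_square \<epsilon> z powr (\<epsilon> / 2)) has_derivative R') (at z)"
    using powr_compose_has_derivative[OF dq q, of "\<epsilon> / 2"] unfolding p3 R'_def[abs_def] .
  define B' where "B' v = ?m * R' v + ?m' * t' v * R" for v
  have dB: "(origin_profile \<epsilon> has_derivative B') (at z)"
    using has_derivative_mult[OF smooth_step_compose_has_derivative[OF dt] dR]
    unfolding origin_profile_def[abs_def] B'_def[abs_def] R_def[symmetric] .
  have R'b: "\<bar>R' v\<bar> \<le> \<epsilon> * (R / r) * norm v" for v
  proof -
    have "\<bar>R' v\<bar> = \<epsilon> / 2 * (R / (r * r)) * \<bar>q' v\<bar>" using \<epsilon> R r by (simp add: R'_def abs_mult)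
    also have "\<dots> \<le> \<epsilon> / 2 * (R / (r * r)) * (2 * r * norm v)"
      using q'b \<epsilon> R r by (intro mult_left_mono) auto
    also have "\<dots> = \<epsilon> * (R / r) * norm v" using r by (simp add: field_simps)
    finally show ?thesis .
  qed
  have t'b: "\<bar>t' v\<bar> \<le> 5 / r * norm v" for v
  proof -
    have "\<bar>?s * (- (1/2) * (1 / (r * r * r)) * q' v)\<bar> = (1/2) * (1 / (r * r * r)) * (\<bar>?s\<bar> * \<bar>q' v\<bar>)"
      using r by (simp add: abs_mult)
    also have "\<dots> \<le> (1/2) * (1 / (r * r * r)) * ((3 * r) * (2 * r * norm v))"
      using sb q'b r by (intro mult_left_mono mult_mono) auto
    also have "\<dots> = 3 / r * norm v" using r by (simp add: field_simps)
    finally have 1: "\<bar>?s * (- (1/2) * (1 / (r * r * r)) * q' v)\<bar> \<le> 3 / r * norm v" .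
    have "\<bar>(fst v + snd v) * (1 / r)\<bar> = \<bar>fst v + snd v\<bar> * (1 / r)" using r by (simp add: abs_mult)
    also have "\<dots> \<le> (2 * norm v) * (1 / r)"
      using abs_fst_le_norm[of v] abs_snd_le_norm[of v] r by (intro mult_right_mono) auto
    finally have 2: "\<bar>(fst v + snd v) * (1 / r)\<bar> \<le> 2 / r * norm v" by simp
    have "5 / r * norm v = 3 / r * norm v + 2 / r * norm v" by (simp add: field_simps)
    then show ?thesis using 1 2 unfolding t'_def by linarith
  qed
  have mR: "\<bar>?m * R' v\<bar> \<le> \<epsilon> * (R / r) * norm v" for v
  proof -
    have "\<bar>?m * R' v\<bar> = ?m * \<bar>R' v\<bar>" by (simp add: abs_mult smooth_step_ge_0)
    also have "\<dots> \<le> 1 * (\<epsilon> * (R / r) * norm v)"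
      using R'b by (intro mult_mono) (simp_all add: smooth_step_le_1)
    finally show ?thesis by simp
  qed
  show thesis
  proof (rule that[OF dB])
    fix v
    have "\<bar>?m' * t' v * R\<bar> = \<bar>?m'\<bar> * \<bar>t' v\<bar> * R" using R by (simp add: abs_mult)
    also have "\<dots> \<le> M * (5 / r * norm v) * R"
      using M(2) t'b R M(1) by (intro mult_right_mono mult_mono) auto
    also have "\<dots> = 5 * M * (R / r) * norm v" by simp
    finally have "\<bar>B' v\<bar> \<le> \<epsilon> * (R / r) * norm v + 5 * M * (R / r) * norm v"
      using mR[of v] unfolding B'_def by linarith
    then show "\<bar>B' v\<bar> \<le> (\<epsilon> + 5 * M) * ?q powr ((\<epsilon> - 1) / 2) * norm v"
      unfolding p4 by (simp only: distrib_right)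
    show "\<bar>B' v\<bar> \<le> \<epsilon> * ?q powr ((\<epsilon> - 1) / 2) * norm v" if "?s * ?q powr (- (1/2)) \<ge> 1"
      using mR[of v] smooth_step_deriv_eq_0[of "?s * ?q powr (- (1/2))"] that unfolding B'_def p4 by simp
  qed
qed

text \<open>The neighbourhood of the origin where the regularization spoils the angular factor on \<^const>\<open>K1\<close>.\<close>

definition core :: "real \<Rightarrow> (real \<times> real) set" where
  "core \<epsilon> = box (- reg_length \<epsilon>, - reg_length \<epsilon>) (reg_length \<epsilon>, reg_length \<epsilon>)"

text \<open>Outside \<^const>\<open>core\<close> the angular factor is \<open>1\<close> on \<^const>\<open>K1\<close>.\<close>

lemma angle_ge_1:
  assumes \<epsilon>: "0 < \<epsilon>" and z: "z \<in> K1" "z \<notin> core \<epsilon>"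
  shows "(fst z + snd z) * reg_square \<epsilon> z powr (- (1/2)) \<ge> 1"
proof -
  let ?q = "reg_square \<epsilon> z" and ?d = "reg_length \<epsilon>"
  have q: "?q > 0" and d: "?d > 0" using \<epsilon> reg_square_pos reg_length_pos by auto
  have xy: "0 \<le> fst z" "0 \<le> snd z" using z by (cases z; simp add: K1_eq)+
  then have "?d \<le> fst z \<or> ?d \<le> snd z" using z(2) d by (auto simp: core_def mem_box_pair)
  then have "?d \<le> fst z + snd z" using xy by linarith
  then have "?d\<^sup>2 \<le> (fst z + snd z)\<^sup>2" using d by (intro power_mono) auto
  moreover have "(fst z)\<^sup>2 + (snd z)\<^sup>2 \<le> (fst z + snd z)\<^sup>2" using xy by (simp add: power2_sum)
  moreover have "(a + b) / 3 \<le> t" if "b \<le> t" "a \<le> t" "0 \<le> t" for a b t :: real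
    using that by simp
  ultimately have "?q \<le> (fst z + snd z)\<^sup>2" unfolding reg_square_def using zero_le_power2 by blast
  then have "sqrt ?q \<le> fst z + snd z" using xy by (simp add: real_le_lsqrt)
  moreover have "?q powr (- (1/2)) = 1 / sqrt ?q"
    using q by (simp add: powr_minus powr_half_sqrt inverse_eq_divide)
  ultimately show ?thesis using q by simp
qed

text \<open>Since \<open>- ln q \<le> 4 q\<^bsup>-1/4\<^esup>\<close>; the assumption \<open>\<epsilon> \<le> 1/2\<close> makes the exponent \<open>(\<epsilon> - 1) / 2\<close> at most \<open>-1/4\<close>.\<close>

lemma one_minus_powr_le:
  fixes q \<epsilon> :: real
  assumes q: "0 < q" "q \<le> 1" and \<epsilon>: "0 < \<epsilon>" "\<epsilon> \<le> 1/2"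
  shows "1 - q powr (\<epsilon> / 2) \<le> 2 * \<epsilon> * q powr ((\<epsilon> - 1) / 2)"
proof -
  have "- ln q = 4 * ln (q powr (- (1/4)))" using q by (simp add: ln_powr)
  also have "\<dots> \<le> 4 * q powr (- (1/4))" using ln_le_minus_one[of "q powr (- (1/4))"] q by simp
  also have "\<dots> \<le> 4 * q powr ((\<epsilon> - 1) / 2)"
    using q \<epsilon> by (intro mult_left_mono powr_mono') auto
  finally have "\<epsilon> / 2 * (- ln q) \<le> \<epsilon> / 2 * (4 * q powr ((\<epsilon> - 1) / 2))"
    using \<epsilon> by (intro mult_left_mono) auto
  moreover have "1 + \<epsilon> / 2 * ln q \<le> q powr (\<epsilon> / 2)"
    using q exp_ge_add_one_self[of "\<epsilon> / 2 * ln q"] by (simp add: powr_def)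
  ultimately show ?thesis by simp
qed

lemma singular_function_has_derivative:
  assumes "(boundary_profile \<epsilon> has_derivative A') (at z)" "(origin_profile \<epsilon> has_derivative B') (at z)"
  shows "(singular_function \<epsilon> has_derivative (\<lambda>v. boundary_profile \<epsilon> z * B' v + A' v * origin_profile \<epsilon> z)) (at z)"
  unfolding singular_function_def[abs_def] by (rule has_derivative_mult[OF assms])

lemma grad_singular_function_K1:
  assumes \<epsilon>: "0 < \<epsilon>" "\<epsilon> \<le> 1/2" and M: "M \<ge> 1" "\<And>t. \<bar>deriv smooth_step t\<bar> \<le> M" and z: "z \<in> K1"
  shows "(norm (grad (singular_function \<epsilon>) z + (1, 1)))\<^sup>2
    \<le> 192 * M\<^sup>2 * (layer \<epsilon> z + \<epsilon>\<^sup>2 * reg_square \<epsilon> z powr (\<epsilon> - 1) + indicator (core \<epsilon>) z * reg_square \<epsilon> z powr (\<epsilon> - 1))"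
proof -
  let ?A = "boundary_profile \<epsilon> z" and ?B = "origin_profile \<epsilon> z" and ?q = "reg_square \<epsilon> z"
  define w where "w = ?q powr ((\<epsilon> - 1) / 2)"
  define \<kappa> where "\<kappa> = (indicator (core \<epsilon>) z :: real)"
  have \<kappa>: "\<kappa> = 0 \<and> z \<notin> core \<epsilon> \<or> \<kappa> = 1" by (auto simp: \<kappa>_def indicator_def)
  have lay: "layer \<epsilon> z = 0 \<or> layer \<epsilon> z = 1" by (simp add: layer_def)
  have zQ: "z \<in> cbox (-1, -1) (1, 1)" using z by (cases z) (auto simp: K1_eq cbox_Pair_eq)
  have q: "0 < ?q" "?q \<le> 1" using reg_square_pos reg_square_le_1 \<epsilon> zQ by auto
  have w2: "w\<^sup>2 = ?q powr (\<epsilon> - 1)" using q by (simp add: w_def power2_eq_square flip: powr_add)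
  have w1: "w \<ge> 1"
    using powr_mono'[of "(\<epsilon> - 1) / 2" 0 ?q] q \<epsilon> by (simp add: w_def)
  obtain A' where A': "(boundary_profile \<epsilon> has_derivative A') (at z)"
    and A'0: "\<And>v. layer \<epsilon> z = 0 \<Longrightarrow> A' v = - fst v - snd v"
    and A'1: "\<And>v. \<bar>A' v\<bar> \<le> (2 + 4 * M) * norm v"
    using boundary_profile_has_derivative[OF \<epsilon>(1) M, of z] z by metis
  obtain B' where B': "(origin_profile \<epsilon> has_derivative B') (at z)"
    and B'1: "\<And>v. \<bar>B' v\<bar> \<le> (\<epsilon> + 5 * M) * w * norm v"
    and B'0: "\<And>v. (fst z + snd z) * ?q powr (- (1/2)) \<ge> 1 \<Longrightarrow> \<bar>B' v\<bar> \<le> \<epsilon> * w * norm v"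
    using origin_profile_has_derivative[OF \<epsilon>(1) M, of z] unfolding w_def by metis
  have B: "0 \<le> ?B" "?B \<le> 1" using origin_profile_bounds[OF \<epsilon>(1) q(2)] .
  have Ab: "\<bar>?A\<bar> \<le> 1"
    using boundary_profile_abs_le[of \<epsilon> z] z by (cases z) (auto simp: K1_eq corner_def)
  have B'b: "\<bar>B' v\<bar> \<le> (\<epsilon> + 5 * M * \<kappa>) * w * norm v" for v
    using \<kappa>
  proof
    assume "\<kappa> = 0 \<and> z \<notin> core \<epsilon>"
    then show ?thesis using B'0[OF angle_ge_1[OF \<epsilon>(1) z], of v] by simp
  next
    assume "\<kappa> = 1"
    then show ?thesis using B'1[of v] by simp
  qed
  have B1: "1 - ?B \<le> (2 * \<epsilon> + \<kappa>) * w"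
    using \<kappa>
  proof
    assume "\<kappa> = 0 \<and> z \<notin> core \<epsilon>"
    then have "?B = ?q powr (\<epsilon> / 2)"
      using smooth_step_eq_1[OF angle_ge_1[OF \<epsilon>(1) z]] by (simp add: origin_profile_def)
    then show ?thesis using one_minus_powr_le[OF q \<epsilon>] \<open>\<kappa> = 0 \<and> z \<notin> core \<epsilon>\<close> by (simp add: w_def)
  next
    assume "\<kappa> = 1"
    have "1 \<le> (2 * \<epsilon> + 1) * w" using mult_mono[of 1 "2 * \<epsilon> + 1" 1 w] \<epsilon> w1 by simp
    then show ?thesis using B(1) \<open>\<kappa> = 1\<close> by simp
  qed
  let ?L = "8 * M * (layer \<epsilon> z + \<epsilon> * w + \<kappa> * w)"
  have "norm (grad (\<lambda>z. singular_function \<epsilon> z - 1 * corner z) z) \<le> ?L"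
  proof (rule norm_grad_le)
    show "((\<lambda>z. singular_function \<epsilon> z - 1 * corner z) has_derivative
        (\<lambda>v. (?A * B' v + A' v * ?B) - 1 * (- fst v - snd v))) (at z)"
      by (intro has_derivative_diff singular_function_has_derivative A' B' has_derivative_mult_right corner_has_derivative)
    show "?L \<ge> 0" using M \<epsilon> w1 lay \<kappa> by (auto intro!: mult_nonneg_nonneg add_nonneg_nonneg)
    fix v :: "real \<times> real"
    have sv: "\<bar>fst v + snd v\<bar> \<le> 2 * norm v" using abs_fst_le_norm[of v] abs_snd_le_norm[of v] by linarith
    have 1: "\<bar>(A' v + (fst v + snd v)) * ?B\<bar> \<le> (4 + 4 * M) * layer \<epsilon> z * norm v"
      using lay
    proof
      assume "layer \<epsilon> z = 0" then show ?thesis by (simp add: A'0)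
    next
      assume l: "layer \<epsilon> z = 1"
      have "\<bar>A' v + (fst v + snd v)\<bar> \<le> (4 + 4 * M) * norm v"
        using A'1[of v] sv by (simp add: distrib_right)
      from mult_mono[OF this B(2)] B(1) M(1) show ?thesis by (simp add: l abs_mult)
    qed
    have 2: "\<bar>?A * B' v\<bar> \<le> (\<epsilon> + 5 * M * \<kappa>) * w * norm v"
      using mult_mono[OF Ab B'b[of v]] by (simp add: abs_mult)
    have 3: "\<bar>(fst v + snd v) * (1 - ?B)\<bar> \<le> (2 * norm v) * ((2 * \<epsilon> + \<kappa>) * w)"
      unfolding abs_mult using sv B B1 by (intro mult_mono) auto
    have "(?A * B' v + A' v * ?B) - 1 * (- fst v - snd v)
        = (A' v + (fst v + snd v)) * ?B + ?A * B' v + (fst v + snd v) * (1 - ?B)"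
      by (simp add: algebra_simps)
    then have "\<bar>(?A * B' v + A' v * ?B) - 1 * (- fst v - snd v)\<bar>
        \<le> (4 + 4 * M) * layer \<epsilon> z * norm v + (\<epsilon> + 5 * M * \<kappa>) * w * norm v + (2 * norm v) * ((2 * \<epsilon> + \<kappa>) * w)"
      using 1 2 3 by linarith
    also have "\<dots> = ((4 + 4 * M) * layer \<epsilon> z + 5 * (\<epsilon> * w) + (5 * M + 2) * (\<kappa> * w)) * norm v"
      by (simp add: algebra_simps)
    also have "\<dots> \<le> ?L * norm v"
    proof (rule mult_right_mono)
      have "(4 + 4 * M) * layer \<epsilon> z \<le> (8 * M) * layer \<epsilon> z" "5 * (\<epsilon> * w) \<le> (8 * M) * (\<epsilon> * w)"
        "(5 * M + 2) * (\<kappa> * w) \<le> (8 * M) * (\<kappa> * w)"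
        using M(1) lay \<kappa> w1 \<epsilon> by (intro mult_right_mono; auto)+
      then show "(4 + 4 * M) * layer \<epsilon> z + 5 * (\<epsilon> * w) + (5 * M + 2) * (\<kappa> * w) \<le> ?L"
        unfolding distrib_left by linarith
    qed simp
    finally show "\<bar>(?A * B' v + A' v * ?B) - 1 * (- fst v - snd v)\<bar> \<le> ?L * norm v" .
  qed
  then have "(norm (grad (singular_function \<epsilon>) z + (1, 1)))\<^sup>2 \<le> ?L\<^sup>2"
    unfolding grad_diff_scaled_corner[OF C_k_singular_function[OF \<epsilon>(1)]] by (intro power_mono) auto
  also have "\<dots> = 64 * M\<^sup>2 * (layer \<epsilon> z + \<epsilon> * w + \<kappa> * w)\<^sup>2" by (simp add: power_mult_distrib)
  also have "\<dots> \<le> 64 * M\<^sup>2 * (3 * ((layer \<epsilon> z)\<^sup>2 + (\<epsilon> * w)\<^sup>2 + (\<kappa> * w)\<^sup>2))"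
  proof (rule mult_left_mono)
    have "(a + b + c)\<^sup>2 \<le> 3 * (a\<^sup>2 + b\<^sup>2 + c\<^sup>2)" for a b c :: real
      using zero_le_power2[of "a - b"] zero_le_power2[of "b - c"] zero_le_power2[of "a - c"]
      by (simp add: power2_eq_square algebra_simps)
    then show "(layer \<epsilon> z + \<epsilon> * w + \<kappa> * w)\<^sup>2 \<le> 3 * ((layer \<epsilon> z)\<^sup>2 + (\<epsilon> * w)\<^sup>2 + (\<kappa> * w)\<^sup>2)" .
  qed simp
  also have "\<dots> = 192 * M\<^sup>2 * (layer \<epsilon> z + \<epsilon>\<^sup>2 * w\<^sup>2 + \<kappa> * w\<^sup>2)"
    using lay \<kappa> by (auto simp: power_mult_distrib)
  finally show ?thesis by (simp add: w2 \<kappa>_def)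
qed

lemma grad_singular_function:
  assumes \<epsilon>: "0 < \<epsilon>" "\<epsilon> \<le> 1/2" and M: "M \<ge> 1" "\<And>t. \<bar>deriv smooth_step t\<bar> \<le> M"
    and z: "z \<in> cbox (-1, -1) (1, 1)"
  shows "\<epsilon>\<^sup>2 * (norm (grad (singular_function \<epsilon>) z))\<^sup>2
      \<le> 968 * M\<^sup>2 * (layer \<epsilon> z + \<epsilon>\<^sup>2 * reg_square \<epsilon> z powr (\<epsilon> - 1))"
    and "\<epsilon>\<^sup>2 * (norm (grad (singular_function \<epsilon>) z + (1, 1)))\<^sup>2
      \<le> 968 * M\<^sup>2 * (layer \<epsilon> z + \<epsilon>\<^sup>2 * reg_square \<epsilon> z powr (\<epsilon> - 1))"
proof -
  let ?A = "boundary_profile \<epsilon> z" and ?B = "origin_profile \<epsilon> z" and ?q = "reg_square \<epsilon> z"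
  define w where "w = ?q powr ((\<epsilon> - 1) / 2)"
  have lay: "layer \<epsilon> z = 0 \<or> layer \<epsilon> z = 1" by (simp add: layer_def)
  have q: "0 < ?q" "?q \<le> 1" using reg_square_pos reg_square_le_1 \<epsilon> z by auto
  have w2: "w\<^sup>2 = ?q powr (\<epsilon> - 1)" using q by (simp add: w_def power2_eq_square flip: powr_add)
  have w1: "w \<ge> 1"
    using powr_mono'[of "(\<epsilon> - 1) / 2" 0 ?q] q \<epsilon> by (simp add: w_def)
  obtain A' where A': "(boundary_profile \<epsilon> has_derivative A') (at z)"
    and A'b: "\<And>v. \<bar>A' v\<bar> \<le> (2 + 4 * M * \<bar>corner z\<bar> / \<epsilon> * layer \<epsilon> z) * norm v"
    using boundary_profile_has_derivative[OF \<epsilon>(1) M, of z] by metis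
  obtain B' where B': "(origin_profile \<epsilon> has_derivative B') (at z)"
    and B'b: "\<And>v. \<bar>B' v\<bar> \<le> (\<epsilon> + 5 * M) * w * norm v"
    using origin_profile_has_derivative[OF \<epsilon>(1) M, of z] unfolding w_def by metis
  have B: "0 \<le> ?B" "?B \<le> 1" using origin_profile_bounds[OF \<epsilon>(1) q(2)] .
  have c3: "\<bar>corner z\<bar> \<le> 3" using z by (cases z) (auto simp: corner_def cbox_Pair_eq)
  then have Ab: "\<bar>?A\<bar> \<le> 3" using boundary_profile_abs_le[of \<epsilon> z] by linarith
  define k where "k = layer \<epsilon> z / \<epsilon> + w"
  have "layer \<epsilon> z / \<epsilon> \<ge> 0" using lay \<epsilon> by auto
  then have k0: "layer \<epsilon> z / \<epsilon> \<ge> 0" "k \<ge> 1" using w1 by (simp_all add: k_def)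
  have main: "norm (grad (singular_function \<epsilon>) z) \<le> 20 * M * k"
  proof (rule norm_grad_le[OF singular_function_has_derivative[OF A' B']])
    show "20 * M * k \<ge> 0" using M k0 by simp
    fix v
    have 1: "\<bar>?A * B' v\<bar> \<le> 3 * ((\<epsilon> + 5 * M) * w * norm v)"
      using mult_mono[OF Ab B'b[of v]] by (simp add: abs_mult)
    have "\<bar>A' v * ?B\<bar> \<le> \<bar>A' v\<bar>" using B by (simp add: abs_mult mult_left_le)
    also have "\<dots> \<le> (2 + 4 * M * \<bar>corner z\<bar> / \<epsilon> * layer \<epsilon> z) * norm v" by (rule A'b)
    also have "\<dots> \<le> (2 + 4 * M * 3 / \<epsilon> * layer \<epsilon> z) * norm v"
      using c3 M(1) \<epsilon> lay by (intro mult_right_mono add_left_mono divide_right_mono mult_left_mono) auto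
    finally have "\<bar>?A * B' v + A' v * ?B\<bar>
        \<le> 3 * ((\<epsilon> + 5 * M) * w * norm v) + (2 + 4 * M * 3 / \<epsilon> * layer \<epsilon> z) * norm v"
      using 1 by linarith
    also have "\<dots> = ((3 * \<epsilon> + 15 * M) * w + 2 + 12 * M * (layer \<epsilon> z / \<epsilon>)) * norm v"
      by (simp add: algebra_simps)
    also have "\<dots> \<le> (20 * M * k) * norm v"
    proof (rule mult_right_mono)
      have "(3 * \<epsilon> + 15 * M) * w + 2 \<le> (3 * \<epsilon> + 15 * M) * w + 2 * w" using w1 by simp
      also have "\<dots> = (3 * \<epsilon> + 15 * M + 2) * w" by (simp add: distrib_right)
      also have "\<dots> \<le> (20 * M) * w" using M(1) \<epsilon> w1 by (intro mult_right_mono) auto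
      finally have "(3 * \<epsilon> + 15 * M) * w + 2 \<le> (20 * M) * w" .
      moreover have "(12 * M) * (layer \<epsilon> z / \<epsilon>) \<le> (20 * M) * (layer \<epsilon> z / \<epsilon>)"
        using M(1) k0 by (intro mult_right_mono) auto
      ultimately show "(3 * \<epsilon> + 15 * M) * w + 2 + 12 * M * (layer \<epsilon> z / \<epsilon>) \<le> 20 * M * k"
        unfolding k_def distrib_left by linarith
    qed simp
    finally show "\<bar>?A * B' v + A' v * ?B\<bar> \<le> (20 * M * k) * norm v" .
  qed
  have "norm ((1, 1) :: real \<times> real) \<le> 2" by (simp add: norm_Pair real_le_lsqrt)
  moreover have "2 \<le> 2 * M * k" using mult_mono[of 1 M 1 k] M(1) k0 by simp
  ultimately have n: "norm (grad (singular_function \<epsilon>) z) \<le> 22 * M * k"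
    "norm (grad (singular_function \<epsilon>) z + (1, 1)) \<le> 22 * M * k"
    using main norm_triangle_ineq[of "grad (singular_function \<epsilon>) z" "(1, 1)"] by linarith+
  have final: "\<epsilon>\<^sup>2 * a\<^sup>2 \<le> 968 * M\<^sup>2 * (layer \<epsilon> z + \<epsilon>\<^sup>2 * ?q powr (\<epsilon> - 1))" if a: "0 \<le> a" "a \<le> 22 * M * k" for a
  proof -
    have "\<epsilon>\<^sup>2 * a\<^sup>2 \<le> \<epsilon>\<^sup>2 * (22 * M * k)\<^sup>2" using a by (intro mult_left_mono power_mono) auto
    also have "\<dots> = 484 * M\<^sup>2 * (\<epsilon> * k)\<^sup>2" by (simp add: power_mult_distrib)
    also have "\<epsilon> * k = layer \<epsilon> z + \<epsilon> * w" using \<epsilon> by (simp add: k_def distrib_left)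
    also have "484 * M\<^sup>2 * (layer \<epsilon> z + \<epsilon> * w)\<^sup>2 \<le> 484 * M\<^sup>2 * (2 * ((layer \<epsilon> z)\<^sup>2 + (\<epsilon> * w)\<^sup>2))"
    proof (rule mult_left_mono)
      show "(layer \<epsilon> z + \<epsilon> * w)\<^sup>2 \<le> 2 * ((layer \<epsilon> z)\<^sup>2 + (\<epsilon> * w)\<^sup>2)"
        using zero_le_power2[of "layer \<epsilon> z - \<epsilon> * w"] by (simp add: power2_eq_square algebra_simps)
    qed simp
    also have "\<dots> = 968 * M\<^sup>2 * (layer \<epsilon> z + \<epsilon>\<^sup>2 * w\<^sup>2)"
      using lay by (auto simp: power_mult_distrib)
    finally show ?thesis by (simp add: w2)
  qed
  show "\<epsilon>\<^sup>2 * (norm (grad (singular_function \<epsilon>) z))\<^sup>2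
      \<le> 968 * M\<^sup>2 * (layer \<epsilon> z + \<epsilon>\<^sup>2 * ?q powr (\<epsilon> - 1))"
    using final n(1) by simp
  show "\<epsilon>\<^sup>2 * (norm (grad (singular_function \<epsilon>) z + (1, 1)))\<^sup>2
      \<le> 968 * M\<^sup>2 * (layer \<epsilon> z + \<epsilon>\<^sup>2 * ?q powr (\<epsilon> - 1))"
    using final n(2) by simp
qed

section \<open>The energy is small\<close>

text \<open>A continuous majorant of \<^const>\<open>layer\<close>, of the form \<open>\<zeta> (l / \<epsilon>)\<close> for three affine functions \<open>l\<close>, whose
  integral is computed by the arctangent.\<close>

definition layer_majorant :: "real \<Rightarrow> real \<times> real \<Rightarrow> real" where
  "layer_majorant \<epsilon> z = 2 / (1 + (corner z / \<epsilon>)\<^sup>2) + 2 / (1 + ((1 - fst z) / \<epsilon>)\<^sup>2) + 2 / (1 + ((1 - snd z) / \<epsilon>)\<^sup>2)"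

lemma layer_le_majorant:
  assumes \<epsilon>: "0 < \<epsilon>" and z: "z \<in> \<Union>Triangulation"
  shows "layer \<epsilon> z \<le> layer_majorant \<epsilon> z"
proof -
  have nn: "0 \<le> 2 / (1 + t\<^sup>2)" for t :: real by (simp add: add_nonneg_nonneg)
  have ge: "1 \<le> 2 / (1 + (t / \<epsilon>)\<^sup>2)" if "0 \<le> t" "t < \<epsilon>" for t
  proof -
    have "(t / \<epsilon>)\<^sup>2 \<le> 1" using that \<epsilon> by (intro power_le_one) auto
    then show ?thesis by (simp add: add_pos_nonneg)
  qed
  have pos: "0 \<le> corner z" "0 \<le> 1 - fst z" "0 \<le> 1 - snd z"
    using z by (cases z; auto simp: Triangulation_def K_eqs corner_def)+
  have "(if P \<or> Q \<or> R then 1 else 0) \<le> a + b + c"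
    if "P \<Longrightarrow> 1 \<le> a" "Q \<Longrightarrow> 1 \<le> b" "R \<Longrightarrow> 1 \<le> c" "0 \<le> a" "0 \<le> b" "0 \<le> c" for P Q R and a b c :: real
    using that by (cases P; cases Q; cases R) auto
  from this[OF ge[OF pos(1)] ge[OF pos(2)] ge[OF pos(3)] nn nn nn]
  show ?thesis unfolding layer_def layer_majorant_def .
qed

lemma arctan_compose_has_derivative:
  fixes l :: "real \<times> real \<Rightarrow> real"
  assumes "(l has_derivative l') (at z)" "\<epsilon> > 0"
  shows "((\<lambda>z. 2 * \<epsilon> * arctan (l z / \<epsilon>)) has_derivative (\<lambda>v. 2 / (1 + (l z / \<epsilon>)\<^sup>2) * l' v)) (at z)"
proof -
  have "(arctan has_real_derivative inverse (1 + (l z / \<epsilon>)\<^sup>2)) (at (l z / \<epsilon>))" by (rule DERIV_arctan)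
  from has_derivative_compose[OF bounded_linear.has_derivative[OF bounded_linear_divide assms(1)]
      this[unfolded has_field_derivative_def]]
  have "((\<lambda>z. arctan (l z / \<epsilon>)) has_derivative (\<lambda>v. inverse (1 + (l z / \<epsilon>)\<^sup>2) * (l' v / \<epsilon>))) (at z)" .
  from has_derivative_mult_right[OF this, of "2 * \<epsilon>"]
  have "((\<lambda>z. 2 * \<epsilon> * arctan (l z / \<epsilon>)) has_derivative
      (\<lambda>v. 2 * \<epsilon> * (inverse (1 + (l z / \<epsilon>)\<^sup>2) * (l' v / \<epsilon>)))) (at z)" .
  moreover have "2 * \<epsilon> * (inverse c * (a / \<epsilon>)) = 2 / c * a" for a c :: real
  proof -
    have "\<epsilon> \<noteq> 0" using assms(2) by simp
    then show ?thesis by (simp add: divide_inverse)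
  qed
  ultimately show ?thesis by simp
qed

lemma integral_arctan_le:
  fixes l :: "real \<times> real \<Rightarrow> real"
  assumes \<epsilon>: "\<epsilon> > 0" and l: "\<And>z. (l has_derivative l') (at z)"
    and v: "l' (1, 0) = -1 \<or> l' (0, 1) = -1"
  shows "integral (cbox (-1, -1) (1, 1)) (\<lambda>z. 2 / (1 + (l z / \<epsilon>)\<^sup>2)) \<le> 16 * \<epsilon>"
proof -
  define w where "w z = 2 * \<epsilon> * arctan (l z / \<epsilon>)" for z
  have w': "(w has_derivative (\<lambda>v. 2 / (1 + (l z / \<epsilon>)\<^sup>2) * l' v)) (at z)" for z
    unfolding w_def[abs_def] by (rule arctan_compose_has_derivative[OF l \<epsilon>])
  have lc: "continuous_on UNIV l"
    by (rule continuous_at_imp_continuous_on) (simp add: has_derivative_continuous[OF l])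
  have pos: "1 + (t::real)\<^sup>2 \<noteq> 0" for t by (smt (verit) zero_le_power2)
  have "C_k (Suc 0) w"
    by (rule C_k_Suc_I[OF w']) (use \<epsilon> in \<open>auto intro!: continuous_intros lc simp: pos\<close>)
  note box = integral_partial_derivatives_box[OF this, of "-1" 1 "-1" 1]
  have fd: "frechet_derivative w (at z) v = 2 / (1 + (l z / \<epsilon>)\<^sup>2) * l' v" for z v
    by (rule frechet_derivative_eqI[OF w'])
  have wb: "- (w p - w p') \<le> 8 * \<epsilon>" for p p'
  proof -
    have "\<bar>arctan t\<bar> \<le> 2" for t using arctan_bounded[of t] pi_less_4 by (simp add: abs_le_iff)
    then have "arctan (l p' / \<epsilon>) - arctan (l p / \<epsilon>) \<le> 4" by (smt (verit))
    then have "2 * \<epsilon> * (arctan (l p' / \<epsilon>) - arctan (l p / \<epsilon>)) \<le> 2 * \<epsilon> * 4" using \<epsilon> by (intro mult_left_mono) auto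
    then show ?thesis by (simp add: w_def algebra_simps)
  qed
  have wc: "continuous_on S w" for S
    by (rule continuous_at_imp_continuous_on) (simp add: has_derivative_continuous[OF w'])
  have fin: "- integral {-1..1::real} (\<lambda>t. w (f t) - w (g t)) \<le> 16 * \<epsilon>" if "continuous_on {-1..1} f" "continuous_on {-1..1} g" for f g
  proof -
    have "integral {-1..1::real} (\<lambda>t. - (w (f t) - w (g t))) \<le> integral {-1..1::real} (\<lambda>t. 8 * \<epsilon>)"
      using wb by (intro integral_le integrable_continuous_real continuous_intros continuous_on_compose2[OF wc[of UNIV]] that) auto
    then show ?thesis unfolding Henstock_Kurzweil_Integration.integral_neg by simp
  qed
  show ?thesis using v
  proof
    assume "l' (1, 0) = -1"
    then have "(\<lambda>z. 2 / (1 + (l z / \<epsilon>)\<^sup>2)) = (\<lambda>z. - frechet_derivative w (at z) (1, 0))" by (simp add: fd)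
    then show ?thesis using fin[of "\<lambda>t. (1, t)" "\<lambda>t. (-1, t)"] box(1)
      by (simp add: continuous_intros)
  next
    assume "l' (0, 1) = -1"
    then have "(\<lambda>z. 2 / (1 + (l z / \<epsilon>)\<^sup>2)) = (\<lambda>z. - frechet_derivative w (at z) (0, 1))" by (simp add: fd)
    then show ?thesis using fin[of "\<lambda>t. (t, 1)" "\<lambda>t. (t, -1)"] box(2)
      by (simp add: continuous_intros)
  qed
qed

lemma reg_square_has_derivative:
  "(reg_square \<epsilon> has_derivative (\<lambda>v. (2 * fst z * fst v + 2 * snd z * snd v) / 3)) (at z)"
  unfolding reg_square_def[abs_def] by (auto intro!: derivative_eq_intros)

text \<open>The integrand is bounded by the divergence of the vector field \<open>z q\<^bsup>\<epsilon> - 1\<^esup> / (2 \<epsilon>)\<close>, where \<open>q\<close> is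
  \<^const>\<open>reg_square\<close>, and on the boundary of the square \<open>q\<close> is at least \<open>1/3\<close>.\<close>

lemma integral_reg_square_powr_le:
  assumes \<epsilon>: "0 < \<epsilon>" "\<epsilon> \<le> 1/2"
  shows "integral (cbox (-1, -1) (1, 1)) (\<lambda>z. reg_square \<epsilon> z powr (\<epsilon> - 1)) \<le> 12 / \<epsilon>"
proof -
  let ?Q = "cbox (-1, -1) (1, 1) :: (real \<times> real) set" and ?q = "reg_square \<epsilon>"
  define W where "W z = ?q z powr (\<epsilon> - 1)" for z
  have q: "?q z > 0" for z by (rule reg_square_pos[OF \<epsilon>(1)])
  have WC: "C_k k W" for k unfolding W_def[abs_def] by (rule C_k_powr[OF C_k_reg_square q])
  define W' where "W' z v = (\<epsilon> - 1) * ?q z powr (\<epsilon> - 1 - 1) * ((2 * fst z * fst v + 2 * snd z * snd v) / 3)" for z v :: "real \<times> real"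
  have W': "(W has_derivative W' z) (at z)" for z
    unfolding W_def[abs_def] W'_def[abs_def] by (rule powr_compose_has_derivative[OF reg_square_has_derivative q])
  have C1: "C_k (Suc 0) (\<lambda>z. fst z * W z)" by (rule C_k_mult[OF C_k_fst WC])
  have C2: "C_k (Suc 0) (\<lambda>z. snd z * W z)" by (rule C_k_mult[OF C_k_snd WC])
  have d1: "frechet_derivative (\<lambda>z. fst z * W z) (at z) (1, 0) = fst z * W' z (1, 0) + W z" for z
    using frechet_derivative_eqI[OF has_derivative_mult[OF has_derivative_fst[OF has_derivative_ident] W'[of z]], of "(1, 0)"]
    by simp
  have d2: "frechet_derivative (\<lambda>z. snd z * W z) (at z) (0, 1) = snd z * W' z (0, 1) + W z" for z
    using frechet_derivative_eqI[OF has_derivative_mult[OF has_derivative_snd[OF has_derivative_ident] W'[of z]], of "(0, 1)"]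
    by simp
  let ?D = "\<lambda>z. frechet_derivative (\<lambda>z. fst z * W z) (at z) (1, 0) + frechet_derivative (\<lambda>z. snd z * W z) (at z) (0, 1)"
  have div: "2 * \<epsilon> * W z \<le> ?D z" for z
  proof -
    have "fst z * W' z (1, 0) + snd z * W' z (0, 1)
        = - ((1 - \<epsilon>) * (?q z powr (\<epsilon> - 1 - 1) * (2 / 3 * ((fst z)\<^sup>2 + (snd z)\<^sup>2))))"
      by (simp add: W'_def power2_eq_square field_simps)
    moreover have "(1 - \<epsilon>) * (?q z powr (\<epsilon> - 1 - 1) * (2 / 3 * ((fst z)\<^sup>2 + (snd z)\<^sup>2))) \<le> (1 - \<epsilon>) * (?q z powr (\<epsilon> - 1 - 1) * (2 * ?q z))"
      using \<epsilon> by (intro mult_left_mono) (auto simp: reg_square_def)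
    moreover have "?q z powr (\<epsilon> - 1 - 1) * (2 * ?q z) = 2 * W z"
      using q[of z] by (simp add: W_def powr_diff power2_eq_square)
    moreover have "(1 - \<epsilon>) * (2 * W z) = 2 * W z - 2 * \<epsilon> * W z" by (simp add: algebra_simps)
    ultimately have "fst z * W' z (1, 0) + snd z * W' z (0, 1) \<ge> - (2 * W z - 2 * \<epsilon> * W z)"
      by (simp only: neg_le_iff_le)
    moreover have "d \<le> a + w + (b + w)" if "a + b \<ge> - (2 * w - d)" for a b d w :: real
      using that by linarith
    ultimately show ?thesis unfolding d1 d2 by blast
  qed
  have Wb: "W z \<le> 3" if "\<bar>fst z\<bar> = 1 \<or> \<bar>snd z\<bar> = 1" for z
  proof -
    have "(fst z)\<^sup>2 = 1 \<or> (snd z)\<^sup>2 = 1" using that by (metis power2_abs one_power2)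
    then have "1/3 \<le> ?q z" using zero_le_power2[of "fst z"] zero_le_power2[of "snd z"] zero_le_power2[of "reg_length \<epsilon>"]
      unfolding reg_square_def by (auto simp del: zero_le_power2)
    then have "W z \<le> (1/3) powr (\<epsilon> - 1)" unfolding W_def using \<epsilon> by (intro powr_mono2') auto
    also have "\<dots> \<le> (1/3) powr (-1)" using \<epsilon> by (intro powr_mono') auto
    finally show ?thesis by (simp add: powr_minus)
  qed
  have Wc: "continuous_on S W" for S
    using C_k_continuous[OF WC] continuous_on_subset by blast
  have cont: "continuous_on S (\<lambda>z. frechet_derivative (\<lambda>z. fst z * W z) (at z) (1, 0))"
    "continuous_on S (\<lambda>z. frechet_derivative (\<lambda>z. snd z * W z) (at z) (0, 1))" for S
    using C_k_continuous[OF C_k_SucD(2)[OF C1]] C_k_continuous[OF C_k_SucD(2)[OF C2]] continuous_on_subset by blast+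
  have flux: "integral {-1..1::real} (\<lambda>t. W (f t) + W (g t)) \<le> 12"
    if "continuous_on {-1..1} f" "continuous_on {-1..1} g"
      "\<And>t. \<bar>fst (f t)\<bar> = 1 \<or> \<bar>snd (f t)\<bar> = 1" "\<And>t. \<bar>fst (g t)\<bar> = 1 \<or> \<bar>snd (g t)\<bar> = 1" for f g
  proof -
    have "integral {-1..1::real} (\<lambda>t. W (f t) + W (g t)) \<le> integral {-1..1::real} (\<lambda>t. 6)"
    proof (rule integral_le)
      show "(\<lambda>t. W (f t) + W (g t)) integrable_on {-1..1}"
        by (intro integrable_continuous_real continuous_intros continuous_on_compose2[OF Wc[of UNIV]] that) auto
      show "W (f t) + W (g t) \<le> 6" for t using Wb[OF that(3), of t] Wb[OF that(4), of t] by linarith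
    qed auto
    then show ?thesis by simp
  qed
  have "2 * \<epsilon> * integral ?Q W = integral ?Q (\<lambda>z. 2 * \<epsilon> * W z)" by simp
  also have "\<dots> \<le> integral ?Q ?D"
    using div by (intro integral_le integrable_continuous continuous_intros Wc cont) auto
  also have "\<dots> = integral ?Q (\<lambda>z. frechet_derivative (\<lambda>z. fst z * W z) (at z) (1, 0))
      + integral ?Q (\<lambda>z. frechet_derivative (\<lambda>z. snd z * W z) (at z) (0, 1))"
    by (intro Henstock_Kurzweil_Integration.integral_add integrable_continuous cont)
  also have "\<dots> = integral {-1..1} (\<lambda>t. W (1, t) + W (-1, t)) + integral {-1..1} (\<lambda>t. W (t, 1) + W (t, -1))"
    using integral_partial_derivatives_box(1)[OF C1, of "-1" 1 "-1" 1]
      integral_partial_derivatives_box(2)[OF C2, of "-1" 1 "-1" 1] by simp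
  also have "\<dots> \<le> 12 + 12"
    by (intro add_mono flux continuous_intros) auto
  finally have "\<epsilon> * integral ?Q W \<le> 12" by simp
  then show ?thesis using \<epsilon> by (simp add: W_def[abs_def] field_simps)
qed

text \<open>The square \<^const>\<open>core\<close> has side \<open>2 d\<close> with \<open>d =\<close> \<^term>\<open>reg_length \<epsilon>\<close>, so its contribution is of order
  \<open>d\<^bsup>2 \<epsilon>\<^esup> = \<epsilon>\<close>.\<close>

lemma reg_square_powr_le_core:
  assumes \<epsilon>: "0 < \<epsilon>" "\<epsilon> \<le> 1/2"
  shows "(2 * reg_length \<epsilon>)\<^sup>2 * reg_square \<epsilon> z powr (\<epsilon> - 1) \<le> 12 * \<epsilon>"
proof -
  let ?d = "reg_length \<epsilon>"
  have d: "?d > 0" using \<epsilon> reg_length_pos by auto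
  have "reg_square \<epsilon> z powr (\<epsilon> - 1) \<le> (?d\<^sup>2 / 3) powr (\<epsilon> - 1)"
    using \<epsilon> d by (intro powr_mono2') (auto simp: reg_square_def)
  also have "\<dots> = (?d\<^sup>2) powr (\<epsilon> - 1) * (1/3) powr (\<epsilon> - 1)"
    using powr_mult[of "?d\<^sup>2" "1/3" "\<epsilon> - 1"] by simp
  also have "\<dots> \<le> (?d\<^sup>2) powr (\<epsilon> - 1) * 3"
  proof (rule mult_left_mono)
    have "(1/3 :: real) powr (\<epsilon> - 1) \<le> (1/3) powr (-1)" using \<epsilon> by (intro powr_mono') auto
    then show "(1/3 :: real) powr (\<epsilon> - 1) \<le> 3" by (simp add: powr_minus)
  qed simp
  finally have "(2 * ?d)\<^sup>2 * reg_square \<epsilon> z powr (\<epsilon> - 1) \<le> (2 * ?d)\<^sup>2 * ((?d\<^sup>2) powr (\<epsilon> - 1) * 3)"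
    by (rule mult_left_mono) simp
  also have "\<dots> = 12 * (?d\<^sup>2 * (?d\<^sup>2) powr (\<epsilon> - 1))" by (simp add: power_mult_distrib)
  also have "?d\<^sup>2 * (?d\<^sup>2) powr (\<epsilon> - 1) = (?d\<^sup>2) powr \<epsilon>"
    using d by (simp add: powr_diff)
  also have "(?d\<^sup>2) powr \<epsilon> = ?d powr (2 * \<epsilon>)"
    using d by (simp add: powr_powr flip: powr_numeral)
  finally show ?thesis using \<epsilon> by (simp add: reg_length_powr)
qed

text \<open>Up to a constant factor, a bound for the energy density of the local errors.\<close>

definition energy_majorant :: "real \<Rightarrow> real \<times> real \<Rightarrow> real" where
  "energy_majorant \<epsilon> z = layer_majorant \<epsilon> z + \<epsilon>\<^sup>2 * reg_square \<epsilon> z powr (\<epsilon> - 1)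
     + indicator (core \<epsilon>) z * reg_square \<epsilon> z powr (\<epsilon> - 1)"

lemma energy_majorant_integral:
  assumes \<epsilon>: "0 < \<epsilon>" "\<epsilon> \<le> 1/2"
  shows "integrable (lebesgue_on (cbox (-1, -1) (1, 1))) (energy_majorant \<epsilon>)" (is ?int)
    and "(\<integral>z. energy_majorant \<epsilon> z \<partial>lebesgue_on (cbox (-1, -1) (1, 1))) \<le> 72 * \<epsilon>" (is ?le)
proof -
  let ?Q = "cbox (-1, -1) (1, 1) :: (real \<times> real) set" and ?W = "\<lambda>z. reg_square \<epsilon> z powr (\<epsilon> - 1)"
  let ?M = "lebesgue_on ?Q"
  have lbc: "(\<integral>z. f z \<partial>?M) = integral ?Q f" if "continuous_on ?Q f" for f :: "real \<times> real \<Rightarrow> real"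
    using that by (intro lebesgue_integral_eq_integral continuous_imp_integrable) auto
  have zeta: "integrable ?M (\<lambda>z. 2 / (1 + (l z / \<epsilon>)\<^sup>2))" "(\<integral>z. 2 / (1 + (l z / \<epsilon>)\<^sup>2) \<partial>?M) \<le> 16 * \<epsilon>"
    if l: "\<And>z. (l has_derivative l') (at z)" "l' (1, 0) = -1 \<or> l' (0, 1) = -1" for l l'
  proof -
    have "continuous_on ?Q l"
      by (rule continuous_at_imp_continuous_on) (simp add: has_derivative_continuous[OF l(1)])
    moreover have pos: "1 + (t::real)\<^sup>2 \<noteq> 0" for t by (smt (verit) zero_le_power2)
    ultimately have c: "continuous_on ?Q (\<lambda>z. 2 / (1 + (l z / \<epsilon>)\<^sup>2))"
      using \<epsilon> by (auto intro!: continuous_intros simp: pos)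
    then show "integrable ?M (\<lambda>z. 2 / (1 + (l z / \<epsilon>)\<^sup>2))" by (rule continuous_imp_integrable)
    show "(\<integral>z. 2 / (1 + (l z / \<epsilon>)\<^sup>2) \<partial>?M) \<le> 16 * \<epsilon>"
      unfolding lbc[OF c] by (rule integral_arctan_le[OF \<epsilon>(1) l])
  qed
  have "((\<lambda>z :: real \<times> real. 1 - fst z) has_derivative (\<lambda>v. - fst v)) (at z)"
    "((\<lambda>z :: real \<times> real. 1 - snd z) has_derivative (\<lambda>v. - snd v)) (at z)" for z
    by (auto intro!: derivative_eq_intros)
  note z1 = zeta[OF corner_has_derivative, simplified] and z2 = zeta[OF this(1), simplified] and z3 = zeta[OF this(2), simplified]
  have WC: "continuous_on ?Q ?W"
    using C_k_continuous[OF C_k_powr[OF C_k_reg_square reg_square_pos[OF \<epsilon>(1)], of 0]] continuous_on_subset by blast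
  have Wi: "integrable ?M ?W" using WC by (rule continuous_imp_integrable)
  have W: "(\<integral>z. \<epsilon>\<^sup>2 * ?W z \<partial>?M) \<le> 12 * \<epsilon>"
  proof -
    have "(\<integral>z. \<epsilon>\<^sup>2 * ?W z \<partial>?M) = \<epsilon>\<^sup>2 * integral ?Q ?W" using Wi by (simp add: lbc[OF WC])
    also have "\<dots> \<le> \<epsilon>\<^sup>2 * (12 / \<epsilon>)" by (intro mult_left_mono integral_reg_square_powr_le \<epsilon>) simp
    also have "\<dots> = 12 * \<epsilon>" using \<epsilon> by (simp add: power2_eq_square)
    finally show ?thesis .
  qed
  let ?d = "reg_length \<epsilon>"
  have d: "0 < ?d" "?d \<le> 1" using \<epsilon> by (auto intro: reg_length_pos reg_length_le_1)
  have coreQ: "core \<epsilon> \<subseteq> ?Q"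
    using d by (auto simp: core_def mem_box_pair cbox_Pair_eq)
  have core_sets: "core \<epsilon> \<in> sets ?M"
    using coreQ by (simp add: sets_restrict_space_iff) (simp add: core_def)
  have ci: "integrable ?M (\<lambda>z. indicator (core \<epsilon>) z * ?W z)"
    using integrable_mult_indicator[OF core_sets Wi] by simp
  have c: "(\<integral>z. indicator (core \<epsilon>) z * ?W z \<partial>?M) \<le> 12 * \<epsilon>"
  proof -
    have mc: "measure ?M (core \<epsilon>) = (2 * ?d)\<^sup>2"
      using coreQ measure_box_pair[of "- ?d" ?d "- ?d" ?d] d
      by (simp add: measure_restrict_space core_def power2_eq_square)
    have "(\<integral>z. indicator (core \<epsilon>) z * ?W z \<partial>?M) \<le> (\<integral>z. (12 * \<epsilon> / (2 * ?d)\<^sup>2) * indicator (core \<epsilon>) z \<partial>?M)"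
    proof (rule Bochner_Integration.integral_mono[OF ci])
      have "emeasure ?M (core \<epsilon>) < \<infinity>"
        using finite_measure.emeasure_finite[OF finite_measure_lebesgue_on[of ?Q], of "core \<epsilon>"]
        by (simp add: less_top lmeasurable_cbox)
      then show "integrable ?M (\<lambda>z. (12 * \<epsilon> / (2 * ?d)\<^sup>2) * indicator (core \<epsilon>) z)"
        using core_sets by (intro integrable_mult_right integrable_real_indicator)
      fix z
      have "?W z \<le> 12 * \<epsilon> / (2 * ?d)\<^sup>2"
        using reg_square_powr_le_core[OF \<epsilon>, of z] d by (simp add: field_simps)
      then show "indicator (core \<epsilon>) z * ?W z \<le> (12 * \<epsilon> / (2 * ?d)\<^sup>2) * indicator (core \<epsilon>) z"
        by (simp add: indicator_def)
    qed
    also have "\<dots> = (12 * \<epsilon> / (2 * ?d)\<^sup>2) * measure ?M (core \<epsilon>)"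
      using coreQ by (simp add: Int_absorb2)
    also have "\<dots> = 12 * \<epsilon>" using d by (simp add: mc)
    finally show ?thesis .
  qed
  have eq: "energy_majorant \<epsilon> = (\<lambda>z. 2 / (1 + (corner z / \<epsilon>)\<^sup>2) + 2 / (1 + ((1 - fst z) / \<epsilon>)\<^sup>2)
      + 2 / (1 + ((1 - snd z) / \<epsilon>)\<^sup>2) + \<epsilon>\<^sup>2 * ?W z + indicator (core \<epsilon>) z * ?W z)"
    by (simp add: energy_majorant_def[abs_def] layer_majorant_def[abs_def])
  have Wi2: "integrable ?M (\<lambda>z. \<epsilon>\<^sup>2 * ?W z)" using Wi by simp
  note ints = z1(1) z2(1) z3(1) Wi2 ci
  show ?int unfolding eq by (intro Bochner_Integration.integrable_add ints)
  have "(\<integral>z. energy_majorant \<epsilon> z \<partial>?M) = (\<integral>z. 2 / (1 + (corner z / \<epsilon>)\<^sup>2) \<partial>?M) + (\<integral>z. 2 / (1 + ((1 - fst z) / \<epsilon>)\<^sup>2) \<partial>?M)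
      + (\<integral>z. 2 / (1 + ((1 - snd z) / \<epsilon>)\<^sup>2) \<partial>?M) + (\<integral>z. \<epsilon>\<^sup>2 * ?W z \<partial>?M) + (\<integral>z. indicator (core \<epsilon>) z * ?W z \<partial>?M)"
    unfolding eq by (simp only: Bochner_Integration.integral_add Bochner_Integration.integrable_add ints)
  then show ?le using z1(2) z2(2) z3(2) W c by linarith
qed

section \<open>Failure of the localization\<close>

lemma small_local_large_global_error:
  obtains D where "D > 0"
    and "\<And>\<epsilon>. 0 < \<epsilon> \<Longrightarrow> \<epsilon> \<le> 1/2 \<Longrightarrow> \<exists>u\<in>H10 Omega. global_error \<epsilon> u \<ge> 1/6 - D * \<epsilon>
      \<and> (\<forall>K\<in>Triangulation. element_error \<epsilon> K u \<le> D * \<epsilon>) \<and> (\<forall>F. patch_error \<epsilon> (edge_patch F) u \<le> D * \<epsilon>)"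
proof -
  obtain M where M: "M \<ge> 1" "\<And>t. \<bar>deriv smooth_step t\<bar> \<le> M"
    using smooth_step_deriv_bounded by blast
  define D where "D = 968 * M\<^sup>2 * 72"
  let ?Q = "cbox (-1, -1) (1, 1) :: (real \<times> real) set"
  have main: "\<exists>u\<in>H10 Omega. global_error \<epsilon> u \<ge> 1/6 - D * \<epsilon>
      \<and> (\<forall>K\<in>Triangulation. element_error \<epsilon> K u \<le> D * \<epsilon>) \<and> (\<forall>F. patch_error \<epsilon> (edge_patch F) u \<le> D * \<epsilon>)"
    if \<epsilon>: "0 < \<epsilon>" "\<epsilon> \<le> 1/2" for \<epsilon>
  proof -
    define u where "u = singular_function \<epsilon>"
    define E where "E z = 968 * M\<^sup>2 * energy_majorant \<epsilon> z" for z
    have test: "u \<in> test_functions Omega" unfolding u_def by (rule singular_function_test_function[OF \<epsilon>(1)])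
    have C1: "C_k (Suc 0) u" by (rule test_function_C_k[OF test])
    have E_int: "integrable (lebesgue_on ?Q) E"
      unfolding E_def[abs_def] by (intro integrable_mult_right energy_majorant_integral \<epsilon>)
    have E_le: "(\<integral>z. E z \<partial>lebesgue_on ?Q) \<le> D * \<epsilon>"
      using mult_left_mono[OF energy_majorant_integral(2)[OF \<epsilon>], of "968 * M\<^sup>2"] by (simp add: E_def D_def)
    have E_nonneg: "0 \<le> E z" for z
      by (auto simp: E_def energy_majorant_def layer_majorant_def intro!: mult_nonneg_nonneg add_nonneg_nonneg divide_nonneg_nonneg)
    have T: "z \<in> ?Q" if "z \<in> \<Union>Triangulation" for z using that Triangulation_subset_box by blast
    have le_E: "k * (a + b) \<le> E z"
      if "k \<le> 968 * M\<^sup>2" "a \<le> layer_majorant \<epsilon> z" "b \<le> \<epsilon>\<^sup>2 * reg_square \<epsilon> z powr (\<epsilon> - 1) + indicator (core \<epsilon>) z * reg_square \<epsilon> z powr (\<epsilon> - 1)" "0 \<le> a + b"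
      for k a b z
      unfolding E_def energy_majorant_def using that by (intro mult_mono) auto
    have nn: "0 \<le> indicator (core \<epsilon>) z * reg_square \<epsilon> z powr (\<epsilon> - 1)" for z by simp
    have lay: "0 \<le> layer \<epsilon> z" for z by (simp add: layer_def)
    have K1: "(norm (grad u z + (1, 1)))\<^sup>2 \<le> E z" if "z \<in> K1" for z
    proof -
      have zT: "z \<in> \<Union>Triangulation" using that by (auto simp: Triangulation_def)
      have "192 * M\<^sup>2 * (layer \<epsilon> z + (\<epsilon>\<^sup>2 * reg_square \<epsilon> z powr (\<epsilon> - 1) + indicator (core \<epsilon>) z * reg_square \<epsilon> z powr (\<epsilon> - 1))) \<le> E z"
        by (rule le_E[OF _ layer_le_majorant[OF \<epsilon>(1) zT]]) (simp_all add: lay)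
      then show ?thesis using grad_singular_function_K1[OF \<epsilon> M that] unfolding u_def add.assoc by linarith
    qed
    have K: "\<epsilon>\<^sup>2 * (norm (grad u z))\<^sup>2 \<le> E z" "\<epsilon>\<^sup>2 * (norm (grad u z + (1, 1)))\<^sup>2 \<le> E z" if "z \<in> \<Union>Triangulation" for z
    proof -
      have "968 * M\<^sup>2 * (layer \<epsilon> z + \<epsilon>\<^sup>2 * reg_square \<epsilon> z powr (\<epsilon> - 1)) \<le> E z"
        by (rule le_E[OF _ layer_le_majorant[OF \<epsilon>(1) that]]) (simp_all add: lay)
      then show "\<epsilon>\<^sup>2 * (norm (grad u z))\<^sup>2 \<le> E z" "\<epsilon>\<^sup>2 * (norm (grad u z + (1, 1)))\<^sup>2 \<le> E z"
        using grad_singular_function[OF \<epsilon> M T[OF that]] unfolding u_def by linarith+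
    qed
    have K4: "grad u z = 0" if "fst z \<le> 0" "snd z \<le> 0" for z
      unfolding u_def using that by (intro grad_singular_function_eq_0 \<epsilon>) auto
    have "(\<integral>z. (norm (grad u z + (1, 1)))\<^sup>2 \<partial>lebesgue_on (box (0, 0) (1/2, 1/2))) \<le> (\<integral>z. E z \<partial>lebesgue_on ?Q)"
    proof (rule integral_mono_lebesgue_on_AE[OF E_int])
      show "AE z in lebesgue_on (box (0, 0) (1/2, 1/2)). (norm (grad u z + (1, 1)))\<^sup>2 \<le> E z"
        by (rule AE_I2, rule K1) (auto simp: mem_box_pair K1_eq)
      show "box (0, 0) (1/2, 1/2) \<subseteq> ?Q" by (auto simp: mem_box_pair cbox_Pair_eq)
    qed (use E_nonneg in auto)
    also note E_le
    finally have "global_error \<epsilon> u \<ge> 1/6 - D * \<epsilon>"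
      by (intro global_error_ge[OF test]) (auto intro: K4 simp: mem_box_pair)
    moreover have "u \<in> H10 Omega" by (rule test_function_in_H10[OF test open_Omega bounded_Omega])
    moreover have "z \<in> K4 \<Longrightarrow> grad u z = 0" for z by (rule K4) (auto simp: K4_eq)
    note local = local_errors_le[OF C1 E_int E_nonneg K1 this K]
    have "\<forall>K\<in>Triangulation. element_error \<epsilon> K u \<le> D * \<epsilon>" using local(1) E_le by (meson order_trans)
    moreover have "\<forall>F. patch_error \<epsilon> (edge_patch F) u \<le> D * \<epsilon>" using local(2) E_le by (meson order_trans)
    ultimately show ?thesis by blast
  qed
  have "D > 0" using M(1) by (simp add: D_def)
  then show thesis using main that by blast
qed

text \<open>For \<open>err\<close> the sum of the element errors or of the patch errors is inserted.\<close>

lemma no_uniform_constant: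
  fixes err :: "real \<Rightarrow> (real \<times> real \<Rightarrow> real) \<Rightarrow> real"
  assumes "c > 0" "D > 0" "0 < \<epsilon>\<^sub>0" "\<epsilon>\<^sub>0 \<le> 1"
    and ex: "\<And>\<epsilon>. 0 < \<epsilon> \<Longrightarrow> \<epsilon> < \<epsilon>\<^sub>0 \<Longrightarrow> \<exists>u\<in>H10 Omega. c \<le> global_error \<epsilon> u \<and> err \<epsilon> u \<le> D * \<epsilon>"
    and nonneg: "\<And>\<epsilon> u. 0 \<le> err \<epsilon> u"
  shows "\<not> (\<exists>C. \<forall>u\<in>H10 Omega. \<forall>\<epsilon>. 0 < \<epsilon> \<and> \<epsilon> < 1 \<longrightarrow> global_error \<epsilon> u \<le> C * err \<epsilon> u)"
proof
  assume "\<exists>C. \<forall>u\<in>H10 Omega. \<forall>\<epsilon>. 0 < \<epsilon> \<and> \<epsilon> < 1 \<longrightarrow> global_error \<epsilon> u \<le> C * err \<epsilon> u"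
  then obtain C where C: "\<And>u \<epsilon>. u \<in> H10 Omega \<Longrightarrow> 0 < \<epsilon> \<Longrightarrow> \<epsilon> < 1 \<Longrightarrow> global_error \<epsilon> u \<le> C * err \<epsilon> u"
    by blast
  define k where "k = (\<bar>C\<bar> + 1) * D"
  have k: "k > 0" using assms(2) by (simp add: k_def)
  define \<epsilon> where "\<epsilon> = min (\<epsilon>\<^sub>0 / 2) (c / (2 * k))"
  have \<epsilon>: "0 < \<epsilon>" "\<epsilon> < \<epsilon>\<^sub>0" "\<epsilon> < 1" using assms k by (auto simp: \<epsilon>_def min_less_iff_disj)
  obtain u where u: "u \<in> H10 Omega" "c \<le> global_error \<epsilon> u" "err \<epsilon> u \<le> D * \<epsilon>"
    using ex[OF \<epsilon>(1,2)] by blast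
  have "c \<le> C * err \<epsilon> u" using C[OF u(1) \<epsilon>(1,3)] u(2) by linarith
  also have "\<dots> \<le> (\<bar>C\<bar> + 1) * (D * \<epsilon>)" using u(3) nonneg by (intro mult_mono) auto
  also have "\<dots> = k * \<epsilon>" by (simp add: k_def)
  also have "\<dots> \<le> k * (c / (2 * k))" using k by (intro mult_left_mono) (auto simp: \<epsilon>_def)
  also have "\<dots> = c / 2" using k by simp
  finally show False using assms(1) by simp
qed

theorem mainTheorem2:
  shows "(\<exists>c>0. \<exists>C>0. \<exists>\<epsilon>\<^sub>0>0. \<epsilon>\<^sub>0 \<le> 1 \<and>
           (\<forall>\<epsilon>. 0 < \<epsilon> \<and> \<epsilon> < \<epsilon>\<^sub>0 \<longrightarrow>
             (\<exists>u\<in>H10 Omega. global_error \<epsilon> u \<ge> c \<and>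
                (\<Sum>K\<in>Triangulation. element_error \<epsilon> K u) \<le> C * \<epsilon>)))
       \<and> \<not> (\<exists>C'. \<forall>u\<in>H10 Omega. \<forall>\<epsilon>. 0 < \<epsilon> \<and> \<epsilon> < 1 \<longrightarrow>
             global_error \<epsilon> u \<le> C' * (\<Sum>K\<in>Triangulation. element_error \<epsilon> K u))
       \<and> \<not> (\<exists>C''. \<forall>u\<in>H10 Omega. \<forall>\<epsilon>. 0 < \<epsilon> \<and> \<epsilon> < 1 \<longrightarrow>
             global_error \<epsilon> u \<le> C'' * (\<Sum>F\<in>interior_edges. patch_error \<epsilon> (edge_patch F) u))"
proof -
  obtain D where D: "D > 0"
    and ex: "\<And>\<epsilon>. 0 < \<epsilon> \<Longrightarrow> \<epsilon> \<le> 1/2 \<Longrightarrow> \<exists>u\<in>H10 Omega. global_error \<epsilon> u \<ge> 1/6 - D * \<epsilon>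
      \<and> (\<forall>K\<in>Triangulation. element_error \<epsilon> K u \<le> D * \<epsilon>) \<and> (\<forall>F. patch_error \<epsilon> (edge_patch F) u \<le> D * \<epsilon>)"
    using small_local_large_global_error by metis
  define N where "N = real (card Triangulation) + real (card interior_edges) + 1"
  have N: "N > 0" by (simp add: N_def)
  define \<epsilon>0 where "\<epsilon>0 = min (1/2) (1 / (12 * D))"
  have \<epsilon>0: "0 < \<epsilon>0" "\<epsilon>0 \<le> 1" using D by (auto simp: \<epsilon>0_def)
  have ex': "\<exists>u\<in>H10 Omega. 1/12 \<le> global_error \<epsilon> u \<and> (\<Sum>K\<in>Triangulation. element_error \<epsilon> K u) \<le> N * D * \<epsilon>
      \<and> (\<Sum>F\<in>interior_edges. patch_error \<epsilon> (edge_patch F) u) \<le> N * D * \<epsilon>"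
    if \<epsilon>: "0 < \<epsilon>" "\<epsilon> < \<epsilon>0" for \<epsilon>
  proof -
    have "\<epsilon> \<le> 1/2" using \<epsilon> by (simp add: \<epsilon>0_def)
    then obtain u where u: "u \<in> H10 Omega" "global_error \<epsilon> u \<ge> 1/6 - D * \<epsilon>"
      "\<And>K. K \<in> Triangulation \<Longrightarrow> element_error \<epsilon> K u \<le> D * \<epsilon>" "\<And>F. patch_error \<epsilon> (edge_patch F) u \<le> D * \<epsilon>"
      using ex[OF \<epsilon>(1)] by blast
    have "\<epsilon> < 1 / (12 * D)" using \<epsilon> by (simp add: \<epsilon>0_def)
    then have "D * \<epsilon> \<le> 1/12" using D by (simp add: field_simps)
    then have "1/12 \<le> global_error \<epsilon> u" using u(2) by linarith
    moreover have "(\<Sum>K\<in>Triangulation. element_error \<epsilon> K u) \<le> real (card Triangulation) * (D * \<epsilon>)"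
      by (rule sum_bounded_above) (rule u(3))
    moreover have "real (card Triangulation) * (D * \<epsilon>) \<le> N * (D * \<epsilon>)"
      using D \<epsilon> by (intro mult_right_mono) (auto simp: N_def)
    moreover have "(\<Sum>F\<in>interior_edges. patch_error \<epsilon> (edge_patch F) u) \<le> real (card interior_edges) * (D * \<epsilon>)"
      by (rule sum_bounded_above) (rule u(4))
    moreover have "real (card interior_edges) * (D * \<epsilon>) \<le> N * (D * \<epsilon>)"
      using D \<epsilon> by (intro mult_right_mono) (auto simp: N_def)
    ultimately show ?thesis using u(1) unfolding mult.assoc by (meson order_trans)
  qed
  have ND: "N * D > 0" using N D by simp
  show ?thesis
  proof (intro conjI)
    show "\<exists>c>0. \<exists>C>0. \<exists>\<epsilon>\<^sub>0>0. \<epsilon>\<^sub>0 \<le> 1 \<and>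
           (\<forall>\<epsilon>. 0 < \<epsilon> \<and> \<epsilon> < \<epsilon>\<^sub>0 \<longrightarrow>
             (\<exists>u\<in>H10 Omega. global_error \<epsilon> u \<ge> c \<and>
                (\<Sum>K\<in>Triangulation. element_error \<epsilon> K u) \<le> C * \<epsilon>))"
    proof -
      have "\<forall>\<epsilon>. 0 < \<epsilon> \<and> \<epsilon> < \<epsilon>0 \<longrightarrow> (\<exists>u\<in>H10 Omega. global_error \<epsilon> u \<ge> 1/12 \<and>
          (\<Sum>K\<in>Triangulation. element_error \<epsilon> K u) \<le> N * D * \<epsilon>)"
        using ex' by blast
      with \<epsilon>0 have "\<exists>\<epsilon>\<^sub>0>0. \<epsilon>\<^sub>0 \<le> 1 \<and> (\<forall>\<epsilon>. 0 < \<epsilon> \<and> \<epsilon> < \<epsilon>\<^sub>0 \<longrightarrow>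
          (\<exists>u\<in>H10 Omega. global_error \<epsilon> u \<ge> 1/12 \<and> (\<Sum>K\<in>Triangulation. element_error \<epsilon> K u) \<le> N * D * \<epsilon>))"
        by blast
      moreover have "(1/12 :: real) > 0" by simp
      ultimately show ?thesis using ND by blast
    qed
    show "\<not> (\<exists>C'. \<forall>u\<in>H10 Omega. \<forall>\<epsilon>. 0 < \<epsilon> \<and> \<epsilon> < 1 \<longrightarrow>
             global_error \<epsilon> u \<le> C' * (\<Sum>K\<in>Triangulation. element_error \<epsilon> K u))"
    proof (rule no_uniform_constant[OF _ ND \<epsilon>0])
      show "(1/12 :: real) > 0" by simp
    qed (use ex' in blast, intro sum_nonneg element_error_nonneg)
    show "\<not> (\<exists>C''. \<forall>u\<in>H10 Omega. \<forall>\<epsilon>. 0 < \<epsilon> \<and> \<epsilon> < 1 \<longrightarrow>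
             global_error \<epsilon> u \<le> C'' * (\<Sum>F\<in>interior_edges. patch_error \<epsilon> (edge_patch F) u))"
    proof (rule no_uniform_constant[OF _ ND \<epsilon>0])
      show "(1/12 :: real) > 0" by simp
    qed (use ex' in blast, intro sum_nonneg patch_error_nonneg)
  qed
qed

end
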